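(* Let $p$ be a prime and let $R$ be an $\mathbf{F}_p$-algebra. Then the endomorphism $\varphi^{\ast}\colon\mathcal{W}\Omega^{\ast}_R\to\mathcal{W}\Omega^{\ast}_R$ of the saturated de Rham–Witt complex induced by the Frobenius endomorphism $\varphi\colon R\to R$ is a $p$-isogeny: that is, it induces an isomorphism after inverting the prime $p$. Moreover, if $d\ge0$ is an integer such that the $R$-module $\Omega^1_R$ of Kähler differentials can be locally (on $\mathrm{Spec}(R)$) generated by $\le d$ elements, then multiplication by $p^d$ on $\mathcal{W}\Omega^{\ast}_R$ factors through $\varphi^{\ast}$.
   Context: Fix a prime $p$. A Dieudonné complex is a cochain complex of abelian groups $(M^{\ast},d)$ with a map of graded abelian groups $F\colon M^{\ast}\to M^{\ast}$ satisfying $dF=pFd$. It is saturated if it is $p$-torsion-free and for all $n$, $F$ induces an isomorphism $M^n\to\{x\in M^n:dx\in pM^{n+1}\}$; then the Verschiebung $V$ is the unique map with $F(Vx)=px$. For saturated $M^{\ast}$ put $\mathcal{W}_r(M)^{\ast}=M^{\ast}/(\mathrm{im}(V^r)+\mathrm{im}(dV^r))$ and $\mathcal{W}(M)^{\ast}=\varprojlim_r\mathcal{W}_r(M)^{\ast}$. $M^{\ast}$ is strict if it is saturated and $M^{\ast}\to\mathcal{W}(M)^{\ast}$ is an isomorphism. A Dieudonné algebra is a commutative differential graded algebra $(A^{\ast},d)$ (graded-commutative, $x^2=0$ for homogeneous $x$ of odd degree, $d$ satisfying the Leibniz rule) with a graded ring homomorphism $F$ such that $dF=pFd$, $A^n=0$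 for $n<0$, and $Fx\equiv x^p\pmod p$ for $x\in A^0$; morphisms are graded ring homomorphisms commuting with $d$ and $F$; it is strict if its underlying Dieudonné complex is. For an $\mathbf{F}_p$-algebra $R$, the saturated de Rham–Witt complex $\mathcal{W}\Omega^{\ast}_R$ is the strict Dieudonné algebra with a ring homomorphism $R\to\mathcal{W}\Omega^0_R/V\mathcal{W}\Omega^0_R$ such that for every strict Dieudonné algebra $B^{\ast}$ composition induces a bijection from morphisms $\mathcal{W}\Omega^{\ast}_R\to B^{\ast}$ to ring homomorphisms $R\to B^0/VB^0$. It exists for every $R$, is unique up to unique isomorphism, and is functorial in $R$. "Multiplication by $p^d$ factors through $\varphi^{\ast}$" means that $p^d=\varphi^{\ast}\circ\psi$ for some map of cochain complexes $\psi\colon\mathcal{W}\Omega^{\ast}_R\to\mathcal{W}\Omega^{\ast}_R$. *)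

theory Defs
  imports "HOL-Algebra.QuotRing" "HOL-Algebra.Module" "HOL-Computational_Algebra.Primes"
begin

section \<open>Cochain complexes and Dieudonne complexes\<close>

text \<open>
  A graded abelian group is represented by its total group (the direct sum of the homogeneous
  parts), together with the family of homogeneous parts. The fields \<open>mult\<close> and \<open>one\<close> of the
  record play no role until algebras are considered.
\<close>

record 'a cochain = "'a ring" +
  grade :: "int \<Rightarrow> 'a set"
  differential :: "'a \<Rightarrow> 'a"

record 'a dieudonne = "'a cochain" +
  Frob :: "'a \<Rightarrow> 'a"

locale cochain_complex = abelian_group M
  for M :: "('a, 'm) cochain_scheme" (structure) +
  assumes grade_subgroup: "additive_subgroup (grade M n) M"
    and grade_direct_sum: "x \<in> carrier M \<Longrightarrow>
      \<exists>!c. (\<forall>n. c n \<in> grade M n) \<and> finite {n. c n \<noteq> \<zero>} \<and> x = (\<Oplus>n\<in>{n. c n \<noteq> \<zero>}. c n)"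
    and differential_hom: "differential M \<in> hom (add_monoid M) (add_monoid M)"
    and differential_grade: "x \<in> grade M n \<Longrightarrow> differential M x \<in> grade M (n + 1)"
    and differential_square: "x \<in> carrier M \<Longrightarrow> differential M (differential M x) = \<zero>"

definition cochain_hom ::
  "('a, 'm) cochain_scheme \<Rightarrow> ('b, 'n) cochain_scheme \<Rightarrow> ('a \<Rightarrow> 'b) set" where
  "cochain_hom M N = {f \<in> hom (add_monoid M) (add_monoid N).
     (\<forall>n. \<forall>x\<in>grade M n. f x \<in> grade N n) \<and>
     (\<forall>x\<in>carrier M. f (differential M x) = differential N (f x))}"

definition cochain_iso ::
  "('a, 'm) cochain_scheme \<Rightarrow> ('b, 'n) cochain_scheme \<Rightarrow> ('a \<Rightarrow> 'b) set" where
  "cochain_iso M N = {f \<in> cochain_hom M N. \<forall>n. bij_betw f (grade M n) (grade N n)}"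

locale dieudonne_complex = cochain_complex M
  for p :: nat and M :: "('a, 'm) dieudonne_scheme" (structure) +
  assumes Frob_hom: "Frob M \<in> hom (add_monoid M) (add_monoid M)"
    and Frob_grade: "x \<in> grade M n \<Longrightarrow> Frob M x \<in> grade M n"
    and differential_Frob:
      "x \<in> carrier M \<Longrightarrow> differential M (Frob M x) = [p] \<cdot> Frob M (differential M x)"

locale saturated_dieudonne_complex = dieudonne_complex p M
  for p :: nat and M :: "('a, 'm) dieudonne_scheme" (structure) +
  assumes p_torsion_free: "x \<in> carrier M \<Longrightarrow> [p] \<cdot> x = \<zero> \<Longrightarrow> x = \<zero>"
    and Frob_bij: "bij_betw (Frob M) (grade M n)
      {x \<in> grade M n. \<exists>y\<in>grade M (n + 1). differential M x = [p] \<cdot> y}"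

definition Ver :: "nat \<Rightarrow> ('a, 'm) dieudonne_scheme \<Rightarrow> 'a \<Rightarrow> 'a" where
  "Ver p M x = (THE y. y \<in> carrier M \<and> Frob M y = [p] \<cdot>\<^bsub>M\<^esub> x)"

text \<open>The subgroup \<open>im(V\<^sup>r) + im(dV\<^sup>r)\<close>.\<close>

definition Ver_filtration :: "nat \<Rightarrow> ('a, 'm) dieudonne_scheme \<Rightarrow> nat \<Rightarrow> 'a set" where
  "Ver_filtration p M r =
     ((Ver p M ^^ r) ` carrier M) <+>\<^bsub>M\<^esub> ((\<lambda>x. differential M ((Ver p M ^^ r) x)) ` carrier M)"

text \<open>
  The degree \<open>n\<close> part of \<open>\<W>\<^sub>r(M)\<close> is the image of \<open>M\<^sup>n\<close> in the quotient of the total group; the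
  degree \<open>n\<close> part of \<open>\<W>(M)\<close> is the limit along the transition maps
  \<open>C \<mapsto> Fil\<^sub>r + C\<close> from \<open>\<W>\<^sub>r\<^sub>+\<^sub>1(M)\<close> to \<open>\<W>\<^sub>r(M)\<close>.
\<close>

definition Witt_trunc :: "nat \<Rightarrow> ('a, 'm) dieudonne_scheme \<Rightarrow> nat \<Rightarrow> int \<Rightarrow> 'a set set" where
  "Witt_trunc p M r n = (\<lambda>x. Ver_filtration p M r +>\<^bsub>M\<^esub> x) ` grade M n"

definition Witt_completion :: "nat \<Rightarrow> ('a, 'm) dieudonne_scheme \<Rightarrow> int \<Rightarrow> (nat \<Rightarrow> 'a set) set" where
  "Witt_completion p M n = {c. (\<forall>r. c r \<in> Witt_trunc p M r n) \<and>
     (\<forall>r. Ver_filtration p M r <+>\<^bsub>M\<^esub> c (Suc r) = c r)}"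

locale strict_dieudonne_complex = saturated_dieudonne_complex p M
  for p :: nat and M :: "('a, 'm) dieudonne_scheme" (structure) +
  assumes completion_bij:
    "bij_betw (\<lambda>x r. Ver_filtration p M r +> x) (grade M n) (Witt_completion p M n)"


section \<open>Dieudonne algebras\<close>

locale dieudonne_algebra = dieudonne_complex p A + ring A
  for p :: nat and A :: "('a, 'm) dieudonne_scheme" (structure) +
  assumes one_grade: "\<one> \<in> grade A 0"
    and mult_grade: "x \<in> grade A m \<Longrightarrow> y \<in> grade A n \<Longrightarrow> x \<otimes> y \<in> grade A (m + n)"
    and graded_comm: "x \<in> grade A m \<Longrightarrow> y \<in> grade A n \<Longrightarrow>
      x \<otimes> y = (if even (m * n) then y \<otimes> x else \<ominus> (y \<otimes> x))"
    and odd_square: "odd n \<Longrightarrow> x \<in> grade A n \<Longrightarrow> x \<otimes> x = \<zero>"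
    and Leibniz: "x \<in> grade A m \<Longrightarrow> y \<in> grade A n \<Longrightarrow>
      differential A (x \<otimes> y) = (differential A x \<otimes> y) \<oplus>
        (if even m then x \<otimes> differential A y else \<ominus> (x \<otimes> differential A y))"
    and Frob_ring_hom: "Frob A \<in> ring_hom A A"
    and negative_grade: "n < 0 \<Longrightarrow> grade A n = {\<zero>}"
    and Frob_lift: "x \<in> grade A 0 \<Longrightarrow> \<exists>y\<in>grade A 0. Frob A x = x [^] p \<oplus> [p] \<cdot> y"

locale strict_dieudonne_algebra = dieudonne_algebra p A + strict_dieudonne_complex p A
  for p :: nat and A :: "('a, 'm) dieudonne_scheme" (structure)

text \<open>
  Sets of homomorphisms are taken in the extensional function space, so that two homomorphisms
  are equal as soon as they agree on the carrier.
\<close>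

definition dieudonne_alg_hom ::
  "('a, 'm) dieudonne_scheme \<Rightarrow> ('b, 'n) dieudonne_scheme \<Rightarrow> ('a \<Rightarrow> 'b) set" where
  "dieudonne_alg_hom A B = {f \<in> ring_hom A B. f \<in> extensional (carrier A) \<and>
     (\<forall>n. \<forall>x\<in>grade A n. f x \<in> grade B n) \<and>
     (\<forall>x\<in>carrier A. f (differential A x) = differential B (f x)) \<and>
     (\<forall>x\<in>carrier A. f (Frob A x) = Frob B (f x))}"

definition ring_hom_ext ::
  "('a, 'm) ring_scheme \<Rightarrow> ('b, 'n) ring_scheme \<Rightarrow> ('a \<Rightarrow> 'b) set" where
  "ring_hom_ext R S = ring_hom R S \<inter> extensional (carrier R)"

definition degree_zero :: "('a, 'm) dieudonne_scheme \<Rightarrow> 'a ring" where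
  "degree_zero A =
    \<lparr>carrier = grade A 0, monoid.mult = monoid.mult A, one = one A, zero = zero A, add = add A\<rparr>"

definition mod_V :: "nat \<Rightarrow> ('a, 'm) dieudonne_scheme \<Rightarrow> 'a set ring" where
  "mod_V p A = degree_zero A Quot (Ver p A ` grade A 0)"

definition mod_V_map ::
  "nat \<Rightarrow> ('b, 'n) dieudonne_scheme \<Rightarrow> ('a \<Rightarrow> 'b) \<Rightarrow> 'a set \<Rightarrow> 'b set" where
  "mod_V_map p B f C = (\<Union>x\<in>C. (Ver p B ` grade B 0) +>\<^bsub>degree_zero B\<^esub> f x)"


section \<open>The saturated de Rham--Witt complex\<close>

text \<open>
  \<open>R\<close> carries a (then unique) \<open>F\<^sub>p\<close>-algebra structure iff \<open>p = 0\<close> in \<open>R\<close>.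
\<close>

definition Fp_algebra :: "nat \<Rightarrow> ('a, 'm) ring_scheme \<Rightarrow> bool" where
  "Fp_algebra p R \<longleftrightarrow> cring R \<and> [p] \<cdot>\<^bsub>R\<^esub> \<one>\<^bsub>R\<^esub> = \<zero>\<^bsub>R\<^esub>"

definition precompose ::
  "nat \<Rightarrow> ('r, 'm) ring_scheme \<Rightarrow> ('b, 'n) dieudonne_scheme \<Rightarrow> ('r \<Rightarrow> 'a set) \<Rightarrow>
   ('a \<Rightarrow> 'b) \<Rightarrow> 'r \<Rightarrow> 'b set" where
  "precompose p R B \<iota> f = (\<lambda>r\<in>carrier R. mod_V_map p B f (\<iota> r))"

text \<open>
  A pair of a strict Dieudonne algebra \<open>W\<close> and \<open>\<iota> : R \<rightarrow> W\<^sup>0/VW\<^sup>0\<close> with the universal property of the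
  saturated de Rham--Witt complex of \<open>R\<close>. Since a formula cannot quantify over types, the test
  objects \<open>B\<close> are the strict Dieudonne algebras carried by subsets of the element type \<open>'w\<close> of \<open>W\<close>,
  with arbitrary operations. Every universal pair has this property whatever \<open>'w\<close> is, and
  conversely if \<open>'w\<close> is at least as large as \<open>('r + nat) set\<close>, as the universal algebra
  then has a copy in \<open>'w\<close>.
\<close>

definition saturated_deRham_Witt ::
  "nat \<Rightarrow> ('r, 'm) ring_scheme \<Rightarrow> 'w dieudonne \<Rightarrow> ('r \<Rightarrow> 'w set) \<Rightarrow> bool" where
  "saturated_deRham_Witt p R W \<iota> \<longleftrightarrow>
     strict_dieudonne_algebra p W \<and> \<iota> \<in> ring_hom_ext R (mod_V p W) \<and>
     (\<forall>B :: 'w dieudonne. strict_dieudonne_algebra p B \<longrightarrow>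
        bij_betw (precompose p R B \<iota>) (dieudonne_alg_hom W B) (ring_hom_ext R (mod_V p B)))"

text \<open>Functoriality: the unique morphism \<open>W \<rightarrow> W'\<close> corresponding to \<open>\<iota>' \<circ> f : R \<rightarrow> W'\<^sup>0/VW'\<^sup>0\<close>.\<close>

definition deRham_Witt_map ::
  "nat \<Rightarrow> ('r, 'm) ring_scheme \<Rightarrow> ('a, 'n) dieudonne_scheme \<Rightarrow> ('r \<Rightarrow> 'a set) \<Rightarrow>
   ('b, 'k) dieudonne_scheme \<Rightarrow> ('s \<Rightarrow> 'b set) \<Rightarrow> ('r \<Rightarrow> 's) \<Rightarrow> 'a \<Rightarrow> 'b" where
  "deRham_Witt_map p R W \<iota> W' \<iota>' f =
     the_inv_into (dieudonne_alg_hom W W') (precompose p R W' \<iota>) (\<lambda>r\<in>carrier R. \<iota>' (f r))"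


section \<open>Localization\<close>

text \<open>
  Let \<open>e\<close> be an additive endomorphism of \<open>G\<close>. The localization \<open>G[1/e]\<close> consists of the classes of
  pairs \<open>(x, k)\<close>, standing for \<open>x/e\<^sup>k\<close>. It is used with \<open>e\<close> the multiplication by \<open>p\<close>, and by an
  element of a commutative ring.
\<close>

definition loc_rel :: "('a, 'm) ring_scheme \<Rightarrow> ('a \<Rightarrow> 'a) \<Rightarrow> (('a \<times> nat) \<times> ('a \<times> nat)) set" where
  "loc_rel G e = {((x, k), (y, l)). x \<in> carrier G \<and> y \<in> carrier G \<and>
     (\<exists>m. (e ^^ (m + l)) x = (e ^^ (m + k)) y)}"

definition loc_frac :: "('a, 'm) ring_scheme \<Rightarrow> ('a \<Rightarrow> 'a) \<Rightarrow> 'a \<Rightarrow> nat \<Rightarrow> ('a \<times> nat) set" where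
  "loc_frac G e x k = loc_rel G e `` {(x, k)}"

definition loc_set :: "('a, 'm) ring_scheme \<Rightarrow> ('a \<Rightarrow> 'a) \<Rightarrow> 'a set \<Rightarrow> ('a \<times> nat) set set" where
  "loc_set G e X = {loc_frac G e x k |x k. x \<in> X}"

definition loc_map ::
  "('b, 'm) ring_scheme \<Rightarrow> ('b \<Rightarrow> 'b) \<Rightarrow> ('a \<Rightarrow> 'b) \<Rightarrow> ('a \<times> nat) set \<Rightarrow> ('b \<times> nat) set" where
  "loc_map H e f P = (\<Union>(x, k)\<in>P. loc_frac H e (f x) k)"

definition loc_add ::
  "('a, 'm) ring_scheme \<Rightarrow> ('a \<Rightarrow> 'a) \<Rightarrow> ('a \<times> nat) set \<Rightarrow> ('a \<times> nat) set \<Rightarrow> ('a \<times> nat) set" where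
  "loc_add G e P Q = (\<Union>(x, k)\<in>P. \<Union>(y, l)\<in>Q.
     loc_frac G e ((e ^^ l) x \<oplus>\<^bsub>G\<^esub> (e ^^ k) y) (k + l))"

text \<open>The biadditive operation \<open>(a/e\<^sup>k, x/e'\<^sup>l) \<mapsto> op a x/e'\<^sup>k\<^sup>+\<^sup>l\<close>, where \<open>e'\<close> is the endomorphism of \<open>H\<close>.\<close>

definition loc_mult ::
  "('b, 'm) ring_scheme \<Rightarrow> ('b \<Rightarrow> 'b) \<Rightarrow> ('a \<Rightarrow> 'b \<Rightarrow> 'b) \<Rightarrow>
   ('a \<times> nat) set \<Rightarrow> ('b \<times> nat) set \<Rightarrow> ('b \<times> nat) set" where
  "loc_mult H e op P Q = (\<Union>(a, k)\<in>P. \<Union>(x, l)\<in>Q. loc_frac H e (op a x) (k + l))"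

definition loc_complex :: "nat \<Rightarrow> ('a, 'm) cochain_scheme \<Rightarrow> ('a \<times> nat) set cochain" where
  "loc_complex p M = (let e = (\<lambda>x. [p] \<cdot>\<^bsub>M\<^esub> x) in
    \<lparr>carrier = loc_set M e (carrier M), monoid.mult = loc_mult M e (monoid.mult M),
     one = loc_frac M e \<one>\<^bsub>M\<^esub> 0,
     zero = loc_frac M e \<zero>\<^bsub>M\<^esub> 0, add = loc_add M e,
     grade = (\<lambda>n. loc_set M e (grade M n)), differential = loc_map M e (differential M)\<rparr>)"

definition p_isogeny ::
  "nat \<Rightarrow> ('a, 'm) cochain_scheme \<Rightarrow> ('b, 'n) cochain_scheme \<Rightarrow> ('a \<Rightarrow> 'b) \<Rightarrow> bool" where
  "p_isogeny p M N f \<longleftrightarrow> f \<in> cochain_hom M N \<and>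
     loc_map N (\<lambda>x. [p] \<cdot>\<^bsub>N\<^esub> x) f \<in> cochain_iso (loc_complex p M) (loc_complex p N)"

definition loc_ring :: "('a, 'm) ring_scheme \<Rightarrow> 'a \<Rightarrow> ('a \<times> nat) set ring" where
  "loc_ring R s = (let e = (\<lambda>x. s \<otimes>\<^bsub>R\<^esub> x) in
    \<lparr>carrier = loc_set R e (carrier R), monoid.mult = loc_mult R e (monoid.mult R),
     one = loc_frac R e \<one>\<^bsub>R\<^esub> 0,
     zero = loc_frac R e \<zero>\<^bsub>R\<^esub> 0, add = loc_add R e\<rparr>)"

text \<open>The fields \<open>mult\<close> and \<open>one\<close> of a module are not used.\<close>

definition loc_module ::
  "('r, 'b, 'm) module_scheme \<Rightarrow> 'r \<Rightarrow> (('r \<times> nat) set, ('b \<times> nat) set) module" where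
  "loc_module M s = (let e = (\<lambda>x. s \<odot>\<^bsub>M\<^esub> x) in
    \<lparr>carrier = loc_set M e (carrier M), monoid.mult = undefined, one = undefined,
     zero = loc_frac M e \<zero>\<^bsub>M\<^esub> 0, add = loc_add M e, smult = loc_mult M e (smult M)\<rparr>)"


section \<open>Kaehler differentials\<close>

definition mod_span ::
  "('r, 'm) ring_scheme \<Rightarrow> ('r, 'b, 'n) module_scheme \<Rightarrow> 'b set \<Rightarrow> 'b set" where
  "mod_span R M X = \<Inter>{N. submodule N R M \<and> X \<subseteq> N}"

definition quot_module ::
  "('r, 'b, 'n) module_scheme \<Rightarrow> 'b set \<Rightarrow> ('r, 'b set) module" where
  "quot_module M N = \<lparr>carrier = a_rcosets\<^bsub>M\<^esub> N, monoid.mult = undefined, one = undefined,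
     zero = N, add = set_add M, smult = (\<lambda>a C. \<Union>x\<in>C. N +>\<^bsub>M\<^esub> (a \<odot>\<^bsub>M\<^esub> x))\<rparr>"

text \<open>The free module on the set \<open>carrier R\<close>, and its basis.\<close>

definition free_mod :: "('r, 'm) ring_scheme \<Rightarrow> ('r, 'r \<Rightarrow> 'r) module" where
  "free_mod R =
    \<lparr>carrier = {c. (\<forall>x\<in>carrier R. c x \<in> carrier R) \<and> (\<forall>x. x \<notin> carrier R \<longrightarrow> c x = \<zero>\<^bsub>R\<^esub>) \<and>
                  finite {x. c x \<noteq> \<zero>\<^bsub>R\<^esub>}},
     monoid.mult = undefined, one = undefined, zero = (\<lambda>_. \<zero>\<^bsub>R\<^esub>), add = (\<lambda>b c x. b x \<oplus>\<^bsub>R\<^esub> c x),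
     smult = (\<lambda>a c x. a \<otimes>\<^bsub>R\<^esub> c x)\<rparr>"

definition free_gen :: "('r, 'm) ring_scheme \<Rightarrow> 'r \<Rightarrow> 'r \<Rightarrow> 'r" where
  "free_gen R x = (\<lambda>y. if y = x then \<one>\<^bsub>R\<^esub> else \<zero>\<^bsub>R\<^esub>)"

text \<open>
  The absolute differentials: generators \<open>dx\<close> subject to additivity and the Leibniz rule. For an
  \<open>F\<^sub>p\<close>-algebra these are also the differentials relative to \<open>F\<^sub>p\<close>, as \<open>d1 = 0\<close> follows.
\<close>

definition Kaehler_relations :: "('r, 'm) ring_scheme \<Rightarrow> ('r \<Rightarrow> 'r) set" where
  "Kaehler_relations R =
    {free_gen R (x \<oplus>\<^bsub>R\<^esub> y) \<ominus>\<^bsub>free_mod R\<^esub> (free_gen R x \<oplus>\<^bsub>free_mod R\<^esub> free_gen R y)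
       |x y. x \<in> carrier R \<and> y \<in> carrier R} \<union>
    {free_gen R (x \<otimes>\<^bsub>R\<^esub> y) \<ominus>\<^bsub>free_mod R\<^esub>
        (x \<odot>\<^bsub>free_mod R\<^esub> free_gen R y \<oplus>\<^bsub>free_mod R\<^esub> y \<odot>\<^bsub>free_mod R\<^esub> free_gen R x)
       |x y. x \<in> carrier R \<and> y \<in> carrier R}"

definition Kaehler :: "('r, 'm) ring_scheme \<Rightarrow> ('r, ('r \<Rightarrow> 'r) set) module" where
  "Kaehler R = quot_module (free_mod R) (mod_span R (free_mod R) (Kaehler_relations R))"

definition generated_by_at_most ::
  "('r, 'm) ring_scheme \<Rightarrow> ('r, 'b, 'n) module_scheme \<Rightarrow> nat \<Rightarrow> bool" where
  "generated_by_at_most R M d \<longleftrightarrow>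
     (\<exists>X\<subseteq>carrier M. finite X \<and> card X \<le> d \<and> mod_span R M X = carrier M)"

text \<open>Every point \<open>P\<close> of \<open>Spec R\<close> has a basic open neighbourhood \<open>D(s)\<close> over which \<open>M\<close> is so generated.\<close>

definition locally_generated_by_at_most ::
  "('r, 'm) ring_scheme \<Rightarrow> ('r, 'b, 'n) module_scheme \<Rightarrow> nat \<Rightarrow> bool" where
  "locally_generated_by_at_most R M d \<longleftrightarrow>
     (\<forall>P. primeideal P R \<longrightarrow>
        (\<exists>s\<in>carrier R - P. generated_by_at_most (loc_ring R s) (loc_module M s) d))"

end

theory Submission
  imports Defs "HOL-Algebra.Subrings"
begin

text \<open>
  The graded map equal to \<open>p\<^sup>nF\<close> in degree \<open>n\<close> is an endomorphism of the Dieudonne algebra \<open>W\<close> lifting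
  the Frobenius of \<open>R\<close>, so it is \<open>\<phi>\<close> by the universal property; since \<open>FV = p\<close>, it is invertible up to
  powers of \<open>p\<close>. If \<open>W\<^sup>n = 0\<close> for \<open>n > d\<close>, then \<open>F\<close> is bijective in degree \<open>d\<close>, and \<open>\<psi>\<close> is
  \<open>p\<^bsup>d-n-1\<^esup>V\<close> in degrees \<open>n < d\<close> and \<open>F\<^sup>-\<^sup>1\<close> in degree \<open>d\<close>.

  For the vanishing, consider the subalgebras \<open>S\<close> of \<open>W\<close> that contain the Teichmueller representatives
  \<open>[r]\<close> and satisfy \<open>S\<^sup>n \<subseteq> Fil\<^sup>1 = im V + im dV\<close> for \<open>n > d\<close>. The span of the
  \<open>[r\<^sub>0]d[r\<^sub>1]\<cdots>d[r\<^sub>n]\<close> is one, because modulo \<open>Fil\<^sup>1\<close> these monomials are images of elements of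
  \<open>\<Omega>\<^sup>n\<^sub>R\<close>. Saturation inside \<open>W\<close> (as \<open>F\<^sup>kx \<in> Fil\<^sup>1\<close> implies \<open>x \<in> Fil\<^sup>1\<close>) and closure for the
  filtration preserve these conditions, so a maximal such \<open>S\<close> is a strict Dieudonne algebra. As it
  receives a lift of \<open>R \<rightarrow> W\<^sup>0/VW\<^sup>0\<close>, the universal property gives \<open>S = W\<close>. Finally
  \<open>W\<^sup>n \<subseteq> Fil\<^sup>1\<close> means \<open>H\<^sup>n(W/p) = 0\<close>, whence \<open>W\<^sup>n \<subseteq> Fil\<^sup>r\<close> for all \<open>r\<close> and \<open>W\<^sup>n = 0\<close>.
\<close>
section \<open>Graded groups\<close>

text \<open>The coefficient p^n of the lift is forced by dF = pFd: it makes the map commute with d,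
  and it is multiplicative because degrees add. In degree 0 the map is F, which sends [r] to [r]^p =
  [r^p]; this is why it lifts the Frobenius of R. The obstacle in the second claim is to bound
  degrees without building W out of a de Rham complex: universality can only be tested against
  algebras with the element type of W. Hence saturation and completion are carried out inside W, as
  operations on subsets, and a maximal subalgebra replaces an alternation between the two. Monomials
  of high degree are controlled modulo Fil^1 only, since r |-> [r] is additive only modulo V; this
  is why the bound on S is by Fil^1 instead of by 0. The hypothesis on differentials is local on
  Spec(R), whereas W is never localized at elements of R. For a fixed monomial x, the r with [r]x in
  Fil^1 form an ideal, and local generators show that no prime ideal contains it.\<close>

lemma additive_hom:
  assumes "abelian_group M" "abelian_group N" "f \<in> hom (add_monoid M) (add_monoid N)"
  shows "x \<in> carrier M \<Longrightarrow> f x \<in> carrier N"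
    and "x \<in> carrier M \<Longrightarrow> y \<in> carrier M \<Longrightarrow> f (x \<oplus>\<^bsub>M\<^esub> y) = f x \<oplus>\<^bsub>N\<^esub> f y"
    and "f \<zero>\<^bsub>M\<^esub> = \<zero>\<^bsub>N\<^esub>"
    and "x \<in> carrier M \<Longrightarrow> f (\<ominus>\<^bsub>M\<^esub> x) = \<ominus>\<^bsub>N\<^esub> f x"
    and "x \<in> carrier M \<Longrightarrow> y \<in> carrier M \<Longrightarrow> f (x \<ominus>\<^bsub>M\<^esub> y) = f x \<ominus>\<^bsub>N\<^esub> f y"
    and "x \<in> carrier M \<Longrightarrow> f ([(k::nat)] \<cdot>\<^bsub>M\<^esub> x) = [k] \<cdot>\<^bsub>N\<^esub> f x"
proof -
  interpret M: abelian_group M by fact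
  interpret N: abelian_group N by fact
  interpret abelian_group_hom M N f
    using assms(3) by (intro abelian_group_homI) (auto simp: group_hom_def group_hom_axioms_def M.a_group N.a_group M.abelian_group_axioms N.abelian_group_axioms)
  show "x \<in> carrier M \<Longrightarrow> f x \<in> carrier N" by simp
  show "x \<in> carrier M \<Longrightarrow> y \<in> carrier M \<Longrightarrow> f (x \<oplus>\<^bsub>M\<^esub> y) = f x \<oplus>\<^bsub>N\<^esub> f y" by simp
  show "f \<zero>\<^bsub>M\<^esub> = \<zero>\<^bsub>N\<^esub>" by simp
  show "x \<in> carrier M \<Longrightarrow> f (\<ominus>\<^bsub>M\<^esub> x) = \<ominus>\<^bsub>N\<^esub> f x" by simp
  show "x \<in> carrier M \<Longrightarrow> y \<in> carrier M \<Longrightarrow> f (x \<ominus>\<^bsub>M\<^esub> y) = f x \<ominus>\<^bsub>N\<^esub> f y"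
    by (simp add: M.minus_eq N.minus_eq)
  show "f ([(k::nat)] \<cdot>\<^bsub>M\<^esub> x) = [k] \<cdot>\<^bsub>N\<^esub> f x" if "x \<in> carrier M"
    using that by (induction k) (simp_all add: M.add.nat_pow_Suc N.add.nat_pow_Suc)
qed

lemma (in abelian_group) minus_eq_zero_iff:
  assumes "x \<in> carrier G" "y \<in> carrier G"
  shows "x \<ominus> y = \<zero> \<longleftrightarrow> x = y"
  using assms by (metis add.inv_closed add.inv_equality minus_eq minus_minus r_neg)

lemma (in abelian_group) add_minus_cancel:
  assumes "x \<in> carrier G" "y \<in> carrier G"
  shows "y \<oplus> (x \<ominus> y) = x" and "(x \<ominus> y) \<oplus> y = x" and "(x \<oplus> y) \<ominus> y = x"
  using assms by (simp_all add: minus_eq a_ac r_neg l_neg r_neg1 r_neg2)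

lemma (in abelian_group) minus_add_minus:
  assumes "x \<in> carrier G" "y \<in> carrier G" "z \<in> carrier G" "w \<in> carrier G"
  shows "(x \<oplus> y) \<ominus> (z \<oplus> w) = (x \<ominus> z) \<oplus> (y \<ominus> w)"
  using assms by (simp add: minus_eq minus_add a_ac)

lemma (in abelian_group) minus_telescope:
  assumes "x \<in> carrier G" "y \<in> carrier G" "z \<in> carrier G"
  shows "(x \<ominus> y) \<oplus> (y \<ominus> z) = x \<ominus> z"
  using assms by (simp add: minus_eq a_ac r_neg l_neg r_neg1 r_neg2)

section \<open>Homogeneous components and maps given degree by degree\<close>

definition component :: "('a, 'm) cochain_scheme \<Rightarrow> 'a \<Rightarrow> int \<Rightarrow> 'a" where
  "component M x = (THE c. (\<forall>n. c n \<in> grade M n) \<and> finite {n. c n \<noteq> \<zero>\<^bsub>M\<^esub>} \<and>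
     x = (\<Oplus>\<^bsub>M\<^esub>n\<in>{n. c n \<noteq> \<zero>\<^bsub>M\<^esub>}. c n))"

text \<open>Serves for maps whose formula depends on the degree: the Frobenius lift, equal to p^n F
  in degree n, and the factor \<open>\<psi>\<close>. Only additivity within each degree is asked of
  \<open>f\<close>, so its values may come from a choice.\<close>

definition graded_extension :: "('a, 'm) cochain_scheme \<Rightarrow> (int \<Rightarrow> 'a \<Rightarrow> 'a) \<Rightarrow> 'a \<Rightarrow> 'a" where
  "graded_extension M f x = (\<Oplus>\<^bsub>M\<^esub>n\<in>{n. component M x n \<noteq> \<zero>\<^bsub>M\<^esub>}. f n (component M x n))"

context cochain_complex
begin

lemma grade_carrier: "x \<in> grade M n \<Longrightarrow> x \<in> carrier M"
  using additive_subgroup.a_subset[OF grade_subgroup] by blast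

lemma zero_grade [simp]: "\<zero> \<in> grade M n"
  by (rule additive_subgroup.zero_closed[OF grade_subgroup])

lemma add_grade: "x \<in> grade M n \<Longrightarrow> y \<in> grade M n \<Longrightarrow> x \<oplus> y \<in> grade M n"
  by (rule additive_subgroup.a_closed[OF grade_subgroup])

lemma neg_grade: "x \<in> grade M n \<Longrightarrow> \<ominus> x \<in> grade M n"
  using additive_subgroup.a_inv_closed[OF grade_subgroup] abelian_group_axioms by blast

lemma minus_grade: "x \<in> grade M n \<Longrightarrow> y \<in> grade M n \<Longrightarrow> x \<ominus> y \<in> grade M n"
  by (simp add: minus_eq add_grade neg_grade)

lemma nat_mult_grade: "x \<in> grade M n \<Longrightarrow> [(k::nat)] \<cdot> x \<in> grade M n"
  by (induction k) (simp_all add: add.nat_pow_Suc add_grade)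

lemma component_spec:
  assumes "x \<in> carrier M"
  shows "(\<forall>n. component M x n \<in> grade M n) \<and> finite {n. component M x n \<noteq> \<zero>} \<and>
    x = (\<Oplus>n\<in>{n. component M x n \<noteq> \<zero>}. component M x n)"
  unfolding component_def by (rule theI'[OF grade_direct_sum[OF assms]])

lemmas component_grade = component_spec[THEN conjunct1, rule_format]
  and component_finite = component_spec[THEN conjunct2, THEN conjunct1]
  and component_sum = component_spec[THEN conjunct2, THEN conjunct2]

lemma component_carrier: "x \<in> carrier M \<Longrightarrow> component M x n \<in> carrier M"
  by (rule grade_carrier[OF component_grade])

lemma component_unique:
  assumes c: "\<And>n. c n \<in> grade M n" and A: "finite A" "\<And>n. n \<notin> A \<Longrightarrow> c n = \<zero>"
    and x: "x = (\<Oplus>n\<in>A. c n)"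
  shows "component M x = c"
proof -
  have fin: "finite {n. c n \<noteq> \<zero>}" using A by (metis (mono_tags, lifting) finite_subset mem_Collect_eq subsetI)
  have "(\<Oplus>n\<in>{n. c n \<noteq> \<zero>}. c n) = (\<Oplus>n\<in>A. c n)"
    by (rule add.finprod_mono_neutral_cong_left) (use A c grade_carrier in auto)
  hence 1: "(\<forall>n. c n \<in> grade M n) \<and> finite {n. c n \<noteq> \<zero>} \<and> x = (\<Oplus>n\<in>{n. c n \<noteq> \<zero>}. c n)"
    using c fin x by simp
  have "x \<in> carrier M" unfolding x using c grade_carrier by (intro finsum_closed) auto
  from theI'[OF grade_direct_sum[OF this]] grade_direct_sum[OF this] 1
  show ?thesis unfolding component_def by blast
qed

lemma finsum_component:
  assumes "x \<in> carrier M" "finite A" "{n. component M x n \<noteq> \<zero>} \<subseteq> A"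
  shows "(\<Oplus>n\<in>A. component M x n) = x"
proof -
  have "(\<Oplus>n\<in>{n. component M x n \<noteq> \<zero>}. component M x n) = (\<Oplus>n\<in>A. component M x n)"
    by (rule add.finprod_mono_neutral_cong_left) (use assms component_carrier in auto)
  thus ?thesis using component_sum[OF assms(1)] by simp
qed

lemma component_add:
  assumes "x \<in> carrier M" "y \<in> carrier M"
  shows "component M (x \<oplus> y) n = component M x n \<oplus> component M y n"
proof -
  let ?A = "{n. component M x n \<noteq> \<zero>} \<union> {n. component M y n \<noteq> \<zero>}"
  have fin: "finite ?A" using assms component_finite by auto
  have "component M (x \<oplus> y) = (\<lambda>n. component M x n \<oplus> component M y n)"
  proof (rule component_unique[OF _ fin])
    show "x \<oplus> y = (\<Oplus>n\<in>?A. component M x n \<oplus> component M y n)"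
      using assms fin finsum_component[of x ?A] finsum_component[of y ?A]
      by (subst finsum_addf) (auto simp: component_carrier)
  qed (use assms component_grade add_grade in auto)
  thus ?thesis by simp
qed

lemma component_homogeneous:
  assumes "x \<in> grade M n"
  shows "component M x m = (if m = n then x else \<zero>)"
proof -
  have "component M x = (\<lambda>m. if m = n then x else \<zero>)"
    by (rule component_unique[of _ "{n}"]) (use assms grade_carrier in \<open>auto simp: finsum_singleton\<close>)
  thus ?thesis by simp
qed

lemma component_zero [simp]: "component M \<zero> m = \<zero>"
  using component_homogeneous[of \<zero> m m] by simp

text \<open>Sign rules and degree-dependent formulas are available on homogeneous elements only;
  identities additive in x reach the whole group through this rule.\<close>

lemma homogeneous_induct [consumes 1, case_names homogeneous add]:
  assumes x: "x \<in> carrier M" and h: "\<And>n x. x \<in> grade M n \<Longrightarrow> P x"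
    and a: "\<And>x y. x \<in> carrier M \<Longrightarrow> y \<in> carrier M \<Longrightarrow> P x \<Longrightarrow> P y \<Longrightarrow> P (x \<oplus> y)"
  shows "P x"
proof -
  have "finite A \<Longrightarrow> P (\<Oplus>n\<in>A. component M x n)" for A
  proof (induction A rule: finite_induct)
    case empty
    thus ?case using h[of \<zero>] by simp
  next
    case (insert n A)
    thus ?case using x h[OF component_grade[OF x]] by (auto intro!: a simp: component_carrier)
  qed
  from this[OF component_finite[OF x]] show ?thesis using component_sum[OF x] by simp
qed

lemma component_hom: "(\<lambda>x. component M x n) \<in> hom (add_monoid M) (add_monoid M)"
  by (auto simp: hom_def component_carrier component_add)

lemmas component_simps = additive_hom[OF abelian_group_axioms abelian_group_axioms component_hom]

text \<open>The shift k is 1 for the differential and 0 for F, V and their powers.\<close>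

lemma component_map:
  assumes f: "f \<in> hom (add_monoid M) (add_monoid M)"
    and g: "\<And>n x. x \<in> grade M n \<Longrightarrow> f x \<in> grade M (n + k)" and x: "x \<in> carrier M"
  shows "component M (f x) n = f (component M x (n - k))"
  using x
proof (induction x rule: homogeneous_induct)
  case (homogeneous m x)
  from component_homogeneous[OF g[OF this]] component_homogeneous[OF this]
  show ?case using additive_hom(3)[OF abelian_group_axioms abelian_group_axioms f] by auto
next
  case (add x y)
  note h = additive_hom[OF abelian_group_axioms abelian_group_axioms f]
  show ?case using add by (simp add: h component_add component_carrier)
qed

lemma eq_if_components_eq:
  assumes "x \<in> carrier M" "y \<in> carrier M" "\<And>n. component M x n = component M y n"
  shows "x = y"
proof -
  have "component M x = component M y" using assms by auto
  thus ?thesis using component_sum assms by metis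
qed

lemma in_grade_if_components_zero:
  assumes "x \<in> carrier M" "\<And>m. m \<noteq> n \<Longrightarrow> component M x m = \<zero>"
  shows "x \<in> grade M n"
proof -
  have "component M x n = x"
    by (rule eq_if_components_eq)
      (use assms component_homogeneous[OF component_grade[OF assms(1)]] component_carrier in auto)
  thus ?thesis using component_grade[OF assms(1)] by metis
qed

context
  fixes f :: "int \<Rightarrow> 'a \<Rightarrow> 'a"
  assumes f_grade: "\<And>n x. x \<in> grade M n \<Longrightarrow> f n x \<in> grade M n"
    and f_add: "\<And>n x y. x \<in> grade M n \<Longrightarrow> y \<in> grade M n \<Longrightarrow> f n (x \<oplus> y) = f n x \<oplus> f n y"
begin

lemma graded_extension_zero: "f n \<zero> = \<zero>"
proof -
  have "f n \<zero> \<oplus> f n \<zero> = f n \<zero>" using f_add[of \<zero> n \<zero>] by simp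
  thus ?thesis using grade_carrier[OF f_grade[of \<zero> n]] by (simp add: add.r_cancel_one')
qed

lemma graded_extension_superset:
  assumes "x \<in> carrier M" "finite A" "{n. component M x n \<noteq> \<zero>} \<subseteq> A"
  shows "graded_extension M f x = (\<Oplus>n\<in>A. f n (component M x n))"
  unfolding graded_extension_def
  by (rule add.finprod_mono_neutral_cong_left)
    (use assms graded_extension_zero in \<open>auto intro!: grade_carrier[OF f_grade] component_grade\<close>)

lemma graded_extension_hom: "graded_extension M f \<in> hom (add_monoid M) (add_monoid M)"
proof -
  have "graded_extension M f (x \<oplus> y) = graded_extension M f x \<oplus> graded_extension M f y"
    if xy: "x \<in> carrier M" "y \<in> carrier M" for x y
  proof -
    let ?A = "{n. component M x n \<noteq> \<zero>} \<union> {n. component M y n \<noteq> \<zero>}"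
    have fin: "finite ?A" using xy component_finite by auto
    have "graded_extension M f (x \<oplus> y) = (\<Oplus>n\<in>?A. f n (component M (x \<oplus> y) n))"
      by (rule graded_extension_superset) (use xy fin component_add in auto)
    also have "\<dots> = (\<Oplus>n\<in>?A. f n (component M x n) \<oplus> f n (component M y n))"
      by (rule finsum_cong') (use xy in \<open>auto simp: component_add f_add component_grade intro!: grade_carrier[OF f_grade] \<close>)
    also have "\<dots> = graded_extension M f x \<oplus> graded_extension M f y"
      by (subst finsum_addf) (use xy fin in \<open>auto simp: component_grade graded_extension_superset[of _ ?A] intro!: grade_carrier[OF f_grade]\<close>)
    finally show ?thesis .
  qed
  moreover have "graded_extension M f x \<in> carrier M" if "x \<in> carrier M" for x
    unfolding graded_extension_def using that
    by (intro finsum_closed) (auto intro: grade_carrier f_grade component_grade)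
  ultimately show ?thesis by (simp add: hom_def)
qed

lemma graded_extension_homogeneous:
  assumes "x \<in> grade M n"
  shows "graded_extension M f x = f n x"
proof -
  have "graded_extension M f x = (\<Oplus>m\<in>{n}. f m (component M x m))"
    by (rule graded_extension_superset) (use assms grade_carrier component_homogeneous[OF assms] in auto)
  also have "\<dots> = f n (component M x n) \<oplus> \<zero>"
    by (subst finsum_insert) (use assms in \<open>auto intro!: grade_carrier[OF f_grade] simp: component_homogeneous\<close>)
  also have "\<dots> = f n x"
    using assms by (auto simp: component_homogeneous intro!: r_zero grade_carrier[OF f_grade])
  finally show ?thesis .
qed

end

lemmas d_simps = additive_hom[OF abelian_group_axioms abelian_group_axioms differential_hom]

lemma component_d: "x \<in> carrier M \<Longrightarrow> component M (differential M x) n = differential M (component M x (n - 1))"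
  by (rule component_map[OF differential_hom differential_grade])

end

section \<open>Saturated Dieudonne complexes\<close>

lemma (in abelian_group) coset_eq_iff:
  assumes "additive_subgroup H G" "x \<in> carrier G" "y \<in> carrier G"
  shows "H +> x = H +> y \<longleftrightarrow> x \<ominus> y \<in> H"
proof -
  interpret H: abelian_subgroup H G
    using assms(1) abelian_group_axioms by (rule abelian_subgroupI3)
  have "H +> x = H +> y \<longleftrightarrow> x \<in> H +> y"
    using H.a_rcos_self[OF assms(2)] H.a_repr_independence'[OF _ assms(3), of x] by blast
  thus ?thesis using H.a_rcos_module[OF assms(3,2)] by (simp add: minus_eq)
qed

lemma (in abelian_group) set_add_coset:
  assumes H: "additive_subgroup H G" and K: "additive_subgroup K G" "K \<subseteq> H" and x: "x \<in> carrier G"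
  shows "H <+>\<^bsub>G\<^esub> (K +> x) = H +> x"
proof -
  interpret H: additive_subgroup H G by fact
  interpret K: additive_subgroup K G by fact
  have 1: "h \<oplus> (k \<oplus> x) = (h \<oplus> k) \<oplus> x" if "h \<in> H" "k \<in> K" for h k
    using that x H.a_Hcarr K.a_Hcarr by (simp add: a_assoc)
  have 2: "h \<oplus> x = h \<oplus> (\<zero> \<oplus> x)" for h
    using x by simp
  show "H <+>\<^bsub>G\<^esub> (K +> x) = H +> x"
  proof (intro Set.set_eqI iffI)
    fix z assume "z \<in> H <+>\<^bsub>G\<^esub> (K +> x)"
    then obtain h k where "h \<in> H" "k \<in> K" "z = h \<oplus> (k \<oplus> x)"
      unfolding set_add_def' a_r_coset_def' by blast
    hence "z = (h \<oplus> k) \<oplus> x" "h \<oplus> k \<in> H" using 1 K(2) by auto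
    thus "z \<in> H +> x" unfolding a_r_coset_def' by blast
  next
    fix z assume "z \<in> H +> x"
    then obtain h where "h \<in> H" "z = h \<oplus> (\<zero> \<oplus> x)" using 2 unfolding a_r_coset_def' by blast
    thus "z \<in> H <+>\<^bsub>G\<^esub> (K +> x)" using K.zero_closed unfolding set_add_def' a_r_coset_def' by blast
  qed
qed

context abelian_group
begin

lemma nat_mult_simps:
  shows "x \<in> carrier G \<Longrightarrow> [(1::nat)] \<cdot> x = x"
    and "x \<in> carrier G \<Longrightarrow> [(k::nat)] \<cdot> ([(l::nat)] \<cdot> x) = [(k * l)] \<cdot> x"
    and "x \<in> carrier G \<Longrightarrow> y \<in> carrier G \<Longrightarrow> [(k::nat)] \<cdot> (x \<oplus> y) = [k] \<cdot> x \<oplus> [k] \<cdot> y"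
    and "x \<in> carrier G \<Longrightarrow> y \<in> carrier G \<Longrightarrow> [(k::nat)] \<cdot> (x \<ominus> y) = [k] \<cdot> x \<ominus> [k] \<cdot> y"
    and "x \<in> carrier G \<Longrightarrow> [(k::nat)] \<cdot> (\<ominus> x) = \<ominus> ([k] \<cdot> x)"
    and "x \<in> carrier G \<Longrightarrow> [(k::nat)] \<cdot> x \<in> carrier G"
    and "[(k::nat)] \<cdot> \<zero> = \<zero>"
proof -
  show "x \<in> carrier G \<Longrightarrow> [(k::nat)] \<cdot> ([(l::nat)] \<cdot> x) = [(k * l)] \<cdot> x"
    by (subst mult.commute) (rule add.nat_pow_pow)
qed (simp_all add: add.nat_pow_distrib minus_eq add.nat_pow_inv)

end

context dieudonne_complex
begin

lemmas F_simps = additive_hom[OF abelian_group_axioms abelian_group_axioms Frob_hom]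

lemma component_F: "x \<in> carrier M \<Longrightarrow> component M (Frob M x) n = Frob M (component M x n)"
  using component_map[OF Frob_hom, of 0 x n] Frob_grade by simp

lemma F_pow_hom: "(Frob M ^^ k) \<in> hom (add_monoid M) (add_monoid M)"
  by (induction k) (auto simp: hom_def F_simps Pi_def)

lemmas F_pow_simps = additive_hom[OF abelian_group_axioms abelian_group_axioms F_pow_hom]

lemma F_pow_grade: "x \<in> grade M n \<Longrightarrow> (Frob M ^^ k) x \<in> grade M n"
  by (induction k) (auto simp: Frob_grade)

lemma component_F_pow: "x \<in> carrier M \<Longrightarrow> component M ((Frob M ^^ k) x) n = (Frob M ^^ k) (component M x n)"
  using component_map[OF F_pow_hom[of k], of 0 x n] F_pow_grade by simp

lemma d_F_pow: "x \<in> carrier M \<Longrightarrow> differential M ((Frob M ^^ k) x) = [(p ^ k)] \<cdot> (Frob M ^^ k) (differential M x)"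
proof (induction k)
  case (Suc k)
  thus ?case
    by (simp add: differential_Frob F_simps F_pow_simps d_simps nat_mult_simps)
qed (simp add: nat_mult_simps d_simps)

end

context saturated_dieudonne_complex
begin

section \<open>Injectivity and image of the powers of F\<close>

lemma p_pow_torsion_free: "x \<in> carrier M \<Longrightarrow> [(p ^ k)] \<cdot> x = \<zero> \<Longrightarrow> x = \<zero>"
proof (induction k)
  case (Suc k)
  hence "[p] \<cdot> ([(p ^ k)] \<cdot> x) = \<zero>" by (simp add: nat_mult_simps)
  with Suc show ?case by (metis nat_mult_simps(6) p_torsion_free)
qed (simp add: nat_mult_simps)

lemma p_pow_cancel:
  assumes "x \<in> carrier M" "y \<in> carrier M" "[(p ^ k)] \<cdot> x = [(p ^ k)] \<cdot> y"
  shows "x = y"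
proof -
  have "[(p ^ k)] \<cdot> (x \<ominus> y) = \<zero>" using assms by (simp add: nat_mult_simps minus_eq_zero_iff)
  thus ?thesis using p_pow_torsion_free assms minus_eq_zero_iff by (metis minus_closed)
qed

lemma p_cancel: "x \<in> carrier M \<Longrightarrow> y \<in> carrier M \<Longrightarrow> [p] \<cdot> x = [p] \<cdot> y \<Longrightarrow> x = y"
  using p_pow_cancel[of x y 1] by simp

lemma F_inj: 
  assumes "x \<in> carrier M" "y \<in> carrier M" "Frob M x = Frob M y"
  shows "x = y"
proof (rule eq_if_components_eq[OF assms(1,2)])
  fix n
  have "Frob M (component M x n) = Frob M (component M y n)"
    using assms by (metis component_F)
  thus "component M x n = component M y n"
    using Frob_bij[of n] component_grade assms by (meson bij_betw_imp_inj_on inj_onD)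
qed

lemma F_pow_inj:
  "x \<in> carrier M \<Longrightarrow> y \<in> carrier M \<Longrightarrow> (Frob M ^^ k) x = (Frob M ^^ k) y \<Longrightarrow> x = y"
  by (induction k) (auto dest: F_inj[rotated 2] simp: F_pow_simps)

text \<open>\<open>Frob_bij\<close> asks for y in degree n + 1. As dx is homogeneous of that degree,
  an arbitrary y may be replaced by its component there.\<close>

lemma F_surj_grade:
  assumes "x \<in> grade M n" "y \<in> carrier M" "differential M x = [p] \<cdot> y"
  shows "\<exists>z\<in>grade M n. Frob M z = x"
proof -
  have "differential M x = component M (differential M x) (n + 1)"
    using component_homogeneous[OF differential_grade[OF assms(1)]] by simp
  also have "\<dots> = [p] \<cdot> component M y (n + 1)" using assms by (simp add: component_simps)
  finally have "x \<in> {x \<in> grade M n. \<exists>y\<in>grade M (n + 1). differential M x = [p] \<cdot> y}"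
    using assms component_grade by auto
  hence "x \<in> Frob M ` grade M n" using bij_betw_imp_surj_on[OF Frob_bij[of n]] by simp
  thus ?thesis by blast
qed

lemma F_surj:
  assumes x: "x \<in> carrier M" and y: "y \<in> carrier M" "differential M x = [p] \<cdot> y"
  shows "\<exists>z\<in>carrier M. Frob M z = x"
proof -
  have "finite A \<Longrightarrow> \<exists>z\<in>carrier M. Frob M z = (\<Oplus>n\<in>A. component M x n)" for A
  proof (induction A rule: finite_induct)
    case empty
    thus ?case using F_simps(3) by auto
  next
    case (insert n A)
    have "differential M (component M x n) = [p] \<cdot> component M y (n + 1)"
      using component_d[OF x, of "n + 1"] y by (simp add: component_simps)
    then obtain z where z: "z \<in> grade M n" "Frob M z = component M x n"
      using F_surj_grade[OF component_grade[OF x]] component_carrier y by blast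
    obtain w where w: "w \<in> carrier M" "Frob M w = (\<Oplus>n\<in>A. component M x n)" using insert by blast
    have "Frob M (z \<oplus> w) = (\<Oplus>n\<in>insert n A. component M x n)"
      using z w insert x by (simp add: F_simps grade_carrier finsum_insert component_carrier)
    thus ?case using z w grade_carrier by blast
  qed
  from this[OF component_finite[OF x]] show ?thesis using component_sum[OF x] by simp
qed

text \<open>Writing x = Fz leaves F(dz) = p^k y, whereas the induction hypothesis for z needs dz
  itself to be divisible by p^k. So y has to be divided by F, which is possible because y is
  closed.\<close>

lemma F_pow_surj:
  "x \<in> carrier M \<Longrightarrow> y \<in> carrier M \<Longrightarrow> differential M x = [(p ^ k)] \<cdot> y \<Longrightarrow> \<exists>z\<in>carrier M. (Frob M ^^ k) z = x"
proof (induction k arbitrary: x y)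
  case (Suc k)
  note closed = F_simps(1) d_simps(1) F_pow_simps(1) nat_mult_simps(6)
  note x = Suc.prems(1) and y = Suc.prems(2)
  have dx: "differential M x = [p] \<cdot> ([(p ^ k)] \<cdot> y)" using Suc.prems by (simp add: nat_mult_simps)
  then obtain z where z: "z \<in> carrier M" "Frob M z = x"
    using F_surj[OF x closed(4)[OF y]] by blast
  have "[p] \<cdot> Frob M (differential M z) = [p] \<cdot> ([(p ^ k)] \<cdot> y)"
    using differential_Frob[OF z(1)] dx z(2) by simp
  hence 1: "Frob M (differential M z) = [(p ^ k)] \<cdot> y"
    by (rule p_cancel[OF closed(1)[OF closed(2)[OF z(1)]] closed(4)[OF y]])
  \<comment> \<open>As p^(k+1) y = dx, torsion-freeness makes y closed; a closed element has
    differential p times 0 and hence lies in the image of F.\<close>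
  have "[(p ^ Suc k)] \<cdot> differential M y = differential M (differential M x)"
    unfolding Suc.prems(3) by (rule d_simps(6)[OF y, symmetric])
  also have "\<dots> = \<zero>" by (rule differential_square[OF x])
  finally have "differential M y = \<zero>" by (rule p_pow_torsion_free[OF closed(2)[OF y]])
  hence "differential M y = [p] \<cdot> \<zero>" by (simp add: nat_mult_simps)
  then obtain w where w: "w \<in> carrier M" "Frob M w = y"
    using F_surj[OF y zero_closed] by blast
  have "Frob M (differential M z) = Frob M ([(p ^ k)] \<cdot> w)" using 1 w by (simp add: F_simps)
  hence "differential M z = [(p ^ k)] \<cdot> w"
    by (rule F_inj[OF closed(2)[OF z(1)] closed(4)[OF w(1)]])
  then obtain u where u: "u \<in> carrier M" "(Frob M ^^ k) u = z" using Suc.IH[OF z(1) w(1)] by blast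
  hence "(Frob M ^^ Suc k) u = x" using z(2) by simp
  thus ?case using u(1) by blast
qed auto

section \<open>The Verschiebung and its commutation rules\<close>

abbreviation "V \<equiv> Ver p M"

text \<open>d(px) = p dx, so px satisfies the divisibility condition that characterises the image of
  F.\<close>

lemma V_spec:
  assumes "x \<in> carrier M"
  shows "V x \<in> carrier M \<and> Frob M (V x) = [p] \<cdot> x"
proof -
  have "\<exists>y\<in>carrier M. Frob M y = [p] \<cdot> x"
    by (rule F_surj[of _ "differential M x"]) (use assms in \<open>auto simp: d_simps nat_mult_simps\<close>)
  hence "\<exists>!y. y \<in> carrier M \<and> Frob M y = [p] \<cdot> x" using F_inj by metis
  from theI'[OF this] show ?thesis unfolding Ver_def .
qed

lemmas V_carrier = V_spec[THEN conjunct1] and F_V = V_spec[THEN conjunct2]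

lemma V_unique: "x \<in> carrier M \<Longrightarrow> y \<in> carrier M \<Longrightarrow> Frob M y = [p] \<cdot> x \<Longrightarrow> V x = y"
  by (metis F_inj V_spec)

lemma V_F: "x \<in> carrier M \<Longrightarrow> V (Frob M x) = [p] \<cdot> x"
  by (rule V_unique) (auto simp: F_simps nat_mult_simps)

lemma V_hom: "V \<in> hom (add_monoid M) (add_monoid M)"
proof -
  have "V (x \<oplus> y) = V x \<oplus> V y" if "x \<in> carrier M" "y \<in> carrier M" for x y
    by (rule V_unique) (use that in \<open>auto simp: F_simps nat_mult_simps V_carrier F_V\<close>)
  thus ?thesis by (auto simp: hom_def V_carrier)
qed

lemmas V_simps = additive_hom[OF abelian_group_axioms abelian_group_axioms V_hom]

lemma V_grade:
  assumes "x \<in> grade M n"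
  shows "V x \<in> grade M n"
proof (rule in_grade_if_components_zero)
  have x: "x \<in> carrier M" using assms grade_carrier by auto
  show "V x \<in> carrier M" using V_carrier x by auto
  fix m assume "m \<noteq> n"
  hence "Frob M (component M (V x) m) = Frob M \<zero>"
    using component_F[of "V x" m] x assms component_homogeneous[OF nat_mult_grade[OF assms]] F_simps
    by (simp add: V_carrier F_V)
  thus "component M (V x) m = \<zero>" using F_inj component_carrier V_carrier x by blast
qed

lemma V_pow_hom: "(V ^^ k) \<in> hom (add_monoid M) (add_monoid M)"
  by (induction k) (auto simp: hom_def V_simps Pi_def)

lemmas V_pow_simps = additive_hom[OF abelian_group_axioms abelian_group_axioms V_pow_hom]

lemma V_pow_grade: "x \<in> grade M n \<Longrightarrow> (V ^^ k) x \<in> grade M n"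
  by (induction k) (auto simp: V_grade)

lemma component_V_pow: "x \<in> carrier M \<Longrightarrow> component M ((V ^^ k) x) n = (V ^^ k) (component M x n)"
  using component_map[OF V_pow_hom[of k], of 0 x n] V_pow_grade by simp

lemma V_F_commute: "x \<in> carrier M \<Longrightarrow> V (Frob M x) = Frob M (V x)"
  by (simp add: V_F F_V)

lemma F_pow_V_pow: "x \<in> carrier M \<Longrightarrow> (Frob M ^^ k) ((V ^^ k) x) = [(p ^ k)] \<cdot> x"
proof (induction k arbitrary: x)
  case (Suc k)
  have "(Frob M ^^ Suc k) ((V ^^ Suc k) x) = (Frob M ^^ Suc k) ((V ^^ k) (V x))" 
    by (simp add: funpow_swap1)
  also have "\<dots> = Frob M ([(p ^ k)] \<cdot> V x)" using Suc V_carrier by simp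
  also have "\<dots> = [(p ^ Suc k)] \<cdot> x"
    using Suc.prems by (simp add: F_simps V_carrier F_V nat_mult_simps mult.commute)
  finally show ?case .
qed (simp add: nat_mult_simps)

lemma V_F_pow: "x \<in> carrier M \<Longrightarrow> V ((Frob M ^^ k) x) = (Frob M ^^ k) (V x)"
  by (induction k) (auto simp: V_F_commute F_pow_simps)

lemma V_pow_F_pow: "x \<in> carrier M \<Longrightarrow> (V ^^ k) ((Frob M ^^ k) x) = [(p ^ k)] \<cdot> x"
proof (induction k arbitrary: x)
  case (Suc k)
  have "(V ^^ Suc k) ((Frob M ^^ Suc k) x) = V ((V ^^ k) ((Frob M ^^ k) (Frob M x)))"
    by (simp add: funpow_swap1)
  also have "\<dots> = [(p ^ k)] \<cdot> V (Frob M x)" using Suc F_simps V_simps by simp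
  finally show ?case using Suc.prems by (simp add: V_F nat_mult_simps mult.commute)
qed (simp add: nat_mult_simps)

text \<open>After multiplication by p, both sides become d(FVx) = p dx.\<close>

lemma F_d_V: "x \<in> carrier M \<Longrightarrow> Frob M (differential M (V x)) = differential M x"
proof (rule p_cancel)
  assume x: "x \<in> carrier M"
  show "[p] \<cdot> Frob M (differential M (V x)) = [p] \<cdot> differential M x"
    using x by (simp flip: differential_Frob add: V_carrier F_V d_simps)
qed (auto simp: F_simps V_simps d_simps)

lemma F_pow_d_V_pow: "x \<in> carrier M \<Longrightarrow> (Frob M ^^ k) (differential M ((V ^^ k) x)) = differential M x"
proof (induction k arbitrary: x)
  case (Suc k)
  have "(Frob M ^^ Suc k) (differential M ((V ^^ Suc k) x)) = Frob M ((Frob M ^^ k) (differential M ((V ^^ k) (V x))))"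
    by (simp add: funpow_swap1)
  thus ?case using Suc V_carrier F_d_V by simp
qed simp

lemma V_d: "x \<in> carrier M \<Longrightarrow> V (differential M x) = [p] \<cdot> differential M (V x)"
  by (rule V_unique) (auto simp: F_simps V_simps d_simps nat_mult_simps F_d_V)

lemma V_pow_d: "x \<in> carrier M \<Longrightarrow> (V ^^ k) (differential M x) = [(p ^ k)] \<cdot> differential M ((V ^^ k) x)"
proof (induction k)
  case (Suc k)
  thus ?case by (simp add: V_simps V_pow_simps d_simps V_d nat_mult_simps mult.commute)
qed (simp add: nat_mult_simps d_simps)

section \<open>The filtration by im V^r + im dV^r\<close>

abbreviation "Fil \<equiv> Ver_filtration p M"

lemma Fil_iff:
  "x \<in> Fil r \<longleftrightarrow> (\<exists>u\<in>carrier M. \<exists>v\<in>carrier M. x = (V ^^ r) u \<oplus> differential M ((V ^^ r) v))"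
  unfolding Ver_filtration_def set_add_def' by auto

lemma FilI: "u \<in> carrier M \<Longrightarrow> v \<in> carrier M \<Longrightarrow> (V ^^ r) u \<oplus> differential M ((V ^^ r) v) \<in> Fil r"
  using Fil_iff by blast

lemma Fil_V: "u \<in> carrier M \<Longrightarrow> (V ^^ r) u \<in> Fil r"
  using FilI[of u \<zero> r] by (simp add: V_pow_simps d_simps)

lemma Fil_dV: "u \<in> carrier M \<Longrightarrow> differential M ((V ^^ r) u) \<in> Fil r"
  using FilI[of \<zero> u r] by (simp add: V_pow_simps d_simps)

lemma Fil_V1: "u \<in> carrier M \<Longrightarrow> V u \<in> Fil 1"
  using Fil_V[of u 1] by simp

text \<open>Because p^r = V^r F^r.\<close>

lemma Fil_p_pow: "u \<in> carrier M \<Longrightarrow> [(p ^ r)] \<cdot> u \<in> Fil r"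
  using Fil_V[of "(Frob M ^^ r) u" r] by (simp add: V_pow_F_pow F_pow_simps)

lemma Fil_carrier: "x \<in> Fil r \<Longrightarrow> x \<in> carrier M"
  unfolding Fil_iff by (auto simp: V_pow_simps d_simps)

lemma Fil_add: assumes "x \<in> Fil r" "y \<in> Fil r" shows "x \<oplus> y \<in> Fil r"
proof -
  obtain u v where u: "u \<in> carrier M" "v \<in> carrier M" "x = (V ^^ r) u \<oplus> differential M ((V ^^ r) v)"
    using assms unfolding Fil_iff by blast
  obtain u' v' where u': "u' \<in> carrier M" "v' \<in> carrier M" "y = (V ^^ r) u' \<oplus> differential M ((V ^^ r) v')"
    using assms unfolding Fil_iff by blast
  have "x \<oplus> y = (V ^^ r) (u \<oplus> u') \<oplus> differential M ((V ^^ r) (v \<oplus> v'))"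
    using u u' by (simp add: V_pow_simps d_simps a_ac)
  thus ?thesis using FilI u u' by auto
qed

lemma Fil_neg: assumes "x \<in> Fil r" shows "\<ominus> x \<in> Fil r"
proof -
  obtain u v where u: "u \<in> carrier M" "v \<in> carrier M" "x = (V ^^ r) u \<oplus> differential M ((V ^^ r) v)"
    using assms unfolding Fil_iff by blast
  have "\<ominus> x = (V ^^ r) (\<ominus> u) \<oplus> differential M ((V ^^ r) (\<ominus> v))"
    using u by (simp add: V_pow_simps d_simps minus_add a_ac)
  thus ?thesis using FilI u by auto
qed

lemma Fil_zero [simp]: "\<zero> \<in> Fil r"
  using Fil_V[of \<zero> r] by (simp add: V_pow_simps)

lemma Fil_minus: "x \<in> Fil r \<Longrightarrow> y \<in> Fil r \<Longrightarrow> x \<ominus> y \<in> Fil r"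
  by (simp add: minus_eq Fil_add Fil_neg)

lemma Fil_subgroup: "additive_subgroup (Fil r) M"
proof (intro additive_subgroupI subgroup.intro)
  show "Fil r \<subseteq> carrier (add_monoid M)" using Fil_carrier by auto
  show "x \<otimes>\<^bsub>add_monoid M\<^esub> y \<in> Fil r" if "x \<in> Fil r" "y \<in> Fil r" for x y using Fil_add that by simp
  show "\<one>\<^bsub>add_monoid M\<^esub> \<in> Fil r" by simp
  show "inv\<^bsub>add_monoid M\<^esub> x \<in> Fil r" if "x \<in> Fil r" for x
    using Fil_neg[OF that] by (simp add: a_inv_def)
qed

lemma Fil_minus_cancel:
  "x \<in> carrier M \<Longrightarrow> y \<in> carrier M \<Longrightarrow> x \<ominus> y \<in> Fil r \<Longrightarrow> y \<in> Fil r \<Longrightarrow> x \<in> Fil r"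
  using Fil_add[of "x \<ominus> y" r y] by (simp add: add_minus_cancel)

lemma Fil_minus_trans:
  "x \<in> carrier M \<Longrightarrow> y \<in> carrier M \<Longrightarrow> z \<in> carrier M \<Longrightarrow> x \<ominus> y \<in> Fil r \<Longrightarrow> y \<ominus> z \<in> Fil r \<Longrightarrow> x \<ominus> z \<in> Fil r"
  using Fil_add[of "x \<ominus> y" r "y \<ominus> z"] by (simp add: minus_telescope)

lemma Fil_minus_swap:
  assumes "x \<in> carrier M" "y \<in> carrier M" "x \<ominus> y \<in> Fil r" shows "y \<ominus> x \<in> Fil r"
proof -
  have "y \<ominus> x = \<ominus> (x \<ominus> y)" using assms by (simp add: minus_eq minus_add a_ac)
  thus ?thesis using Fil_neg assms by simp
qed

lemma Fil_d: assumes "x \<in> Fil r" shows "differential M x \<in> Fil r"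
  using assms unfolding Fil_iff[of x]
  by (auto simp: V_pow_simps d_simps differential_square Fil_dV)

lemma Fil_Suc: "x \<in> Fil (Suc r) \<Longrightarrow> x \<in> Fil r"
  unfolding Fil_iff funpow_Suc_right comp_apply using V_carrier by blast

lemma Fil_mono: "r \<le> s \<Longrightarrow> Fil s \<subseteq> Fil r"
  by (rule lift_Suc_antimono_le[of Fil]) (auto intro: Fil_Suc)

text \<open>One level is lost because F dV = d uses up one V in the second summand; in the first, FV
  = p is absorbed into u.\<close>

lemma Fil_F: assumes "x \<in> Fil (Suc r)" shows "Frob M x \<in> Fil r"
proof -
  obtain u v where u: "u \<in> carrier M" "v \<in> carrier M" "x = (V ^^ Suc r) u \<oplus> differential M ((V ^^ Suc r) v)"
    using assms unfolding Fil_iff by blast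
  have "Frob M x = (V ^^ r) ([p] \<cdot> u) \<oplus> differential M ((V ^^ r) v)"
    using u by (simp add: F_simps V_simps V_pow_simps d_simps F_V F_d_V nat_mult_simps)
  thus ?thesis using FilI[of "[p] \<cdot> u" v r] u nat_mult_simps(6) by simp
qed

lemma Fil_V_closed: assumes "x \<in> Fil r" shows "V x \<in> Fil r"
proof -
  obtain u v where u: "u \<in> carrier M" "v \<in> carrier M" "x = (V ^^ r) u \<oplus> differential M ((V ^^ r) v)"
    using assms unfolding Fil_iff by blast
  \<comment> \<open>V(dw) = p dV(w) for w = V^r v, and the factor p is moved inside V^r.\<close>
  have "V x = (V ^^ r) (V u) \<oplus> differential M ((V ^^ r) ([p] \<cdot> V v))"
    using u by (simp add: V_simps V_pow_simps d_simps V_d funpow_swap1)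
  thus ?thesis using FilI[of "V u" "[p] \<cdot> V v" r] u nat_mult_simps(6) V_carrier by simp
qed

lemma Fil_component: assumes "x \<in> Fil r" shows "component M x n \<in> Fil r"
proof -
  obtain u v where u: "u \<in> carrier M" "v \<in> carrier M" "x = (V ^^ r) u \<oplus> differential M ((V ^^ r) v)"
    using assms unfolding Fil_iff by blast
  have "component M x n = (V ^^ r) (component M u n) \<oplus> differential M ((V ^^ r) (component M v (n - 1)))"
    using u by (simp add: component_simps V_pow_simps d_simps component_V_pow component_d)
  thus ?thesis using FilI u component_carrier by auto
qed

lemma Fil_grade:
  assumes "x \<in> Fil r" "x \<in> grade M n"
  shows "\<exists>u\<in>grade M n. \<exists>v\<in>grade M (n - 1). x = (V ^^ r) u \<oplus> differential M ((V ^^ r) v)"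
proof -
  obtain u v where u: "u \<in> carrier M" "v \<in> carrier M" "x = (V ^^ r) u \<oplus> differential M ((V ^^ r) v)"
    using assms unfolding Fil_iff by blast
  have "x = component M x n" using component_homogeneous[OF assms(2)] by simp
  also have "component M x n = (V ^^ r) (component M u n) \<oplus> differential M ((V ^^ r) (component M v (n - 1)))"
    using u by (simp add: component_simps V_pow_simps d_simps component_V_pow component_d)
  finally show ?thesis using u component_grade by blast
qed

text \<open>Let F^k x = Vy + dVz. Differentiating gives p^k F^k(dx) = dVy, and a further F turns
  this into dy = p^k F^(k+1)(dx), so y = F^k y' for some y'. The remaining part w = x - Vy'
  satisfies F^k w = dVz; applying V^k gives p^k w = V^k(dVz) = p^k d(V^k Vz), and p^k
  cancels.\<close>

lemma Fil1_if_F_pow: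
  assumes x: "x \<in> carrier M" and F: "(Frob M ^^ k) x \<in> Fil 1"
  shows "x \<in> Fil 1"
proof -
  note simps = F_simps V_simps d_simps F_pow_simps V_pow_simps nat_mult_simps
  note closed = F_simps(1) d_simps(1) V_simps(1) F_pow_simps(1) V_pow_simps(1) nat_mult_simps(6)
  obtain y z where yz: "y \<in> carrier M" "z \<in> carrier M" "(Frob M ^^ k) x = V y \<oplus> differential M (V z)"
    using F unfolding Fil_iff by auto
  have "[(p ^ k)] \<cdot> (Frob M ^^ k) (differential M x) = differential M (V y)"
  proof -
    have "differential M ((Frob M ^^ k) x) = differential M (V y)"
      unfolding yz(3) using yz by (simp add: simps differential_square)
    thus ?thesis using d_F_pow[OF x] by simp
  qed
  hence "differential M y = [(p ^ k)] \<cdot> Frob M ((Frob M ^^ k) (differential M x))"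
    using F_d_V[OF yz(1)] x by (simp add: simps flip: \<open>_ = differential M (V y)\<close>)
  then obtain y' where y': "y' \<in> carrier M" "(Frob M ^^ k) y' = y"
    using F_pow_surj[OF yz(1) closed(1)[OF closed(4)[OF closed(2)[OF x]]]] by blast
  let ?w = "x \<ominus> V y'"
  have "(Frob M ^^ k) ?w = (V y \<oplus> differential M (V z)) \<ominus> V y"
    using x y' yz V_F_pow[OF y'(1), of k] by (simp add: simps)
  also have "\<dots> = differential M (V z)"
    using yz by (simp add: simps add_minus_cancel a_comm[of "V y"])
  finally have "(V ^^ k) ((Frob M ^^ k) ?w) = (V ^^ k) (differential M (V z))" by simp
  hence "[(p ^ k)] \<cdot> ?w = [(p ^ k)] \<cdot> differential M ((V ^^ k) (V z))"
    using x y' yz by (simp add: V_pow_F_pow V_pow_d V_carrier)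
  hence "?w = differential M ((V ^^ k) (V z))"
    by (rule p_pow_cancel[rotated 2]) (use x y' yz in \<open>auto simp: simps\<close>)
  hence "?w = differential M (V ((V ^^ k) z))" by (simp add: funpow_swap1)
  hence "x = V y' \<oplus> differential M (V ((V ^^ k) z))"
    using x y' add_minus_cancel(1)[of x "V y'"] V_carrier by simp
  thus ?thesis using FilI[of y' "(V ^^ k) z" 1] y' yz closed by simp
qed

text \<open>The hypothesis amounts to saying that an element of degree n closed modulo p is exact
  modulo p; \<open>H\<close> below is the analogue modulo p^r. It is applied to F^r x, whose
  differential is p^r F^r(dx). Since p^r u + dv = F^r(V^r u + dV^r v), injectivity of F^r gives the
  result.\<close>

lemma grade_in_Fil:
  assumes n: "grade M n \<subseteq> Fil 1" and x: "x \<in> grade M n"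
  shows "x \<in> Fil r"
proof -
  note simps = F_simps V_simps d_simps F_pow_simps V_pow_simps nat_mult_simps
  note closed = F_simps(1) d_simps(1) V_simps(1) F_pow_simps(1) V_pow_simps(1) nat_mult_simps(6)
  have H: "\<exists>u\<in>grade M n. \<exists>v\<in>carrier M. y = [(p ^ r)] \<cdot> u \<oplus> differential M v"
    if "y \<in> grade M n" "w \<in> carrier M" "differential M y = [(p ^ r)] \<cdot> w" for y w
    using that
  proof (induction r arbitrary: y w)
    case 0
    thus ?case using grade_carrier by (intro bexI[of _ y] bexI[of _ \<zero>]) (auto simp: simps)
  next
    case (Suc r)
    \<comment> \<open>y is divided by F, the quotient is expanded by the hypothesis, and F is
      applied again: y = pu + dv. Then p du = dy, so du is divisible by p^r and the induction
      continues with u.\<close>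
    have dy: "differential M y = [p] \<cdot> ([(p ^ r)] \<cdot> w)" using Suc.prems by (simp add: simps)
    then obtain x where x: "x \<in> grade M n" "Frob M x = y"
      using F_surj_grade[OF Suc.prems(1) closed(6)[OF Suc.prems(2)]] by blast
    obtain u v where uv: "u \<in> grade M n" "v \<in> grade M (n - 1)" "x = V u \<oplus> differential M (V v)"
      using Fil_grade[of x 1 n] subsetD[OF n x(1)] x(1) by auto
    have c: "u \<in> carrier M" "v \<in> carrier M" using uv grade_carrier by auto
    have y: "y = [p] \<cdot> u \<oplus> differential M v"
      using x(2) uv(3) c by (auto simp: simps F_V F_d_V)
    have "[p] \<cdot> differential M u = [p] \<cdot> ([(p ^ r)] \<cdot> w)"
      using c by (simp add: simps differential_square flip: dy) (simp add: y simps differential_square)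
    hence "differential M u = [(p ^ r)] \<cdot> w"
      by (rule p_cancel[OF closed(2)[OF c(1)] closed(6)[OF Suc.prems(2)]])
    then obtain u' v' where uv': "u' \<in> grade M n" "v' \<in> carrier M" "u = [(p ^ r)] \<cdot> u' \<oplus> differential M v'"
      using Suc.IH[OF uv(1) Suc.prems(2)] by blast
    have "y = [(p ^ Suc r)] \<cdot> u' \<oplus> differential M ([p] \<cdot> v' \<oplus> v)"
      unfolding y uv'(3) using uv' c grade_carrier by (simp add: simps a_assoc)
    moreover have "[p] \<cdot> v' \<oplus> v \<in> carrier M" using uv' c by (simp add: simps)
    ultimately show ?case using uv'(1) by blast
  qed
  have c: "x \<in> carrier M" using x grade_carrier by auto
  have "differential M ((Frob M ^^ r) x) = [(p ^ r)] \<cdot> (Frob M ^^ r) (differential M x)"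
    by (rule d_F_pow[OF c])
  then obtain u v where uv: "u \<in> grade M n" "v \<in> carrier M"
      "(Frob M ^^ r) x = [(p ^ r)] \<cdot> u \<oplus> differential M v"
    using H[OF F_pow_grade[OF x] closed(4)[OF closed(2)[OF c]]] by blast
  have u: "u \<in> carrier M" using uv grade_carrier by auto
  have "(Frob M ^^ r) x = (Frob M ^^ r) ((V ^^ r) u \<oplus> differential M ((V ^^ r) v))"
    using uv u by (simp add: simps F_pow_V_pow F_pow_d_V_pow)
  hence "x = (V ^^ r) u \<oplus> differential M ((V ^^ r) v)"
    by (rule F_pow_inj[rotated 2]) (use c uv u in \<open>auto simp: simps\<close>)
  thus ?thesis using FilI[OF u uv(2)] by simp
qed

text \<open>Elements of the limit are families of cosets. Representatives X r turn surjectivity into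
  convergence of a sequence with X (r+1) - X r in Fil r, and injectivity into separatedness. In this
  form strictness can be verified for subalgebras.\<close>

lemma completion_bijI:
  assumes sep: "\<And>x. x \<in> grade M n \<Longrightarrow> (\<And>r. x \<in> Fil r) \<Longrightarrow> x = \<zero>"
    and complete: "\<And>X. (\<And>r. X r \<in> grade M n) \<Longrightarrow> (\<And>r. X (Suc r) \<ominus> X r \<in> Fil r) \<Longrightarrow>
      \<exists>x\<in>grade M n. \<forall>r. x \<ominus> X r \<in> Fil r"
  shows "bij_betw (\<lambda>x r. Fil r +> x) (grade M n) (Witt_completion p M n)"
  unfolding bij_betw_def
proof (intro conjI Set.set_eqI iffI)
  note coset = coset_eq_iff[OF Fil_subgroup grade_carrier grade_carrier]
  have trans: "Fil r <+>\<^bsub>M\<^esub> (Fil (Suc r) +> x) = Fil r +> x" if "x \<in> grade M n" for x r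
    by (rule set_add_coset[OF Fil_subgroup Fil_subgroup]) (use Fil_Suc that grade_carrier in auto)
  show "inj_on (\<lambda>x r. Fil r +> x) (grade M n)"
  proof (rule inj_onI)
    fix x y assume xy: "x \<in> grade M n" "y \<in> grade M n" "(\<lambda>r. Fil r +> x) = (\<lambda>r. Fil r +> y)"
    hence "x \<ominus> y \<in> Fil r" for r using coset by metis
    hence "x \<ominus> y = \<zero>" using sep xy minus_grade by blast
    thus "x = y" using xy minus_eq_zero_iff grade_carrier by auto
  qed
  show "c \<in> Witt_completion p M n" if "c \<in> (\<lambda>x r. Fil r +> x) ` grade M n" for c
    using that trans unfolding Witt_completion_def Witt_trunc_def by auto
  show "c \<in> (\<lambda>x r. Fil r +> x) ` grade M n" if "c \<in> Witt_completion p M n" for c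
  proof -
    have "\<forall>r. \<exists>x\<in>grade M n. c r = Fil r +> x" and c: "\<And>r. Fil r <+>\<^bsub>M\<^esub> c (Suc r) = c r"
      using that unfolding Witt_completion_def Witt_trunc_def by (blast, simp)
    then obtain X where X: "\<And>r. X r \<in> grade M n" "\<And>r. c r = Fil r +> X r" by metis
    have "X (Suc r) \<ominus> X r \<in> Fil r" for r using c[of r] trans[OF X(1)] X coset by metis
    then obtain x where x: "x \<in> grade M n" "\<And>r. x \<ominus> X r \<in> Fil r" using complete X by metis
    have "c = (\<lambda>r. Fil r +> x)" using coset[OF x(1) X(1)] x(2) X(2) by (intro ext) metis
    thus ?thesis using x(1) by blast
  qed
qed

end

section \<open>Separatedness and completeness of strict complexes\<close>

context strict_dieudonne_complex
begin

lemma Fil_separated: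
  assumes "x \<in> grade M n" "\<And>r. x \<in> Fil r"
  shows "x = \<zero>"
proof -
  have inj: "inj_on (\<lambda>x r. Fil r +> x) (grade M n)" by (rule bij_betw_imp_inj_on[OF completion_bij])
  have x: "x \<in> carrier M" using assms(1) by (rule grade_carrier)
  have "x \<ominus> \<zero> = x" using x by (simp add: minus_eq)
  hence "Fil r +> x = Fil r +> \<zero>" for r
    using coset_eq_iff[OF Fil_subgroup x zero_closed, of r] assms(2)[of r] by simp
  hence "(\<lambda>r. Fil r +> x) = (\<lambda>r. Fil r +> \<zero>)" by (rule ext)
  thus ?thesis using inj_onD[OF inj _ assms(1) zero_grade] by simp
qed

lemma Fil_complete:
  assumes X: "\<And>r. X r \<in> grade M n" and d: "\<And>r. X (Suc r) \<ominus> X r \<in> Fil r"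
  shows "\<exists>x\<in>grade M n. \<forall>r. x \<ominus> X r \<in> Fil r"
proof -
  note coset = coset_eq_iff[OF Fil_subgroup grade_carrier grade_carrier]
  have "Fil r <+>\<^bsub>M\<^esub> (Fil (Suc r) +> X (Suc r)) = Fil r +> X r" for r
  proof -
    have "Fil r <+>\<^bsub>M\<^esub> (Fil (Suc r) +> X (Suc r)) = Fil r +> X (Suc r)"
      by (rule set_add_coset[OF Fil_subgroup Fil_subgroup]) (use Fil_Suc grade_carrier[OF X] in auto)
    also have "\<dots> = Fil r +> X r" using coset[OF X X] d by blast
    finally show ?thesis .
  qed
  hence "(\<lambda>r. Fil r +> X r) \<in> Witt_completion p M n"
    using X unfolding Witt_completion_def Witt_trunc_def by auto
  hence "(\<lambda>r. Fil r +> X r) \<in> (\<lambda>x r. Fil r +> x) ` grade M n"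
    by (subst bij_betw_imp_surj_on[OF completion_bij])
  then obtain x where x: "x \<in> grade M n" "(\<lambda>r. Fil r +> X r) = (\<lambda>r. Fil r +> x)" by (rule imageE) blast
  have "x \<ominus> X r \<in> Fil r" for r using coset[OF x(1) X, of r r] fun_cong[OF x(2), of r] by simp
  thus ?thesis using x by blast
qed

lemma Fil_separated_eq:
  assumes "x \<in> grade M n" "y \<in> grade M n" "\<And>r. x \<ominus> y \<in> Fil r"
  shows "x = y"
proof -
  have "x \<ominus> y = \<zero>" by (rule Fil_separated[OF minus_grade]) (use assms in auto)
  thus ?thesis using minus_eq_zero_iff[of x y] assms grade_carrier by blast
qed

lemma grade_vanishes:
  assumes "grade M n \<subseteq> Fil 1"
  shows "grade M n = {\<zero>}"
proof (rule equalityI)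
  show "grade M n \<subseteq> {\<zero>}"
  proof (rule subsetI)
    fix x assume x: "x \<in> grade M n"
    have "x = \<zero>" by (rule Fil_separated[OF x grade_in_Fil[OF assms x]])
    thus "x \<in> {\<zero>}" by simp
  qed
  show "{\<zero>} \<subseteq> grade M n" by simp
qed

end

section \<open>Strict Dieudonne algebras\<close>

context dieudonne_algebra
begin

lemmas F_mult = ring_hom_mult[OF Frob_ring_hom] and F_one = ring_hom_one[OF Frob_ring_hom]

lemma F_pow_mult:
  "x \<in> carrier A \<Longrightarrow> y \<in> carrier A \<Longrightarrow> (Frob A ^^ k) (x \<otimes> y) = (Frob A ^^ k) x \<otimes> (Frob A ^^ k) y"
  by (induction k) (simp_all add: F_mult F_pow_simps)

lemma F_nat_pow: "x \<in> carrier A \<Longrightarrow> Frob A (x [^] (k::nat)) = Frob A x [^] k"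
  by (induction k) (simp_all add: F_mult F_one)

lemma nat_pow_grade: "x \<in> grade A 0 \<Longrightarrow> x [^] (k::nat) \<in> grade A 0"
  by (induction k) (use one_grade mult_grade[of _ 0 _ 0] in auto)

lemma grade_zero_comm:
  assumes "x \<in> grade A 0" "y \<in> carrier A"
  shows "x \<otimes> y = y \<otimes> x"
  using assms(2)
proof (induction y rule: homogeneous_induct)
  case (homogeneous n y)
  show ?case using graded_comm[OF assms(1) homogeneous] by simp
next
  case (add y z)
  show ?case using add grade_carrier[OF assms(1)] by (simp add: l_distr r_distr)
qed

text \<open>The sign depends on the degree of the left factor alone, so the right factor may be
  inhomogeneous.\<close>

lemma Leibniz_left:
  assumes x: "x \<in> grade A m" and y: "y \<in> carrier A"
  shows "differential A (x \<otimes> y) = (differential A x \<otimes> y) \<oplus>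
    (if even m then x \<otimes> differential A y else \<ominus> (x \<otimes> differential A y))"
  using y
proof (induction y rule: homogeneous_induct)
  case (homogeneous n y)
  show ?case by (rule Leibniz[OF x homogeneous])
next
  case (add y z)
  have "x \<in> carrier A" "differential A x \<in> carrier A" using grade_carrier[OF x] d_simps by auto
  thus ?case using add by (simp add: r_distr d_simps minus_add a_ac)
qed

text \<open>Used for the saturation, where membership of a product involves its differential and the
  Leibniz rule wants a homogeneous left factor.\<close>

lemma mult_closed_if_homogeneous:
  assumes S: "S \<subseteq> carrier A" "\<And>x y. x \<in> S \<Longrightarrow> y \<in> S \<Longrightarrow> x \<oplus> y \<in> S" "\<zero> \<in> S"
    and x: "x \<in> carrier A" and y: "y \<in> carrier A"
    and h: "\<And>m n. component A x m \<otimes> component A y n \<in> S"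
  shows "x \<otimes> y \<in> S"
proof -
  have fin: "(\<Oplus>n\<in>I. f n) \<in> S" if "finite I" "\<And>n. f n \<in> S" for I :: "int set" and f
    using that
  proof (induction I rule: finite_induct)
    case (insert i I)
    hence "f \<in> insert i I \<rightarrow> carrier A" using S(1) by auto
    thus ?case using insert S by auto
  qed (use S in auto)
  let ?I = "{n. component A x n \<noteq> \<zero>}" and ?J = "{n. component A y n \<noteq> \<zero>}"
  have "component A x m \<otimes> y \<in> S" for m
  proof -
    have "component A x m \<otimes> y = component A x m \<otimes> (\<Oplus>n\<in>?J. component A y n)"
      using component_sum[OF y] by simp
    also have "\<dots> = (\<Oplus>n\<in>?J. component A x m \<otimes> component A y n)"
      by (rule finsum_rdistr) (use x y component_finite component_carrier in auto)
    also have "\<dots> \<in> S" by (rule fin) (use h component_finite[OF y] in auto)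
    finally show ?thesis .
  qed
  hence "(\<Oplus>m\<in>?I. component A x m \<otimes> y) \<in> S" by (intro fin) (use component_finite[OF x] in auto)
  also have "(\<Oplus>m\<in>?I. component A x m \<otimes> y) = (\<Oplus>m\<in>?I. component A x m) \<otimes> y"
    by (rule finsum_ldistr[symmetric]) (use x y component_finite component_carrier in auto)
  also have "(\<Oplus>m\<in>?I. component A x m) = x" using component_sum[OF x] by simp
  finally show ?thesis .
qed

end

section \<open>The filtration by ideals and the ring W^0/VW^0\<close>

context strict_dieudonne_algebra
begin

text \<open>The projection formula: the injective F^r sends both sides to p^r u F^r(y).\<close>

lemma V_pow_mult_left:
  assumes "u \<in> carrier A" "y \<in> carrier A"
  shows "(V ^^ r) u \<otimes> y = (V ^^ r) (u \<otimes> (Frob A ^^ r) y)"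
  by (rule F_pow_inj[of _ _ r])
    (use assms in \<open>simp_all add: V_pow_simps F_pow_simps F_pow_mult F_pow_V_pow add_pow_ldistr\<close>)

lemma V_pow_mult_right:
  assumes "u \<in> carrier A" "y \<in> carrier A"
  shows "y \<otimes> (V ^^ r) u = (V ^^ r) ((Frob A ^^ r) y \<otimes> u)"
  by (rule F_pow_inj[of _ _ r])
    (use assms in \<open>simp_all add: V_pow_simps F_pow_simps F_pow_mult F_pow_V_pow add_pow_rdistr\<close>)

lemma Fil_neg_iff: "x \<in> carrier A \<Longrightarrow> \<ominus> x \<in> Fil r \<longleftrightarrow> x \<in> Fil r"
  using Fil_neg[of x r] Fil_neg[of "\<ominus> x" r] by auto

lemma Fil_add_cancel_left:
  assumes "x \<in> Fil r" "y \<in> carrier A" "x \<oplus> y \<in> Fil r" shows "y \<in> Fil r"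
  using Fil_minus[OF assms(3,1)] assms(2) Fil_carrier[OF assms(1)] add_minus_cancel(3)[of y x]
  by (simp add: a_comm)

text \<open>For homogeneous y, the Leibniz rule expresses y dV^r v, up to sign, as d(y V^r v) - dy
  V^r v, and both terms lie in the filtration by the projection formula.\<close>

lemma Fil_mult_left:
  assumes x: "x \<in> Fil r" and y: "y \<in> carrier A"
  shows "y \<otimes> x \<in> Fil r"
proof -
  obtain u v where u: "u \<in> carrier A" "v \<in> carrier A" "x = (V ^^ r) u \<oplus> differential A ((V ^^ r) v)"
    using x unfolding Fil_iff by blast
  have V: "z \<otimes> (V ^^ r) w \<in> Fil r" if "z \<in> carrier A" "w \<in> carrier A" for z w
    using that by (simp add: V_pow_mult_right Fil_V F_pow_simps)
  have "y \<otimes> differential A ((V ^^ r) v) \<in> Fil r" using y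
  proof (induction y rule: homogeneous_induct)
    case (homogeneous m y)
    have c: "y \<in> carrier A" "differential A y \<in> carrier A" "(V ^^ r) v \<in> carrier A"
        "differential A ((V ^^ r) v) \<in> carrier A"
      using grade_carrier[OF homogeneous] u d_simps V_pow_simps by auto
    have "differential A (y \<otimes> (V ^^ r) v) \<in> Fil r" by (rule Fil_d[OF V[OF c(1) u(2)]])
    hence "(if even m then y \<otimes> differential A ((V ^^ r) v) else \<ominus> (y \<otimes> differential A ((V ^^ r) v))) \<in> Fil r"
      unfolding Leibniz_left[OF homogeneous c(3)]
      by (rule Fil_add_cancel_left[rotated 2]) (use V[OF c(2) u(2)] c in auto)
    thus ?case using c by (auto simp: Fil_neg_iff split: if_splits)
  next
    case (add y z)
    thus ?case using u by (simp add: l_distr Fil_add d_simps V_pow_simps)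
  qed
  thus ?thesis unfolding u(3) using V[OF y u(1)] u y
    by (simp add: r_distr Fil_add d_simps V_pow_simps)
qed

text \<open>The left factor in the Leibniz rule is now V^r v, so the induction over homogeneous
  parts runs over v instead of y.\<close>

lemma Fil_mult_right:
  assumes x: "x \<in> Fil r" and y: "y \<in> carrier A"
  shows "x \<otimes> y \<in> Fil r"
proof -
  obtain u v where u: "u \<in> carrier A" "v \<in> carrier A" "x = (V ^^ r) u \<oplus> differential A ((V ^^ r) v)"
    using x unfolding Fil_iff by blast
  have V: "(V ^^ r) w \<otimes> z \<in> Fil r" if "z \<in> carrier A" "w \<in> carrier A" for z w
    using that by (simp add: V_pow_mult_left Fil_V F_pow_simps)
  have "differential A ((V ^^ r) v) \<otimes> y \<in> Fil r" using u(2)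
  proof (induction v rule: homogeneous_induct)
    case (homogeneous m v)
    have c: "v \<in> carrier A" "differential A y \<in> carrier A" "(V ^^ r) v \<in> carrier A"
        "differential A ((V ^^ r) v) \<in> carrier A"
      using grade_carrier[OF homogeneous] y d_simps V_pow_simps by auto
    let ?e = "if even m then (V ^^ r) v \<otimes> differential A y else \<ominus> ((V ^^ r) v \<otimes> differential A y)"
    have e: "?e \<in> Fil r" using V[OF c(2,1)] Fil_neg by auto
    have "differential A ((V ^^ r) v \<otimes> y) \<in> Fil r" by (rule Fil_d[OF V[OF y c(1)]])
    hence "?e \<oplus> differential A ((V ^^ r) v) \<otimes> y \<in> Fil r"
      unfolding Leibniz_left[OF V_pow_grade[OF homogeneous] y]
      using a_comm[of ?e "differential A ((V ^^ r) v) \<otimes> y"] c y Fil_carrier[OF e] by simp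
    thus ?case by (rule Fil_add_cancel_left[OF e, rotated]) (use c y in auto)
  next
    case (add v w)
    thus ?case using y by (simp add: l_distr Fil_add d_simps V_pow_simps)
  qed
  thus ?thesis unfolding u(3) using V[OF y u(1)] u y
    by (simp add: l_distr Fil_add d_simps V_pow_simps)
qed

lemma Fil_grade_zero:
  assumes "x \<in> Fil r" "x \<in> grade A 0"
  shows "\<exists>u\<in>grade A 0. x = (V ^^ r) u"
proof -
  obtain u v where uv: "u \<in> grade A 0" "v \<in> grade A (0 - 1)" "x = (V ^^ r) u \<oplus> differential A ((V ^^ r) v)"
    using Fil_grade[OF assms] by blast
  \<comment> \<open>v has degree -1, so the part coming from dV^r is absent in degree 0.\<close>
  have "v = \<zero>" using uv(2) negative_grade[of "-1"] by simp
  hence "x = (V ^^ r) u" using uv grade_carrier[OF uv(1)] by (simp add: V_pow_simps d_simps)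
  thus ?thesis using uv by blast
qed

lemma degree_zero_simps:
  "carrier (degree_zero A) = grade A 0" "monoid.mult (degree_zero A) = monoid.mult A" "one (degree_zero A) = \<one>"
  "zero (degree_zero A) = \<zero>" "add (degree_zero A) = add A"
  by (simp_all add: degree_zero_def)

lemma degree_zero_cring: "cring (degree_zero A)"
proof (rule cringI)
  show "abelian_group (degree_zero A)"
  proof (rule abelian_groupI; unfold degree_zero_simps)
    show "\<exists>y\<in>grade A 0. y \<oplus> x = \<zero>" if "x \<in> grade A 0" for x
      using that neg_grade l_neg grade_carrier by blast
  qed (auto simp: a_ac add_grade grade_carrier)
  show "Group.comm_monoid (degree_zero A)"
  proof (rule comm_monoidI; unfold degree_zero_simps)
    show "x \<otimes> y \<otimes> z = x \<otimes> (y \<otimes> z)" if "x \<in> grade A 0" "y \<in> grade A 0" "z \<in> grade A 0" for x y z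
      using that grade_carrier by (simp add: m_assoc)
  qed (use mult_grade[of _ 0 _ 0] one_grade grade_zero_comm grade_carrier in auto)
qed (auto simp: degree_zero_simps l_distr grade_carrier)

lemma degree_zero_a_inv: "x \<in> grade A 0 \<Longrightarrow> \<ominus>\<^bsub>degree_zero A\<^esub> x = \<ominus> x"
proof -
  interpret Z: cring "degree_zero A" by (rule degree_zero_cring)
  assume "x \<in> grade A 0"
  thus ?thesis using Z.minus_equality[of "\<ominus> x" x] neg_grade l_neg grade_carrier
    by (simp add: degree_zero_simps)
qed

lemma degree_zero_minus: "x \<in> grade A 0 \<Longrightarrow> y \<in> grade A 0 \<Longrightarrow> x \<ominus>\<^bsub>degree_zero A\<^esub> y = x \<ominus> y"
  by (simp add: a_minus_def degree_zero_a_inv degree_zero_simps)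

lemma degree_zero_nat_pow: "x [^]\<^bsub>degree_zero A\<^esub> (k::nat) = x [^] k"
  by (simp add: nat_pow_def degree_zero_simps)

lemma V_image_ideal: "ideal (V ` grade A 0) (degree_zero A)"
proof (rule idealI)
  interpret Z: cring "degree_zero A" by (rule degree_zero_cring)
  show "ring (degree_zero A)" by (rule Z.ring_axioms)
  show "subgroup (V ` grade A 0) (add_monoid (degree_zero A))"
  proof (rule subgroup.intro)
    show "inv\<^bsub>add_monoid (degree_zero A)\<^esub> x \<in> V ` grade A 0" if x: "x \<in> V ` grade A 0" for x
    proof -
      obtain u where u: "u \<in> grade A 0" "x = V u" using x by blast
      have "inv\<^bsub>add_monoid (degree_zero A)\<^esub> x = V (\<ominus> u)"
        using degree_zero_a_inv[of x] u V_grade[OF u(1)] V_simps(4)[OF grade_carrier[OF u(1)]]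
        by (simp add: a_inv_def)
      thus ?thesis using u neg_grade by blast
    qed
    show "x \<otimes>\<^bsub>add_monoid (degree_zero A)\<^esub> y \<in> V ` grade A 0"
      if "x \<in> V ` grade A 0" "y \<in> V ` grade A 0" for x y
      using that by (auto simp: degree_zero_simps V_simps(2)[symmetric] grade_carrier add_grade)
    show "\<one>\<^bsub>add_monoid (degree_zero A)\<^esub> \<in> V ` grade A 0"
      using V_simps(3) zero_grade[of 0] by (auto simp: degree_zero_simps intro!: image_eqI[of _ _ \<zero>])
  qed (auto simp: degree_zero_simps V_grade)
  have *: "V u \<otimes> x = V (u \<otimes> Frob A x)" if "u \<in> grade A 0" "x \<in> grade A 0" for u x
    using V_pow_mult_left[of u x 1] that grade_carrier by simp
  have **: "u \<otimes> Frob A x \<in> grade A 0" if "u \<in> grade A 0" "x \<in> grade A 0" for u x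
    using that mult_grade[of u 0 _ 0] Frob_grade by simp
  show "a \<otimes>\<^bsub>degree_zero A\<^esub> x \<in> V ` grade A 0"
    if "a \<in> V ` grade A 0" "x \<in> carrier (degree_zero A)" for a x
    using that * ** by (auto simp: degree_zero_simps)
  show "x \<otimes>\<^bsub>degree_zero A\<^esub> a \<in> V ` grade A 0"
    if a: "a \<in> V ` grade A 0" and x: "x \<in> carrier (degree_zero A)" for a x
  proof -
    obtain u where u: "u \<in> grade A 0" "a = V u" using a by blast
    have "x \<otimes> a = V (u \<otimes> Frob A x)"
      using grade_zero_comm[of x a] * u x grade_carrier[OF V_grade[OF u(1)]]
      by (auto simp: degree_zero_simps)
    thus ?thesis using ** u x by (auto simp: degree_zero_simps)
  qed
qed

lemma mod_V_carrier: "carrier (mod_V p A) = {V ` grade A 0 +>\<^bsub>degree_zero A\<^esub> x |x. x \<in> grade A 0}"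
  by (auto simp: mod_V_def FactRing_def A_RCOSETS_def' degree_zero_simps)

lemma mod_V_coset_mem:
  assumes "x \<in> grade A 0"
  shows "y \<in> V ` grade A 0 +>\<^bsub>degree_zero A\<^esub> x \<longleftrightarrow> y \<in> grade A 0 \<and> y \<ominus> x \<in> V ` grade A 0"
proof -
  interpret I: ideal "V ` grade A 0" "degree_zero A" by (rule V_image_ideal)
  have "V ` grade A 0 +>\<^bsub>degree_zero A\<^esub> x \<subseteq> grade A 0"
    using I.a_r_coset_subset_G[of "V ` grade A 0" x] I.a_subset assms by (simp add: degree_zero_simps)
  moreover have "y \<in> V ` grade A 0 +>\<^bsub>degree_zero A\<^esub> x \<longleftrightarrow> y \<ominus> x \<in> V ` grade A 0" if "y \<in> grade A 0"
    using I.a_rcos_module_minus[OF I.ring_axioms, of x y] assms that by (simp add: degree_zero_simps degree_zero_minus)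
  ultimately show ?thesis by blast
qed

lemma mod_V_coset_eq:
  assumes "x \<in> grade A 0" "y \<in> grade A 0"
  shows "V ` grade A 0 +>\<^bsub>degree_zero A\<^esub> x = V ` grade A 0 +>\<^bsub>degree_zero A\<^esub> y \<longleftrightarrow> x \<ominus> y \<in> V ` grade A 0"
proof -
  interpret I: ideal "V ` grade A 0" "degree_zero A" by (rule V_image_ideal)
  show ?thesis
    using I.coset_eq_iff[OF I.is_additive_subgroup, of x y] assms by (simp add: degree_zero_simps degree_zero_minus)
qed

lemma mod_V_ring_hom: "(\<lambda>x. V ` grade A 0 +>\<^bsub>degree_zero A\<^esub> x) \<in> ring_hom (degree_zero A) (mod_V p A)"
  unfolding mod_V_def by (rule ideal.rcos_ring_hom[OF V_image_ideal])

lemma mod_V_ring: "ring (mod_V p A)"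
  unfolding mod_V_def by (rule ideal.quotient_is_ring[OF V_image_ideal])

end

section \<open>Closed subalgebras\<close>

context cring
begin

lemma subring_nat_mult: "subring T R \<Longrightarrow> x \<in> T \<Longrightarrow> [(k::nat)] \<cdot> x \<in> T"
  by (induction k) (simp_all add: subringE(2,7) add.nat_pow_Suc)

lemma subring_nat_pow: "subring T R \<Longrightarrow> x \<in> T \<Longrightarrow> x [^] (k::nat) \<in> T"
  by (induction k) (simp_all add: subringE(3,6))

text \<open>An expansion to first order with remainder h^2 c, where c stays in T. It is applied to h
  for which h^2 is much more divisible than h.\<close>

lemma nat_pow_add_expansion:
  assumes T: "subring T R" and b: "b \<in> T" and h: "h \<in> T"
  shows "\<exists>c\<in>T. (b \<oplus> h) [^] Suc n = (b [^] Suc n \<oplus> [Suc n] \<cdot> (b [^] n \<otimes> h)) \<oplus> (h \<otimes> h) \<otimes> c"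
proof (induction n)
  have C: "x \<in> T \<Longrightarrow> x \<in> carrier R" for x using subringE(1)[OF T] by blast
  {
    case 0
    show ?case using b h C subringE(2)[OF T] by (intro bexI[of _ \<zero>]) auto
  next
    case (Suc n)
    then obtain c where c: "c \<in> T"
      "(b \<oplus> h) [^] Suc n = (b [^] Suc n \<oplus> [Suc n] \<cdot> (b [^] n \<otimes> h)) \<oplus> (h \<otimes> h) \<otimes> c" by blast
    \<comment> \<open>Multiplying the old expansion by b + h produces these coefficients of h^2:
      (n+1) b^n from the linear term times h, and cb + ch from the old remainder.\<close>
    let ?c = "([Suc n] \<cdot> (b [^] n) \<oplus> c \<otimes> b) \<oplus> c \<otimes> h"
    let ?u = "b [^] n"
    have cr: "b \<in> carrier R" "h \<in> carrier R" "c \<in> carrier R" "?u \<in> carrier R" using b h c C by auto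
    have "(b \<oplus> h) [^] Suc (Suc n) = ((b [^] Suc n \<oplus> [Suc n] \<cdot> (?u \<otimes> h)) \<oplus> (h \<otimes> h) \<otimes> c) \<otimes> (b \<oplus> h)"
      using c(2) by simp
    also have "\<dots> = ((?u \<otimes> b \<otimes> b \<oplus> ([Suc n] \<cdot> (?u \<otimes> h) \<otimes> b \<oplus> ?u \<otimes> b \<otimes> h)) \<oplus> (h \<otimes> h) \<otimes> (c \<otimes> b \<oplus> c \<otimes> h))
        \<oplus> [Suc n] \<cdot> (?u \<otimes> h) \<otimes> h"
    proof -
      have "[Suc n] \<cdot> (?u \<otimes> h) \<in> carrier R" using cr by simp
      thus ?thesis using cr by (simp add: l_distr r_distr a_ac m_ac del: add.nat_pow_Suc)
    qed
    also have "[Suc n] \<cdot> (?u \<otimes> h) \<otimes> h = (h \<otimes> h) \<otimes> [Suc n] \<cdot> ?u"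
      using cr by (simp add: add_pow_ldistr add_pow_rdistr m_ac del: add.nat_pow_Suc)
    also have "[Suc n] \<cdot> (?u \<otimes> h) \<otimes> b \<oplus> ?u \<otimes> b \<otimes> h = [Suc (Suc n)] \<cdot> (?u \<otimes> b \<otimes> h)"
      using cr by (subst (2) add.nat_pow_Suc) (simp add: add_pow_ldistr add_pow_rdistr m_ac del: add.nat_pow_Suc)
    also have "((?u \<otimes> b \<otimes> b \<oplus> [Suc (Suc n)] \<cdot> (?u \<otimes> b \<otimes> h)) \<oplus> (h \<otimes> h) \<otimes> (c \<otimes> b \<oplus> c \<otimes> h)) \<oplus> (h \<otimes> h) \<otimes> [Suc n] \<cdot> ?u
       = (b [^] Suc (Suc n) \<oplus> [Suc (Suc n)] \<cdot> (b [^] Suc n \<otimes> h)) \<oplus> (h \<otimes> h) \<otimes> ?c"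
    proof -
      have "[Suc n] \<cdot> ?u \<in> carrier R" "[Suc (Suc n)] \<cdot> (?u \<otimes> b \<otimes> h) \<in> carrier R" using cr by auto
      thus ?thesis using cr by (simp add: l_distr r_distr a_ac m_ac del: add.nat_pow_Suc)
    qed
    finally show ?case using T b h c
      by (intro bexI[of _ ?c]) (auto intro!: subringE(6,7) subring_nat_mult subring_nat_pow simp del: add.nat_pow_Suc)
  }
qed

lemma binomial_finsum:
  assumes x: "x \<in> carrier R" and y: "y \<in> carrier R"
  shows "(x \<oplus> y) [^] n = (\<Oplus>i\<in>{..n}. [(n choose i)] \<cdot> (x [^] i \<otimes> y [^] (n - i)))"
proof (induction n)
  case 0
  show ?case using assms by (simp add: finsum_0)
next
  case (Suc n)
  define a b where "a i = [(n choose i)] \<cdot> (x [^] Suc i \<otimes> y [^] (n - i))"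
    and "b i = [(n choose i)] \<cdot> (x [^] i \<otimes> y [^] (Suc n - i))" for i
  have ab: "a i \<in> carrier R" "b i \<in> carrier R" for i using assms by (auto simp: a_def b_def)
  have "(x \<oplus> y) [^] Suc n = (\<Oplus>i\<in>{..n}. [(n choose i)] \<cdot> (x [^] i \<otimes> y [^] (n - i))) \<otimes> (x \<oplus> y)"
    using Suc by simp
  also have "\<dots> = (\<Oplus>i\<in>{..n}. [(n choose i)] \<cdot> (x [^] i \<otimes> y [^] (n - i)) \<otimes> (x \<oplus> y))"
    by (rule finsum_ldistr) (use assms in auto)
  also have "\<dots> = (\<Oplus>i\<in>{..n}. a i \<oplus> b i)"
  proof (rule finsum_cong')
    fix i assume "i \<in> {..n}"
    hence "Suc n - i = Suc (n - i)" by auto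
    thus "[(n choose i)] \<cdot> (x [^] i \<otimes> y [^] (n - i)) \<otimes> (x \<oplus> y) = a i \<oplus> b i"
      using assms by (simp add: a_def b_def r_distr l_distr add_pow_ldistr add_pow_rdistr m_ac nat_mult_simps)
  qed (use ab in auto)
  also have "\<dots> = (\<Oplus>i\<in>{..n}. a i) \<oplus> (\<Oplus>i\<in>{..n}. b i)"
    by (rule finsum_addf) (use ab in auto)
  \<comment> \<open>The added term i = n + 1 vanishes, as n choose n + 1 is 0; splitting off i = 0
    instead aligns the two sums for Pascal's rule.\<close>
  also have "(\<Oplus>i\<in>{..n}. b i) = (\<Oplus>i\<in>{..Suc n}. b i)"
    using ab by (subst finsum_Suc) (auto simp: b_def[of "Suc n"] binomial_eq_0 assms)
  also have "\<dots> = (\<Oplus>i\<in>{..n}. b (Suc i)) \<oplus> b 0"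
    by (rule finsum_Suc2) (use ab in auto)
  also have "(\<Oplus>i\<in>{..n}. a i) \<oplus> ((\<Oplus>i\<in>{..n}. b (Suc i)) \<oplus> b 0) = (\<Oplus>i\<in>{..n}. a i \<oplus> b (Suc i)) \<oplus> b 0"
    using ab by (subst finsum_addf) (auto simp: a_assoc)
  also have "(\<Oplus>i\<in>{..n}. a i \<oplus> b (Suc i)) = (\<Oplus>i\<in>{..n}. [(Suc n choose Suc i)] \<cdot> (x [^] Suc i \<otimes> y [^] (Suc n - Suc i)))"
    by (rule finsum_cong') (use assms in \<open>auto simp: a_def b_def add.nat_pow_mult simp del: nat_pow_Suc\<close>)
  also have "\<dots> \<oplus> b 0 = (\<Oplus>i\<in>{..Suc n}. [(Suc n choose i)] \<cdot> (x [^] i \<otimes> y [^] (Suc n - i)))"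
    by (subst finsum_Suc2) (use assms in \<open>auto simp: b_def simp del: nat_pow_Suc\<close>)
  finally show ?case .
qed

text \<open>The inner binomial coefficients are divisible by p. That the quotient P stays in T
  serves for Frobenius lifts and for sums of Teichmueller elements inside a subalgebra.\<close>

lemma prime_pow_add:
  assumes p: "Factorial_Ring.prime (p::nat)" and T: "subring T R" and x: "x \<in> T" and y: "y \<in> T"
  shows "\<exists>P\<in>T. (x \<oplus> y) [^] p = (x [^] p \<oplus> y [^] p) \<oplus> [p] \<cdot> P"
proof -
  \<comment> \<open>With p = m + 2 the inner indices 1, ..., p - 1 are the \<open>Suc i\<close> with
    i \<le> m.\<close>
  obtain m where m: "p = Suc (Suc m)" using prime_gt_1_nat[OF p] by (metis One_nat_def less_imp_Suc_add add_Suc_shift plus_1_eq_Suc add.commute)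
  define f where "f i = [(p choose i)] \<cdot> (x [^] i \<otimes> y [^] (p - i))" for i
  have C: "z \<in> T \<Longrightarrow> z \<in> carrier R" for z using subringE(1)[OF T] by blast
  have f: "f i \<in> carrier R" for i using C x y by (auto simp: f_def)
  have "\<exists>P\<in>T. (\<Oplus>i\<in>{..j}. f (Suc i)) = [p] \<cdot> P" if "j \<le> m" for j
    using that
  proof (induction j)
    have 1: "\<exists>P\<in>T. f (Suc j) = [p] \<cdot> P" if "j \<le> m" for j
    proof -
      have "p dvd (p choose Suc j)" using p that m by (intro dvd_choose_prime) auto
      then obtain k where "p choose Suc j = p * k" by (auto elim: dvdE)
      hence "f (Suc j) = [p] \<cdot> ([k] \<cdot> (x [^] Suc j \<otimes> y [^] (p - Suc j)))"
        unfolding f_def using C x y by (metis m_closed nat_mult_simps(2) nat_pow_closed)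
      thus ?thesis using T x y by (blast intro: subring_nat_mult subring_nat_pow subringE(6))
    qed
    {
      case 0
      show ?case using 1[of 0] f by simp
    next
      case (Suc j)
      then obtain P Q where "P \<in> T" "Q \<in> T" "(\<Oplus>i\<in>{..j}. f (Suc i)) = [p] \<cdot> P" "f (Suc (Suc j)) = [p] \<cdot> Q"
        using 1[of "Suc j"] by auto
      thus ?case using f C subringE(7)[OF T] by (intro bexI[of _ "Q \<oplus> P"]) (auto simp: nat_mult_simps)
    }
  qed
  then obtain P where P: "P \<in> T" "(\<Oplus>i\<in>{..m}. f (Suc i)) = [p] \<cdot> P" by blast
  have "(x \<oplus> y) [^] p = (\<Oplus>i\<in>{..p}. f i)"
    unfolding f_def by (rule binomial_finsum) (use C x y in auto)
  also have "\<dots> = f p \<oplus> (\<Oplus>i\<in>{..Suc m}. f i)" unfolding m by (rule finsum_Suc) (use f in auto)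
  also have "(\<Oplus>i\<in>{..Suc m}. f i) = (\<Oplus>i\<in>{..m}. f (Suc i)) \<oplus> f 0" by (rule finsum_Suc2) (use f in auto)
  also have "f p = x [^] p" using C x y by (simp add: f_def)
  also have "f 0 = y [^] p" using C x y by (simp add: f_def)
  finally show ?thesis using P C x y by (intro bexI[of _ P]) (auto simp: a_ac)
qed

end

section \<open>Subalgebras of a strict Dieudonne algebra\<close>

definition restrict_dieudonne :: "('a, 'm) dieudonne_scheme \<Rightarrow> 'a set \<Rightarrow> ('a, 'm) dieudonne_scheme" where
  "restrict_dieudonne A S = A\<lparr>carrier := S, grade := \<lambda>n. grade A n \<inter> S\<rparr>"

text \<open>Partial sums of a series that converges for the filtration; stage k stops before the
  term V^k(u k) and is therefore correct modulo Fil k.\<close>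

primrec V_sum :: "nat \<Rightarrow> ('a, 'm) dieudonne_scheme \<Rightarrow> (nat \<Rightarrow> 'a) \<Rightarrow> nat \<Rightarrow> 'a" where
  "V_sum p A u 0 = \<zero>\<^bsub>A\<^esub>"
| "V_sum p A u (Suc k) = V_sum p A u k \<oplus>\<^bsub>A\<^esub> (Ver p A ^^ k) (u k)"

text \<open>By torsion-freeness the y with Fx = x^p + py is unique in A, so \<open>lift_mem\<close>
  is a genuine closure condition: S has to contain (Fx - x^p)/p.\<close>

locale dieudonne_subalgebra = strict_dieudonne_algebra p A
  for p :: nat and A :: "('a, 'm) dieudonne_scheme" (structure) +
  fixes S :: "'a set"
  assumes subset: "S \<subseteq> carrier A"
    and one_mem: "\<one> \<in> S"
    and add_mem: "x \<in> S \<Longrightarrow> y \<in> S \<Longrightarrow> x \<oplus> y \<in> S"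
    and neg_mem: "x \<in> S \<Longrightarrow> \<ominus> x \<in> S"
    and mult_mem: "x \<in> S \<Longrightarrow> y \<in> S \<Longrightarrow> x \<otimes> y \<in> S"
    and d_mem: "x \<in> S \<Longrightarrow> differential A x \<in> S"
    and F_mem: "x \<in> S \<Longrightarrow> Frob A x \<in> S"
    and component_mem: "x \<in> S \<Longrightarrow> component A x n \<in> S"
    and lift_mem: "x \<in> S \<Longrightarrow> x \<in> grade A 0 \<Longrightarrow> \<exists>y\<in>S \<inter> grade A 0. Frob A x = x [^] p \<oplus> [p] \<cdot> y"
begin

lemma mem_carrier: "x \<in> S \<Longrightarrow> x \<in> carrier A"
  using subset by blast

lemma zero_mem: "\<zero> \<in> S"
  using add_mem[OF one_mem neg_mem[OF one_mem]] by (simp add: r_neg)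

lemma minus_mem: "x \<in> S \<Longrightarrow> y \<in> S \<Longrightarrow> x \<ominus> y \<in> S"
  by (simp add: minus_eq add_mem neg_mem)

lemma nat_mult_mem: "x \<in> S \<Longrightarrow> [(k::nat)] \<cdot> x \<in> S"
  by (induction k) (simp_all add: zero_mem add_mem)

lemma nat_pow_mem: "x \<in> S \<Longrightarrow> x [^] (k::nat) \<in> S"
  by (induction k) (simp_all add: one_mem mult_mem)

lemma F_pow_mem: "x \<in> S \<Longrightarrow> (Frob A ^^ k) x \<in> S"
  by (induction k) (simp_all add: F_mem)

lemma subring_grade_zero: "subring (S \<inter> grade A 0) (degree_zero A)"
proof -
  interpret Z: cring "degree_zero A" by (rule degree_zero_cring)
  show ?thesis
    by (rule Z.subringI)
      (use one_mem neg_mem mult_mem add_mem one_grade neg_grade add_grade mult_grade[of _ 0 _ 0]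
        in \<open>auto simp: degree_zero_simps degree_zero_a_inv\<close>)
qed

end

text \<open>The first condition mentions F(dx) besides Fx because F(dx) is the quotient of d(Fx) by
  p, and the divisibility that characterises the image of F has to take place within S. The second
  is closedness for the topology given by the filtration of A.\<close>

locale closed_dieudonne_subalgebra = dieudonne_subalgebra +
  assumes saturated_mem: "x \<in> carrier A \<Longrightarrow> Frob A x \<in> S \<Longrightarrow> Frob A (differential A x) \<in> S \<Longrightarrow> x \<in> S"
    and closed_mem: "x \<in> carrier A \<Longrightarrow> (\<And>r. \<exists>y\<in>S. x \<ominus> y \<in> Fil r) \<Longrightarrow> x \<in> S"
begin

text \<open>A consequence of saturation, as FVx = px and F(dVx) = dx.\<close>

lemma V_mem:
  assumes "x \<in> S"
  shows "V x \<in> S"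
proof -
  have x: "x \<in> carrier A" using assms by (rule mem_carrier)
  show ?thesis
    by (rule saturated_mem[OF V_carrier[OF x]]) (use assms x in \<open>auto simp: F_V F_d_V nat_mult_mem d_mem\<close>)
qed

lemma V_pow_mem: "x \<in> S \<Longrightarrow> (V ^^ k) x \<in> S"
  by (induction k) (simp_all add: V_mem)

text \<open>Completeness of A provides the limit and closedness puts it into S.\<close>

lemma V_sum_limit:
  assumes u: "\<And>k. u k \<in> S \<inter> grade A n"
  shows "\<exists>y\<in>S \<inter> grade A n. \<forall>k. y \<ominus> V_sum p A u k \<in> Fil k"
proof -
  have mem: "V_sum p A u k \<in> S \<inter> grade A n" for k
    using u by (induction k) (auto simp: zero_mem add_mem add_grade V_pow_mem V_pow_grade)
  have "V_sum p A u (Suc k) \<ominus> V_sum p A u k \<in> Fil k" for k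
  proof -
    have "V_sum p A u (Suc k) \<ominus> V_sum p A u k = (V ^^ k) (u k)"
      using mem[of k] u[of k] mem_carrier V_pow_mem
      by (simp add: a_comm[of "V_sum p A u k"] add_minus_cancel)
    thus ?thesis using Fil_V u mem_carrier by simp
  qed
  then obtain y where y: "y \<in> grade A n" "\<And>k. y \<ominus> V_sum p A u k \<in> Fil k"
    using Fil_complete[of "V_sum p A u" n] mem by blast
  have "y \<in> S" by (rule closed_mem) (use y mem grade_carrier in blast)+
  thus ?thesis using y by blast
qed

text \<open>The carrier shrinks while the element type stays that of A; this is what allows B to be
  a test object of the universal property.\<close>

abbreviation "B \<equiv> restrict_dieudonne A S"

lemma restrict_simps:
  "carrier B = S" "monoid.mult B = monoid.mult A" "one B = \<one>" "zero B = \<zero>" "add B = add A"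
  "grade B n = grade A n \<inter> S" "differential B = differential A" "Frob B = Frob A"
  by (simp_all add: restrict_dieudonne_def)

lemma restrict_ring: "ring B"
proof (rule ringI)
  show "abelian_group B"
  proof (rule abelian_groupI; unfold restrict_simps)
    show "\<exists>y\<in>S. y \<oplus> x = \<zero>" if "x \<in> S" for x
      using that neg_mem l_neg mem_carrier by blast
  qed (auto simp: a_ac add_mem mem_carrier zero_mem)
  show "monoid B"
    by (rule monoidI; unfold restrict_simps) (auto simp: mult_mem one_mem m_assoc mem_carrier)
qed (auto simp: restrict_simps l_distr r_distr mem_carrier)

lemma restrict_a_inv: "x \<in> S \<Longrightarrow> \<ominus>\<^bsub>B\<^esub> x = \<ominus> x"
proof -
  interpret B: ring B by (rule restrict_ring)
  assume "x \<in> S"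
  thus ?thesis using B.minus_equality[of "\<ominus> x" x] neg_mem l_neg mem_carrier
    by (simp add: restrict_simps)
qed

lemma restrict_minus: "x \<in> S \<Longrightarrow> y \<in> S \<Longrightarrow> x \<ominus>\<^bsub>B\<^esub> y = x \<ominus> y"
  by (simp add: a_minus_def restrict_a_inv restrict_simps)

lemma restrict_nat_mult: "[(k::nat)] \<cdot>\<^bsub>B\<^esub> x = [k] \<cdot> x"
  by (simp add: add_pow_def nat_pow_def restrict_simps)

lemma restrict_nat_pow: "x [^]\<^bsub>B\<^esub> (k::nat) = x [^] k"
  by (simp add: nat_pow_def restrict_simps)

lemma restrict_finsum:
  assumes "finite I" "\<And>i. i \<in> I \<Longrightarrow> f i \<in> S"
  shows "finsum B f I = finsum A f I"
proof -
  interpret B: ring B by (rule restrict_ring)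
  show ?thesis using assms
  proof (induction I rule: finite_induct)
    case (insert i I)
    have f: "f \<in> I \<rightarrow> carrier B" "f i \<in> carrier B" using insert.prems unfolding restrict_simps by auto
    have f': "f \<in> I \<rightarrow> carrier A" "f i \<in> carrier A" using insert.prems mem_carrier by auto
    have "finsum B f (insert i I) = f i \<oplus>\<^bsub>B\<^esub> finsum B f I"
      by (rule B.finsum_insert) (use insert.hyps f in auto)
    also have "\<dots> = f i \<oplus> finsum A f I"
      using insert.IH insert.prems by (simp add: restrict_simps(5))
    also have "\<dots> = finsum A f (insert i I)"
      by (rule finsum_insert[symmetric]) (use insert.hyps f' in auto)
    finally show ?case .
  qed (simp add: restrict_simps(4))
qed

lemma restrict_grade_subgroup: "subgroup (grade B n) (add_monoid B)"
proof (rule subgroup.intro)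
  show "inv\<^bsub>add_monoid B\<^esub> x \<in> grade B n" if "x \<in> grade B n" for x
    using restrict_a_inv[of x] that neg_grade neg_mem by (simp add: a_inv_def restrict_simps)
qed (auto simp: restrict_simps add_grade add_mem zero_mem)

lemma restrict_hom:
  "differential B \<in> hom (add_monoid B) (add_monoid B)" "Frob B \<in> hom (add_monoid B) (add_monoid B)"
  by (auto simp: hom_def restrict_simps d_mem d_simps mem_carrier F_mem F_simps)

lemma restrict_direct_sum:
  assumes "x \<in> S"
  shows "\<exists>!c. (\<forall>n. c n \<in> grade A n \<inter> S) \<and> finite {n. c n \<noteq> \<zero>} \<and> x = finsum B c {n. c n \<noteq> \<zero>}"
proof (rule ex1I[of _ "component A x"])
  have x: "x \<in> carrier A" using assms by (rule mem_carrier)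
  have "finsum B (component A x) {n. component A x n \<noteq> \<zero>} = x"
    using restrict_finsum[OF component_finite[OF x], of "component A x"] component_sum[OF x]
      component_mem[OF assms] by simp
  thus "(\<forall>n. component A x n \<in> grade A n \<inter> S) \<and> finite {n. component A x n \<noteq> \<zero>} \<and>
    x = finsum B (component A x) {n. component A x n \<noteq> \<zero>}"
    using component_grade[OF x] component_finite[OF x] component_mem[OF assms]
    by (intro conjI allI IntI) simp_all
  show "c = component A x"
    if c: "(\<forall>n. c n \<in> grade A n \<inter> S) \<and> finite {n. c n \<noteq> \<zero>} \<and> x = finsum B c {n. c n \<noteq> \<zero>}" for c
  proof (rule component_unique[symmetric, of _ "{n. c n \<noteq> \<zero>}"])
    have "finsum B c {n. c n \<noteq> \<zero>} = finsum A c {n. c n \<noteq> \<zero>}"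
      by (rule restrict_finsum) (use c in auto)
    thus "x = finsum A c {n. c n \<noteq> \<zero>}" using c by metis
  qed (use c in auto)
qed

text \<open>For surjectivity the preimage z is taken in A. From p F(dz) = dx = py follows F(dz) = y,
  so saturation puts z into S.\<close>

lemma restrict_Frob_bij:
  "bij_betw (Frob A) (grade A n \<inter> S) {x \<in> grade A n \<inter> S. \<exists>y\<in>grade A (n + 1) \<inter> S. differential A x = [p] \<cdot> y}"
proof (rule bij_betw_imageI)
  show "inj_on (Frob A) (grade A n \<inter> S)"
    using F_inj mem_carrier by (auto simp: inj_on_def)
  show "Frob A ` (grade A n \<inter> S) = {x \<in> grade A n \<inter> S. \<exists>y\<in>grade A (n + 1) \<inter> S. differential A x = [p] \<cdot> y}"
  proof (rule equalityI)
    show "Frob A ` (grade A n \<inter> S) \<subseteq> {x \<in> grade A n \<inter> S. \<exists>y\<in>grade A (n + 1) \<inter> S. differential A x = [p] \<cdot> y}"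
    proof (rule image_subsetI)
      fix x assume x: "x \<in> grade A n \<inter> S"
      have "Frob A (differential A x) \<in> grade A (n + 1) \<inter> S"
        using x Frob_grade[OF differential_grade] d_mem F_mem by blast
      thus "Frob A x \<in> {x \<in> grade A n \<inter> S. \<exists>y\<in>grade A (n + 1) \<inter> S. differential A x = [p] \<cdot> y}"
        using x Frob_grade F_mem differential_Frob[of x] mem_carrier by blast
    qed
    show "{x \<in> grade A n \<inter> S. \<exists>y\<in>grade A (n + 1) \<inter> S. differential A x = [p] \<cdot> y} \<subseteq> Frob A ` (grade A n \<inter> S)"
    proof safe
      fix x y assume x: "x \<in> grade A n" "x \<in> S" and y: "y \<in> grade A (n + 1)" "y \<in> S"
        and dx: "differential A x = [p] \<cdot> y"
      have yc: "y \<in> carrier A" using y by (rule_tac mem_carrier)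
      obtain z where z: "z \<in> grade A n" "Frob A z = x" using F_surj_grade[OF x(1) yc dx] by blast
      have zc: "z \<in> carrier A" using z(1) by (rule grade_carrier)
      have "[p] \<cdot> Frob A (differential A z) = [p] \<cdot> y"
        using differential_Frob[OF zc] z dx by simp
      hence "Frob A (differential A z) = y"
        by (rule p_cancel[OF F_simps(1)[OF d_simps(1)[OF zc]] yc])
      hence "z \<in> S" using saturated_mem[OF zc] z x y by simp
      thus "x \<in> Frob A ` (grade A n \<inter> S)" using z by blast
    qed
  qed
qed

lemma restrict_saturated: "saturated_dieudonne_complex p B"
proof -
  interpret B: ring B by (rule restrict_ring)
  show ?thesis
  proof (intro saturated_dieudonne_complex.intro dieudonne_complex.intro cochain_complex.intro
      cochain_complex_axioms.intro dieudonne_complex_axioms.intro saturated_dieudonne_complex_axioms.intro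
      additive_subgroup.intro B.abelian_group_axioms restrict_grade_subgroup restrict_hom;
      unfold restrict_simps restrict_nat_mult)
    show "\<exists>!c. (\<forall>n. c n \<in> grade A n \<inter> S) \<and> finite {n. c n \<noteq> \<zero>} \<and> x = finsum B c {n. c n \<noteq> \<zero>}"
      if "x \<in> S" for x by (rule restrict_direct_sum[OF that])
    show "bij_betw (Frob A) (grade A n \<inter> S) {x \<in> grade A n \<inter> S. \<exists>y\<in>grade A (n + 1) \<inter> S. differential A x = [p] \<cdot> y}" for n
      by (rule restrict_Frob_bij)
    show "differential A x \<in> grade A (n + 1) \<inter> S" if "x \<in> grade A n \<inter> S" for x n
      using that differential_grade d_mem by blast
    show "Frob A x \<in> grade A n \<inter> S" if "x \<in> grade A n \<inter> S" for x n
      using that Frob_grade F_mem by blast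
    show "differential A (differential A x) = \<zero>" if "x \<in> S" for x
      by (rule differential_square[OF mem_carrier[OF that]])
    show "differential A (Frob A x) = [p] \<cdot> Frob A (differential A x)" if "x \<in> S" for x
      by (rule differential_Frob[OF mem_carrier[OF that]])
    show "x = \<zero>" if "x \<in> S" "[p] \<cdot> x = \<zero>" for x
      by (rule p_torsion_free[OF mem_carrier[OF that(1)] that(2)])
  qed
qed

lemma restrict_V:
  assumes "x \<in> S"
  shows "Ver p B x = V x"
proof -
  interpret B: saturated_dieudonne_complex p B by (rule restrict_saturated)
  show ?thesis
    by (rule B.V_unique) (use assms mem_carrier in \<open>auto simp: restrict_simps V_mem F_V restrict_nat_mult\<close>)
qed

lemma restrict_V_pow: "x \<in> S \<Longrightarrow> (Ver p B ^^ k) x = (V ^^ k) x"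
  by (induction k) (simp_all add: restrict_V V_pow_mem)

text \<open>Only this inclusion is immediate: an element of S in Fil r might come from u and v
  outside S. Separatedness thus passes to B, but completeness for the filtration of B takes an
  argument of its own.\<close>

lemma restrict_Fil: "x \<in> Ver_filtration p B r \<Longrightarrow> x \<in> Fil r"
proof -
  interpret B: saturated_dieudonne_complex p B by (rule restrict_saturated)
  assume "x \<in> Ver_filtration p B r"
  then obtain u v where "u \<in> S" "v \<in> S" "x = (V ^^ r) u \<oplus> differential A ((V ^^ r) v)"
    unfolding B.Fil_iff by (auto simp: restrict_simps restrict_V_pow)
  thus ?thesis using FilI mem_carrier by simp
qed

text \<open>A sequence X that is Cauchy for B has a limit x in A, which lies in S by closedness, yet
  x - X r must be exhibited in the filtration of B. The successive differences are V^k y_k + dV^k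
  z_k with y_k and z_k in S; summed from k = r on, they give V^r Y + dV^r Z, where Y and Z are
  limits in S of convergent series.\<close>

lemma restrict_strict: "strict_dieudonne_complex p B"
proof -
  interpret B: saturated_dieudonne_complex p B by (rule restrict_saturated)
  show ?thesis
  proof (unfold_locales, rule B.completion_bijI)
    show "x = \<zero>\<^bsub>B\<^esub>" if "x \<in> grade B n" "\<And>r. x \<in> B.Fil r" for x n
      using Fil_separated[of x n] that restrict_Fil by (simp add: restrict_simps)
    fix n X assume X: "\<And>r. X r \<in> grade B n" "\<And>r. X (Suc r) \<ominus>\<^bsub>B\<^esub> X r \<in> B.Fil r"
    have X': "X r \<in> grade A n" "X r \<in> S" "X r \<in> carrier A" for r
      using X(1)[of r] mem_carrier by (auto simp: restrict_simps)
    have "\<exists>u\<in>S \<inter> grade A n. \<exists>v\<in>S \<inter> grade A (n - 1). X (Suc r) \<ominus> X r = (V ^^ r) u \<oplus> differential A ((V ^^ r) v)" for r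
      using B.Fil_grade[OF X(2) B.minus_grade[OF X(1) X(1)], of r] X'
      by (auto simp: restrict_simps restrict_V_pow restrict_minus)
    then obtain y z where yz: "\<And>r. y r \<in> S \<inter> grade A n" "\<And>r. z r \<in> S \<inter> grade A (n - 1)"
      "\<And>r. X (Suc r) \<ominus> X r = (V ^^ r) (y r) \<oplus> differential A ((V ^^ r) (z r))" by metis
    have yzc: "y r \<in> carrier A" "z r \<in> carrier A" for r using yz mem_carrier by auto
    have "X (Suc r) \<ominus> X r \<in> Fil r" for r unfolding yz(3) using yzc by (intro FilI)
    then obtain x where x: "x \<in> grade A n" "\<And>r. x \<ominus> X r \<in> Fil r"
      using Fil_complete[of X n] X' by blast
    have xc: "x \<in> carrier A" using x(1) by (rule grade_carrier)
    have xS: "x \<in> S" by (rule closed_mem) (use x X' grade_carrier in blast)+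
    have "x \<ominus> X r \<in> B.Fil r" for r
    proof -
      \<comment> \<open>The indices are shifted by r, so that V^r can be taken out of the sum of the
        V^(r+j) y_(r+j).\<close>
      let ?y = "\<lambda>k. y (r + k)" and ?z = "\<lambda>k. z (r + k)"
      obtain Y where Y: "Y \<in> S \<inter> grade A n" "\<And>k. Y \<ominus> V_sum p A ?y k \<in> Fil k"
        using V_sum_limit[of ?y n] yz by blast
      obtain Z where Z: "Z \<in> S \<inter> grade A (n - 1)" "\<And>k. Z \<ominus> V_sum p A ?z k \<in> Fil k"
        using V_sum_limit[of ?z "n - 1"] yz by blast
      have c: "Y \<in> carrier A" "Z \<in> carrier A" using Y Z mem_carrier by auto
      have sc: "V_sum p A ?y k \<in> carrier A" "V_sum p A ?z k \<in> carrier A" for k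
        using yzc V_pow_simps(1) by (induction k) auto
      have eq: "X (r + k) \<ominus> X r = (V ^^ r) (V_sum p A ?y k) \<oplus> differential A ((V ^^ r) (V_sum p A ?z k))" for k
      proof (induction k)
        case 0
        show ?case using X' by (simp add: V_pow_simps d_simps minus_eq r_neg)
      next
        case (Suc k)
        have "X (r + Suc k) \<ominus> X r = (X (Suc (r + k)) \<ominus> X (r + k)) \<oplus> (X (r + k) \<ominus> X r)"
          using X' by (simp add: minus_telescope)
        also have "\<dots> = ((V ^^ r) ((V ^^ k) (y (r + k))) \<oplus> differential A ((V ^^ r) ((V ^^ k) (z (r + k))))) \<oplus>
          ((V ^^ r) (V_sum p A ?y k) \<oplus> differential A ((V ^^ r) (V_sum p A ?z k)))"
          unfolding Suc yz(3) by (simp add: funpow_add)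
        also have "\<dots> = (V ^^ r) (V_sum p A ?y (Suc k)) \<oplus> differential A ((V ^^ r) (V_sum p A ?z (Suc k)))"
          using yzc sc by (simp add: V_pow_simps d_simps a_ac)
        finally show ?case .
      qed
      have VFil: "(V ^^ r) w \<in> Fil k" if "w \<in> Fil k" for w k
        using that by (induction r) (auto simp: Fil_V_closed)
      \<comment> \<open>Both sides are compared with X (r+k) - X r modulo Fil k for every k. Since V
        and d preserve Fil k, Y and Z may be replaced by their partial sums.\<close>
      have "x \<ominus> X r = (V ^^ r) Y \<oplus> differential A ((V ^^ r) Z)"
      proof (rule Fil_separated_eq)
        show "x \<ominus> X r \<in> grade A n" using x X' by (intro minus_grade)
        show "(V ^^ r) Y \<oplus> differential A ((V ^^ r) Z) \<in> grade A n"
          using Y Z V_pow_grade[of Y n r] differential_grade[OF V_pow_grade[of Z "n - 1" r]]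
          by (intro add_grade) auto
        fix k
        let ?w = "X (r + k) \<ominus> X r"
        have 1: "(x \<ominus> X r) \<ominus> ?w \<in> Fil k"
        proof -
          have "(x \<ominus> X r) \<ominus> ?w = x \<ominus> X (r + k)"
            using minus_telescope[of x "X (r + k)" "X r"] add_minus_cancel(3)[of "x \<ominus> X (r + k)" ?w] xc X' by simp
          thus ?thesis using x(2)[of "r + k"] Fil_mono[of k "r + k"] by auto
        qed
        have "((V ^^ r) Y \<oplus> differential A ((V ^^ r) Z)) \<ominus> ?w =
          (V ^^ r) (Y \<ominus> V_sum p A ?y k) \<oplus> differential A ((V ^^ r) (Z \<ominus> V_sum p A ?z k))"
          unfolding eq using c sc by (simp add: V_pow_simps d_simps minus_add_minus)
        also have "\<dots> \<in> Fil k" by (intro Fil_add VFil Y Z Fil_d)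
        finally have 2: "((V ^^ r) Y \<oplus> differential A ((V ^^ r) Z)) \<ominus> ?w \<in> Fil k" .
        have c3: "x \<ominus> X r \<in> carrier A" "?w \<in> carrier A" "(V ^^ r) Y \<oplus> differential A ((V ^^ r) Z) \<in> carrier A"
          using xc X' c by (simp_all add: V_pow_simps d_simps)
        show "(x \<ominus> X r) \<ominus> ((V ^^ r) Y \<oplus> differential A ((V ^^ r) Z)) \<in> Fil k"
          by (rule Fil_minus_trans[OF c3(1,2,3) 1 Fil_minus_swap[OF c3(3,2) 2]])
      qed
      thus ?thesis unfolding B.Fil_iff using Y Z
        by (intro bexI[of _ Y] bexI[of _ Z]) (auto simp: restrict_simps restrict_V_pow)
    qed
    thus "\<exists>x\<in>grade B n. \<forall>r. x \<ominus>\<^bsub>B\<^esub> X r \<in> B.Fil r"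
      using x(1) xS X' by (intro bexI[of _ x]) (auto simp: restrict_simps restrict_minus)
  qed
qed

lemma restrict_algebra: "strict_dieudonne_algebra p B"
proof -
  interpret B: ring B by (rule restrict_ring)
  interpret BC: strict_dieudonne_complex p B by (rule restrict_strict)
  show ?thesis
  proof (unfold_locales; unfold restrict_simps restrict_nat_mult restrict_nat_pow)
    show "x \<otimes> y = (if even (m * n) then y \<otimes> x else \<ominus>\<^bsub>B\<^esub> (y \<otimes> x))"
      if "x \<in> grade A m \<inter> S" "y \<in> grade A n \<inter> S" for x m y n
      using that graded_comm[of x m y n] mult_mem[of y x] restrict_a_inv[of "y \<otimes> x"] by auto
    show "differential A (x \<otimes> y) = differential A x \<otimes> y \<oplus> (if even m then x \<otimes> differential A y else \<ominus>\<^bsub>B\<^esub> (x \<otimes> differential A y))"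
      if "x \<in> grade A m \<inter> S" "y \<in> grade A n \<inter> S" for x m y n
      using that Leibniz[of x m y n] mult_mem[of x "differential A y"] d_mem[of y] restrict_a_inv[of "x \<otimes> differential A y"] by auto
    show "Frob A \<in> ring_hom B B"
      by (rule ring_hom_memI) (auto simp: restrict_simps F_mem F_mult F_one F_simps mem_carrier)
    show "\<exists>y\<in>grade A 0 \<inter> S. Frob A x = x [^] p \<oplus> [p] \<cdot> y" if "x \<in> grade A 0 \<inter> S" for x
      using lift_mem[of x] that by blast
  qed (use one_grade one_mem mult_grade mult_mem odd_square negative_grade zero_mem in auto)
qed

end

section \<open>Teichmueller representatives\<close>

context cring
begin

text \<open>The linear term of the expansion gains a factor p from the exponent, and the quadratic
  one is divisible by p^(2k+2) = p^(k+2) p^k. A modulus p^(k+1) with at least one factor p is what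
  makes this work.\<close>

lemma pow_p_congruence_step:
  assumes T: "subring T R" and b: "b \<in> T" and u: "u \<in> T" and p: "p > 0"
  shows "\<exists>w\<in>T. (b \<oplus> [(p ^ Suc k)] \<cdot> u) [^] (p::nat) = b [^] p \<oplus> [(p ^ Suc (Suc k))] \<cdot> w"
proof -
  obtain n where n: "p = Suc n" using p by (metis Suc_pred)
  have C: "z \<in> T \<Longrightarrow> z \<in> carrier R" for z using subringE(1)[OF T] by blast
  let ?q = "p ^ Suc k"
  let ?h = "[?q] \<cdot> u"
  have h: "?h \<in> T" using T u by (rule subring_nat_mult)
  obtain c where c: "c \<in> T"
    "(b \<oplus> ?h) [^] Suc n = (b [^] Suc n \<oplus> [Suc n] \<cdot> (b [^] n \<otimes> ?h)) \<oplus> (?h \<otimes> ?h) \<otimes> c"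
    using nat_pow_add_expansion[OF T b h] by blast
  have cr: "b [^] n \<in> carrier R" "u \<in> carrier R" "c \<in> carrier R" using C b u c by auto
  have "[Suc n] \<cdot> (b [^] n \<otimes> ?h) = [(p ^ Suc (Suc k))] \<cdot> (b [^] n \<otimes> u)"
    using cr by (simp add: add_pow_rdistr nat_mult_simps n mult_ac del: add.nat_pow_Suc)
  moreover have "(?h \<otimes> ?h) \<otimes> c = [(p ^ Suc (Suc k))] \<cdot> ([(p ^ k)] \<cdot> (u \<otimes> u \<otimes> c))"
    using cr by (simp add: add_pow_rdistr add_pow_ldistr nat_mult_simps mult_ac power_add del: add.nat_pow_Suc)
  ultimately have "(b \<oplus> ?h) [^] p = b [^] p \<oplus> [(p ^ Suc (Suc k))] \<cdot> (b [^] n \<otimes> u \<oplus> [(p ^ k)] \<cdot> (u \<otimes> u \<otimes> c))"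
    using c(2) C b cr unfolding n[symmetric] by (simp add: nat_mult_simps a_assoc)
  moreover have "b [^] n \<otimes> u \<oplus> [(p ^ k)] \<cdot> (u \<otimes> u \<otimes> c) \<in> T"
    using T b u c(1) by (intro subringE(6,7)[OF T] subring_nat_mult subring_nat_pow)
  ultimately show ?thesis by blast
qed

lemma pow_p_congruence:
  assumes T: "subring T R" and b: "b \<in> T" and u: "u \<in> T" and p: "p > 0"
  shows "\<exists>w\<in>T. (b \<oplus> [p] \<cdot> u) [^] ((p::nat) ^ j) = b [^] (p ^ j) \<oplus> [(p ^ Suc j)] \<cdot> w"
proof (induction j)
  have C: "z \<in> T \<Longrightarrow> z \<in> carrier R" for z using subringE(1)[OF T] by blast
  {
    case 0
    show ?case using u C b by (intro bexI[of _ u]) auto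
  next
    case (Suc j)
    then obtain w where w: "w \<in> T" "(b \<oplus> [p] \<cdot> u) [^] (p ^ j) = b [^] (p ^ j) \<oplus> [(p ^ Suc j)] \<cdot> w" by blast
    obtain w' where w': "w' \<in> T" "(b [^] (p ^ j) \<oplus> [(p ^ Suc j)] \<cdot> w) [^] p = (b [^] (p ^ j)) [^] p \<oplus> [(p ^ Suc (Suc j))] \<cdot> w'"
      using pow_p_congruence_step[OF T subring_nat_pow[OF T b] w(1) p] by blast
    have e: "z [^] (p ^ Suc j) = (z [^] (p ^ j)) [^] p" if "z \<in> carrier R" for z
      using that by (simp add: nat_pow_pow mult.commute)
    have "b \<oplus> [p] \<cdot> u \<in> carrier R" "b \<in> carrier R" using C b u by auto
    thus ?case using e w(2) w' by auto
  }
qed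

end

section \<open>Solutions of Ft = t^p in degree 0\<close>

context strict_dieudonne_algebra
begin

lemma degree_zero_nat_mult: "[(k::nat)] \<cdot>\<^bsub>degree_zero A\<^esub> x = [k] \<cdot> x"
  by (simp add: add_pow_def nat_pow_def degree_zero_simps)

lemmas degree_zero_transfer = degree_zero_simps degree_zero_nat_pow degree_zero_nat_mult

lemmas grade_zero_pow_p_congruence =
  cring.pow_p_congruence[OF degree_zero_cring, unfolded degree_zero_transfer]
lemmas grade_zero_pow_p_congruence_step =
  cring.pow_p_congruence_step[OF degree_zero_cring, unfolded degree_zero_transfer]
lemmas grade_zero_prime_pow_add =
  cring.prime_pow_add[OF degree_zero_cring, unfolded degree_zero_transfer]
lemmas grade_zero_pow_add_expansion =
  cring.nat_pow_add_expansion[OF degree_zero_cring, unfolded degree_zero_transfer]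

lemma grade_zero_subring: "subring (grade A 0) (degree_zero A)"
  using ring.carrier_is_subring[OF cring.axioms(1)[OF degree_zero_cring]] by (simp add: degree_zero_simps)

lemma F_pow_nat_pow: "x \<in> carrier A \<Longrightarrow> (Frob A ^^ k) (x [^] (n::nat)) = (Frob A ^^ k) x [^] n"
  by (induction k) (simp_all add: F_nat_pow F_pow_simps)

lemma F_pow_eq_pow:
  assumes "x \<in> carrier A" "Frob A x = x [^] p"
  shows "(Frob A ^^ k) x = x [^] (p ^ k)"
proof (induction k)
  case (Suc k)
  have "(Frob A ^^ Suc k) x = Frob A x [^] (p ^ k)" using Suc F_nat_pow[OF assms(1)] by simp
  thus ?case using assms by (simp add: nat_pow_pow)
qed (use assms in simp)

lemma V_sum_grade:
  assumes "\<And>k. u k \<in> grade A n"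
  shows "V_sum p A u k \<in> grade A n"
  using assms by (induction k) (auto simp: add_grade V_pow_grade)

text \<open>The fixed point is the limit of \<open>F\<^sup>-\<^sup>k(x\<^bsup>p^k\<^esup>)\<close>; relativizing the statement to a subring \<open>T\<close> shows
  later that the correction terms of \<open>[r + s] - [r] - [s]\<close> stay in a given subalgebra.\<close>

lemma Teichmueller_exists:
  assumes p: "p > 0" and T: "subring T (degree_zero A)"
    and limit: "\<And>u. (\<And>k. u k \<in> T) \<Longrightarrow> \<exists>y\<in>T. \<forall>k. y \<ominus> V_sum p A u k \<in> Fil k"
    and x: "x \<in> T" and Fx: "Frob A x \<in> T" and \<delta>: "\<delta> \<in> T" "Frob A x = x [^] p \<oplus> [p] \<cdot> \<delta>"
  shows "\<exists>y\<in>T. Frob A (x \<oplus> V y) = (x \<oplus> V y) [^] p"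
proof -
  interpret Z: cring "degree_zero A" by (rule degree_zero_cring)
  have G: "z \<in> T \<Longrightarrow> z \<in> grade A 0" for z using subringE(1)[OF T] by (auto simp: degree_zero_simps)
  have C: "z \<in> T \<Longrightarrow> z \<in> carrier A" for z using G grade_carrier by blast
  have nT: "\<ominus> z \<in> T" if "z \<in> T" for z
    using subringE(5)[OF T that] G that by (simp add: degree_zero_a_inv)
  have xp: "x [^] p = Frob A x \<oplus> [p] \<cdot> (\<ominus> \<delta>)"
    using \<delta> C[OF \<delta>(1)] C[OF x] by (simp add: nat_mult_simps a_assoc r_neg)
  \<comment> \<open>As x^p = Fx - p\<open>\<delta>\<close>, raising to the power p^k gives a
    congruence modulo p^(k+1); \<open>q k\<close> is the quotient.\<close>
  have "\<exists>q\<in>T. (x [^] p) [^] (p ^ k) = Frob A x [^] (p ^ k) \<oplus> [(p ^ Suc k)] \<cdot> q" for k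
    unfolding xp by (rule grade_zero_pow_p_congruence[OF T Fx nT[OF \<delta>(1)] p])
  then obtain q where q: "\<And>k. q k \<in> T"
    "\<And>k. (x [^] p) [^] (p ^ k) = Frob A x [^] (p ^ k) \<oplus> [(p ^ Suc k)] \<cdot> q k" by metis
  have qG: "q k \<in> grade A 0" for k using q G by blast
  have qC: "q k \<in> carrier A" for k using q C by blast
  obtain y where y: "y \<in> T" "\<And>k. y \<ominus> V_sum p A q k \<in> Fil k" using limit[of q] q(1) by blast
  have sG: "V_sum p A q k \<in> grade A 0" for k by (rule V_sum_grade) (rule qG)
  have sC: "V_sum p A q k \<in> carrier A" for k using sG grade_carrier by blast
  have xC: "x \<in> carrier A" and yC: "y \<in> carrier A" using x y C by auto
  \<comment> \<open>x plus the sum of the V^(j+1)(q j) over j < k. The next term V^(k+1)(q k) is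
    chosen so that F^(k+1) turns it into p^(k+1) q k, the discrepancy between F(x^(p^k)) and
    x^(p^(k+1)).\<close>
  let ?z = "\<lambda>k. x \<oplus> V (V_sum p A q k)"
  have z: "(Frob A ^^ k) (?z k) = x [^] (p ^ k)" for k
  proof (induction k)
    case 0
    show ?case using xC by (simp add: V_simps)
  next
    case (Suc k)
    have "?z (Suc k) = ?z k \<oplus> (V ^^ Suc k) (q k)"
      using xC sC qC by (simp add: V_simps V_pow_simps a_assoc)
    hence "(Frob A ^^ Suc k) (?z (Suc k)) = Frob A ((Frob A ^^ k) (?z k)) \<oplus> (Frob A ^^ Suc k) ((V ^^ Suc k) (q k))"
      using xC sC qC V_simps(1) V_pow_simps(1)[of "q k" "Suc k"] F_pow_simps(2)[of _ _ "Suc k"] by simp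
    also have "\<dots> = Frob A (x [^] (p ^ k)) \<oplus> [(p ^ Suc k)] \<cdot> q k"
      unfolding Suc using F_pow_V_pow[OF qC, of "Suc k" k] by simp
    also have "\<dots> = (x [^] p) [^] (p ^ k)" unfolding q(2) using F_nat_pow[OF xC] by simp
    also have "\<dots> = x [^] (p ^ Suc k)" using xC by (simp add: nat_pow_pow)
    finally show ?case .
  qed
  let ?t = "x \<oplus> V y"
  have tC: "?t \<in> carrier A" using xC yC by (simp add: V_simps)
  have tG: "?t \<in> grade A 0" using x y G V_grade by (intro add_grade) auto
  \<comment> \<open>The limit differs from the k-th approximation by V^k(Vw), which F^k turns into
    p^k Vw.\<close>
  have Ft: "\<exists>w\<in>grade A 0. (Frob A ^^ k) ?t = x [^] (p ^ k) \<oplus> [(p ^ k)] \<cdot> w" for k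
  proof -
    obtain w where w: "w \<in> grade A 0" "y \<ominus> V_sum p A q k = (V ^^ k) w"
      using Fil_grade_zero[OF y(2)] minus_grade[OF G[OF y(1)] sG] by blast
    have wC: "w \<in> carrier A" using w grade_carrier by blast
    have "y = V_sum p A q k \<oplus> (V ^^ k) w" unfolding w(2)[symmetric] using yC sC add_minus_cancel(1) by simp
    hence "?t = ?z k \<oplus> (V ^^ k) (V w)"
      using xC sC wC by (simp add: V_simps V_pow_simps a_assoc funpow_swap1)
    hence "(Frob A ^^ k) ?t = x [^] (p ^ k) \<oplus> [(p ^ k)] \<cdot> V w"
      using xC sC wC z[of k] by (simp add: V_simps V_pow_simps F_pow_simps F_pow_V_pow del: V_sum.simps)
    thus ?thesis using V_grade[OF w(1)] by blast
  qed
  have "Frob A ?t = ?t [^] p"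
  proof (rule Fil_separated_eq)
    show "Frob A ?t \<in> grade A 0" "?t [^] p \<in> grade A 0" using tG Frob_grade nat_pow_grade by auto
    \<comment> \<open>Under F^(r+1), both Ft and t^p become x^(p^(r+2)) modulo p^(r+2). The index is
      r + 1 instead of r because the congruence for p-th powers starts from a modulus divisible by
      p.\<close>
    have *: "Frob A ?t \<ominus> ?t [^] p \<in> Fil (Suc r)" for r
    proof -
      let ?r = "Suc r"
      obtain w1 where w1: "w1 \<in> grade A 0" "(Frob A ^^ Suc ?r) ?t = x [^] (p ^ Suc ?r) \<oplus> [(p ^ Suc ?r)] \<cdot> w1"
        using Ft by blast
      obtain w2 where w2: "w2 \<in> grade A 0" "(Frob A ^^ ?r) ?t = x [^] (p ^ ?r) \<oplus> [(p ^ ?r)] \<cdot> w2"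
        using Ft by blast
      obtain w3 where w3: "w3 \<in> grade A 0"
          "(x [^] (p ^ ?r) \<oplus> [(p ^ ?r)] \<cdot> w2) [^] p = (x [^] (p ^ ?r)) [^] p \<oplus> [(p ^ Suc ?r)] \<cdot> w3"
        using grade_zero_pow_p_congruence_step[OF grade_zero_subring nat_pow_grade[OF G[OF x]] w2(1) p] by blast
      have wC: "w1 \<in> carrier A" "w3 \<in> carrier A" using w1 w3 grade_carrier by auto
      have "(Frob A ^^ ?r) (Frob A ?t \<ominus> ?t [^] p) = (Frob A ^^ Suc ?r) ?t \<ominus> ((Frob A ^^ ?r) ?t) [^] p"
        using tC F_pow_simps(5)[of "Frob A ?t" "?t [^] p" ?r] F_simps(1)[OF tC] F_pow_nat_pow[OF tC, of ?r p]
        by (simp add: funpow_swap1)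
      also have "\<dots> = (x [^] (p ^ Suc ?r) \<oplus> [(p ^ Suc ?r)] \<cdot> w1) \<ominus> (x [^] (p ^ Suc ?r) \<oplus> [(p ^ Suc ?r)] \<cdot> w3)"
        unfolding w1(2) w2(2) w3(2) using xC by (simp add: nat_pow_pow mult.commute)
      also have "\<dots> = [(p ^ Suc ?r)] \<cdot> (w1 \<ominus> w3)"
        using xC wC by (subst minus_add_minus) (simp_all add: nat_mult_simps minus_eq r_neg)
      also have "\<dots> = (Frob A ^^ ?r) ((V ^^ ?r) ([p] \<cdot> (w1 \<ominus> w3)))"
        using F_pow_V_pow[of "[p] \<cdot> (w1 \<ominus> w3)" ?r] wC by (simp add: nat_mult_simps(2) nat_mult_simps(6) mult.commute mult.left_commute)
      finally have "Frob A ?t \<ominus> ?t [^] p = (V ^^ ?r) ([p] \<cdot> (w1 \<ominus> w3))"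
        by (rule F_pow_inj[rotated 2]) (use tC wC F_simps(1)[OF tC] V_pow_simps(1)[of "[p] \<cdot> (w1 \<ominus> w3)" ?r] in simp_all)
      thus ?thesis using Fil_V[of "[p] \<cdot> (w1 \<ominus> w3)" ?r] wC by simp
    qed
    show "Frob A ?t \<ominus> ?t [^] p \<in> Fil r" for r
      using *[of r] by (rule Fil_Suc)
  qed
  thus ?thesis using y(1) by blast
qed

text \<open>With t = s + Vu, applying F gives t^p = s^p + pu. Raised to the power p^r this becomes a
  congruence modulo p^(r+1). As (t^p)^(p^r) is F^(r+1) t, and likewise for s, the difference t - s
  lies in the image of V^(r+1) for every r.\<close>

lemma Teichmueller_unique:
  assumes p: "p > 0" and t: "t \<in> grade A 0" "Frob A t = t [^] p" and s: "s \<in> grade A 0" "Frob A s = s [^] p"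
    and ts: "t \<ominus> s \<in> V ` grade A 0"
  shows "t = s"
proof (rule Fil_separated_eq[OF t(1) s(1)])
  obtain u where u: "u \<in> grade A 0" "t \<ominus> s = V u" using ts by blast
  have C: "t \<in> carrier A" "s \<in> carrier A" "u \<in> carrier A" using t s u grade_carrier by auto
  have ts': "t = s \<oplus> V u" unfolding u(2)[symmetric] using C add_minus_cancel(1) by simp
  have "Frob A t = Frob A s \<oplus> [p] \<cdot> u" unfolding ts' using C by (simp add: V_simps F_simps F_V)
  hence tp: "t [^] p = s [^] p \<oplus> [p] \<cdot> u" unfolding t(2) s(2) .
  have *: "t \<ominus> s \<in> Fil (Suc r)" for r
  proof -
    obtain w where w: "w \<in> grade A 0" "(t [^] p) [^] (p ^ r) = (s [^] p) [^] (p ^ r) \<oplus> [(p ^ Suc r)] \<cdot> w"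
      unfolding tp using grade_zero_pow_p_congruence[OF grade_zero_subring nat_pow_grade[OF s(1)] u(1) p] by blast
    have wC: "w \<in> carrier A" using w grade_carrier by blast
    have F: "(Frob A ^^ Suc r) z = (z [^] p) [^] (p ^ r)" if "z \<in> carrier A" "Frob A z = z [^] p" for z
      using F_pow_eq_pow[OF that, of "Suc r"] that by (simp add: nat_pow_pow)
    have e: "(Frob A ^^ Suc r) t = (Frob A ^^ Suc r) s \<oplus> [(p ^ Suc r)] \<cdot> w"
      using w(2) F[OF C(1) t(2)] F[OF C(2) s(2)] by simp
    have "(Frob A ^^ Suc r) (t \<ominus> s) = (Frob A ^^ Suc r) t \<ominus> (Frob A ^^ Suc r) s"
      by (rule F_pow_simps(5)[OF C(1,2)])
    also have "\<dots> = [(p ^ Suc r)] \<cdot> w"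
      unfolding e using F_pow_simps(1)[OF C(2), of "Suc r"] wC
      by (subst a_comm) (simp_all add: add_minus_cancel(3))
    also have "\<dots> = (Frob A ^^ Suc r) ((V ^^ Suc r) w)" by (rule F_pow_V_pow[OF wC, symmetric])
    finally have "t \<ominus> s = (V ^^ Suc r) w"
      by (rule F_pow_inj[rotated 2]) (use C V_pow_simps(1)[OF wC] V_carrier in simp_all)
    thus ?thesis using Fil_V[OF wC, of "Suc r"] by simp
  qed
  show "t \<ominus> s \<in> Fil r" for r using *[of r] by (rule Fil_Suc)
qed

end

section \<open>The multiplicative lift from R to W^0\<close>

locale dieudonne_algebra_over = strict_dieudonne_algebra p A + R: cring R
  for p :: nat and A :: "('a, 'm) dieudonne_scheme" (structure) and R :: "('r, 'k) ring_scheme" (structure) +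
  fixes \<iota> :: "'r \<Rightarrow> 'a set"
  assumes prime: "Factorial_Ring.prime p" and \<iota>_hom: "\<iota> \<in> ring_hom R (mod_V p A)"
begin

definition Teichmueller :: "'r \<Rightarrow> 'a" ("\<tau>") where
  "\<tau> r = (THE t. t \<in> \<iota> r \<and> Frob A t = t [^] p)"

lemma p_pos: "p > 0"
  using prime prime_gt_0_nat by blast

abbreviation VA where "VA \<equiv> V ` grade A 0"

lemma \<iota>_coset: 
  assumes "r \<in> carrier R"
  obtains x where "x \<in> grade A 0" "\<iota> r = VA +>\<^bsub>degree_zero A\<^esub> x"
  using ring_hom_closed[OF \<iota>_hom assms] unfolding mod_V_carrier by blast

lemma \<iota>_grade: "r \<in> carrier R \<Longrightarrow> t \<in> \<iota> r \<Longrightarrow> t \<in> grade A 0"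
  by (metis \<iota>_coset mod_V_coset_mem)

lemma \<iota>_eq_coset: 
  assumes "r \<in> carrier R" "t \<in> \<iota> r"
  shows "\<iota> r = VA +>\<^bsub>degree_zero A\<^esub> t"
proof -
  obtain x where x: "x \<in> grade A 0" "\<iota> r = VA +>\<^bsub>degree_zero A\<^esub> x" using assms \<iota>_coset by blast
  have t: "t \<in> grade A 0" "t \<ominus> x \<in> VA" using assms(2) mod_V_coset_mem[OF x(1)] unfolding x(2) by auto
  show ?thesis unfolding x(2) using mod_V_coset_eq[OF t(1) x(1)] t(2) by simp
qed

lemma \<iota>_minus:
  assumes "r \<in> carrier R" "t \<in> \<iota> r" "s \<in> \<iota> r"
  shows "t \<ominus> s \<in> VA"
  using \<iota>_eq_coset[OF assms(1,3)] assms mod_V_coset_mem[OF \<iota>_grade[OF assms(1,3)]] by simp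

lemma Teichmueller_unique':
  assumes "r \<in> carrier R" "t \<in> \<iota> r" "Frob A t = t [^] p" "s \<in> \<iota> r" "Frob A s = s [^] p"
  shows "t = s"
  by (rule Teichmueller_unique[OF p_pos]) (use assms \<iota>_grade \<iota>_minus in auto)

lemma grade_zero_limit: "(\<And>k. u k \<in> grade A 0) \<Longrightarrow> \<exists>y\<in>grade A 0. \<forall>k. y \<ominus> V_sum p A u k \<in> Fil k"
proof -
  assume u: "\<And>k. u k \<in> grade A 0"
  have s: "V_sum p A u k \<in> grade A 0" for k by (rule V_sum_grade) (rule u)
  have "V_sum p A u (Suc k) \<ominus> V_sum p A u k \<in> Fil k" for k
  proof -
    have "V_sum p A u (Suc k) \<ominus> V_sum p A u k = (V ^^ k) (u k)"
      using grade_carrier[OF s[of k]] grade_carrier[OF u[of k]] V_pow_simps(1)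
      by (simp add: a_comm[of "V_sum p A u k"] add_minus_cancel)
    thus ?thesis using Fil_V grade_carrier[OF u] by simp
  qed
  thus ?thesis using Fil_complete[of "V_sum p A u" 0] s by blast
qed

lemma Teichmueller_ex1:
  assumes r: "r \<in> carrier R"
  shows "\<exists>!t. t \<in> \<iota> r \<and> Frob A t = t [^] p"
proof -
  obtain x where x: "x \<in> grade A 0" "\<iota> r = VA +>\<^bsub>degree_zero A\<^esub> x" using r \<iota>_coset by blast
  obtain \<delta> where \<delta>: "\<delta> \<in> grade A 0" "Frob A x = x [^] p \<oplus> [p] \<cdot> \<delta>" using Frob_lift[OF x(1)] by blast
  obtain y where y: "y \<in> grade A 0" "Frob A (x \<oplus> V y) = (x \<oplus> V y) [^] p"
    using Teichmueller_exists[OF p_pos grade_zero_subring grade_zero_limit x(1) Frob_grade[OF x(1)] \<delta>] by blast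
  have "(x \<oplus> V y) \<ominus> x = V y"
    using grade_carrier[OF x(1)] grade_carrier[OF y(1)] V_simps(1) by (simp add: a_comm[of x] add_minus_cancel)
  hence "x \<oplus> V y \<in> \<iota> r"
    unfolding x(2) mod_V_coset_mem[OF x(1)] using x y V_grade add_grade by auto
  thus ?thesis using y(2) Teichmueller_unique'[OF r] by blast
qed

lemma Teichmueller_mem: "r \<in> carrier R \<Longrightarrow> \<tau> r \<in> \<iota> r"
  and F_Teichmueller: "r \<in> carrier R \<Longrightarrow> Frob A (\<tau> r) = \<tau> r [^] p"
  using theI'[OF Teichmueller_ex1] unfolding Teichmueller_def by blast+

lemma Teichmueller_eqI: "r \<in> carrier R \<Longrightarrow> t \<in> \<iota> r \<Longrightarrow> Frob A t = t [^] p \<Longrightarrow> \<tau> r = t"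
  using Teichmueller_unique' Teichmueller_mem F_Teichmueller by blast

lemma Teichmueller_grade: "r \<in> carrier R \<Longrightarrow> \<tau> r \<in> grade A 0"
  using Teichmueller_mem \<iota>_grade by blast

lemma Teichmueller_carrier: "r \<in> carrier R \<Longrightarrow> \<tau> r \<in> carrier A"
  using Teichmueller_grade grade_carrier by blast

lemma \<iota>_Teichmueller: "r \<in> carrier R \<Longrightarrow> \<iota> r = VA +>\<^bsub>degree_zero A\<^esub> \<tau> r"
  using \<iota>_eq_coset Teichmueller_mem by blast

lemma coset_self: "x \<in> grade A 0 \<Longrightarrow> x \<in> VA +>\<^bsub>degree_zero A\<^esub> x"
  unfolding mod_V_coset_mem using grade_carrier[of x 0] V_simps(3) zero_grade[of 0]
  by (auto simp: minus_eq r_neg intro!: image_eqI[of _ _ "\<zero>"])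

text \<open>The product again satisfies Ft = t^p, since elements of degree 0 commute, so uniqueness
  within its coset applies.\<close>

lemma Teichmueller_mult:
  assumes r: "r \<in> carrier R" and s: "s \<in> carrier R"
  shows "\<tau> (r \<otimes>\<^bsub>R\<^esub> s) = \<tau> r \<otimes> \<tau> s"
proof (rule Teichmueller_eqI)
  note g = Teichmueller_grade[OF r] Teichmueller_grade[OF s]
  note c = grade_carrier[OF g(1)] grade_carrier[OF g(2)]
  have "\<iota> (r \<otimes>\<^bsub>R\<^esub> s) = \<iota> r \<otimes>\<^bsub>mod_V p A\<^esub> \<iota> s" by (rule ring_hom_mult[OF \<iota>_hom r s])
  also have "\<dots> = VA +>\<^bsub>degree_zero A\<^esub> (\<tau> r \<otimes> \<tau> s)"
    using ring_hom_mult[OF mod_V_ring_hom] g by (simp add: \<iota>_Teichmueller r s degree_zero_simps)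
  finally show "\<tau> r \<otimes> \<tau> s \<in> \<iota> (r \<otimes>\<^bsub>R\<^esub> s)" using coset_self mult_grade[OF g] by simp
  have "monoid A" ..
  show "Frob A (\<tau> r \<otimes> \<tau> s) = (\<tau> r \<otimes> \<tau> s) [^] p"
    using pow_mult_distrib[OF grade_zero_comm[OF g(1) c(2)] c] F_mult[OF c] r s F_Teichmueller by simp
qed (use r s in simp)

lemma Teichmueller_one: "\<tau> \<one>\<^bsub>R\<^esub> = \<one>"
proof (rule Teichmueller_eqI)
  have "\<iota> \<one>\<^bsub>R\<^esub> = VA +>\<^bsub>degree_zero A\<^esub> \<one>"
    using ring_hom_one[OF \<iota>_hom] ring_hom_one[OF mod_V_ring_hom] by (simp add: degree_zero_simps)
  thus "\<one> \<in> \<iota> \<one>\<^bsub>R\<^esub>" using coset_self one_grade by simp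
qed (simp_all add: F_one)

lemma Teichmueller_zero: "\<tau> \<zero>\<^bsub>R\<^esub> = \<zero>"
proof (rule Teichmueller_eqI)
  interpret Z: ring "degree_zero A" using degree_zero_cring cring_def by blast
  have "\<iota> \<zero>\<^bsub>R\<^esub> = \<zero>\<^bsub>mod_V p A\<^esub>" by (rule ring_hom_zero[OF \<iota>_hom R.ring_axioms mod_V_ring])
  also have "\<dots> = VA +>\<^bsub>degree_zero A\<^esub> \<zero>"
    using ring_hom_zero[OF mod_V_ring_hom Z.ring_axioms mod_V_ring] by (simp add: degree_zero_simps)
  finally show "\<zero> \<in> \<iota> \<zero>\<^bsub>R\<^esub>" using coset_self zero_grade by simp
  show "Frob A \<zero> = \<zero> [^] p" using p_pos by (simp add: F_simps nat_pow_zero)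
qed simp

lemma Teichmueller_pow: "r \<in> carrier R \<Longrightarrow> \<tau> (r [^]\<^bsub>R\<^esub> (k::nat)) = \<tau> r [^] k"
  by (induction k) (simp_all add: Teichmueller_one Teichmueller_mult)

text \<open>Additivity fails by a term Vy. Confining y to T = S \<inter> A^0 later yields a ring
  homomorphism from R to S^0/VS^0; with T = A^0 one gets additivity modulo Fil^1.\<close>

lemma Teichmueller_add:
  assumes r: "r \<in> carrier R" and s: "s \<in> carrier R"
    and T: "subring T (degree_zero A)" "\<tau> r \<in> T" "\<tau> s \<in> T"
    and limit: "\<And>u. (\<And>k. u k \<in> T) \<Longrightarrow> \<exists>y\<in>T. \<forall>k. y \<ominus> V_sum p A u k \<in> Fil k"
  shows "\<exists>y\<in>T. \<tau> (r \<oplus>\<^bsub>R\<^esub> s) = (\<tau> r \<oplus> \<tau> s) \<oplus> V y"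
proof -
  interpret Z: cring "degree_zero A" by (rule degree_zero_cring)
  note g = Teichmueller_grade[OF r] Teichmueller_grade[OF s]
  note c = grade_carrier[OF g(1)] grade_carrier[OF g(2)]
  have TG: "z \<in> T \<Longrightarrow> z \<in> grade A 0" for z using subringE(1)[OF T(1)] by (auto simp: degree_zero_simps)
  have addT: "z \<oplus> w \<in> T" if "z \<in> T" "w \<in> T" for z w
    using subringE(7)[OF T(1) that] by (simp add: degree_zero_simps)
  have negT: "\<ominus> z \<in> T" if "z \<in> T" for z
    using subringE(5)[OF T(1) that] TG[OF that] by (simp add: degree_zero_a_inv)
  have powT: "z [^] (k::nat) \<in> T" if "z \<in> T" for z k
    using Z.subring_nat_pow[OF T(1) that] by (simp add: degree_zero_nat_pow)
  let ?x = "\<tau> r \<oplus> \<tau> s"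
  have Fx: "Frob A ?x = \<tau> r [^] p \<oplus> \<tau> s [^] p"
    using c r s by (simp add: F_simps F_Teichmueller)
  obtain P where P: "P \<in> T" "?x [^] p = (\<tau> r [^] p \<oplus> \<tau> s [^] p) \<oplus> [p] \<cdot> P"
    using grade_zero_prime_pow_add[OF prime T(1-3)] by blast
  have Pc: "P \<in> carrier A" using TG[OF P(1)] grade_carrier by blast
  have FxT: "Frob A ?x \<in> T" unfolding Fx by (intro addT powT T)
  \<comment> \<open>P is the sum of the mixed binomial terms divided by p, so the Frobenius lift of
    x = [r] + [s] has \<open>\<delta>\<close> = -P, which stays in T.\<close>
  have Fx': "Frob A ?x = ?x [^] p \<oplus> [p] \<cdot> (\<ominus> P)"
    unfolding Fx P(2) using c Pc by (simp add: nat_mult_simps a_assoc r_neg)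
  then obtain y where y: "y \<in> T" "Frob A (?x \<oplus> V y) = (?x \<oplus> V y) [^] p"
    using Teichmueller_exists[OF p_pos T(1) limit addT[OF T(2,3)] FxT negT[OF P(1)] Fx'] by blast
  have yG: "y \<in> grade A 0" using TG y by blast
  have "\<tau> (r \<oplus>\<^bsub>R\<^esub> s) = ?x \<oplus> V y"
  proof (rule Teichmueller_eqI[OF _ _ y(2)])
    have "\<iota> (r \<oplus>\<^bsub>R\<^esub> s) = \<iota> r \<oplus>\<^bsub>mod_V p A\<^esub> \<iota> s" by (rule ring_hom_add[OF \<iota>_hom r s])
    also have "\<dots> = VA +>\<^bsub>degree_zero A\<^esub> ?x"
      using ring_hom_add[OF mod_V_ring_hom] g by (simp add: \<iota>_Teichmueller r s degree_zero_simps)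
    finally have "\<iota> (r \<oplus>\<^bsub>R\<^esub> s) = VA +>\<^bsub>degree_zero A\<^esub> ?x" .
    moreover have "(?x \<oplus> V y) \<ominus> ?x = V y"
      using c grade_carrier[OF yG] V_simps(1) by (simp add: a_comm[of ?x] add_minus_cancel)
    ultimately show "?x \<oplus> V y \<in> \<iota> (r \<oplus>\<^bsub>R\<^esub> s)"
      using mod_V_coset_mem[of ?x] add_grade[OF g] yG V_grade add_grade by auto
  qed (use r s in simp)
  thus ?thesis using y by blast
qed

lemma Teichmueller_add_Fil:
  assumes r: "r \<in> carrier R" and s: "s \<in> carrier R"
  shows "\<exists>y\<in>grade A 0. \<tau> (r \<oplus>\<^bsub>R\<^esub> s) = (\<tau> r \<oplus> \<tau> s) \<oplus> V y"
  by (rule Teichmueller_add[OF r s grade_zero_subring]) (use Teichmueller_grade r s grade_zero_limit in auto)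

end

context strict_dieudonne_algebra
begin

lemma d_nat_pow:
  assumes x: "x \<in> grade A 0"
  shows "differential A (x [^] Suc n) = [Suc n] \<cdot> (x [^] n \<otimes> differential A x)"
proof (induction n)
  have c: "x \<in> carrier A" "differential A x \<in> carrier A" using x grade_carrier d_simps(1) by auto
  {
    case 0
    show ?case using c by simp
  next
    case (Suc n)
    have "differential A (x [^] Suc (Suc n)) = differential A (x [^] Suc n) \<otimes> x \<oplus> x [^] Suc n \<otimes> differential A x"
      using Leibniz_left[OF nat_pow_grade[OF x] c(1), of "Suc n"] by simp
    also have "differential A (x [^] Suc n) \<otimes> x = [Suc n] \<cdot> (x [^] Suc n \<otimes> differential A x)"
      unfolding Suc using c grade_zero_comm[OF x c(2)]
      by (simp add: add_pow_ldistr m_assoc del: add.nat_pow_Suc)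
    finally show ?case using c by (simp only: add.nat_pow_Suc)
  }
qed

end

section \<open>Saturation and closure of a subalgebra\<close>

context dieudonne_subalgebra
begin

lemma F_pow_mem_mono:
  assumes "(Frob A ^^ k) x \<in> S" "k \<le> l"
  shows "(Frob A ^^ l) x \<in> S"
proof -
  have "(Frob A ^^ l) x = (Frob A ^^ (l - k)) ((Frob A ^^ k) x)"
    using assms(2) by (simp flip: funpow_add comp_apply[of "Frob A ^^ (l - k)"])
  thus ?thesis using F_pow_mem assms(1) by simp
qed

text \<open>The condition on dx is separate because d(F^k x) = p^k F^k(dx) only places a multiple of
  F^k(dx) in S. The exponent may be enlarged freely since S is stable under F.\<close>

definition saturation :: "'a set" where
  "saturation = {x \<in> carrier A. \<exists>k. (Frob A ^^ k) x \<in> S \<and> (Frob A ^^ k) (differential A x) \<in> S}"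

definition closure :: "'a set" where
  "closure = {x \<in> carrier A. \<forall>r. \<exists>y\<in>S. x \<ominus> y \<in> Fil r}"

lemma saturationI: "x \<in> carrier A \<Longrightarrow> (Frob A ^^ k) x \<in> S \<Longrightarrow> (Frob A ^^ k) (differential A x) \<in> S \<Longrightarrow> x \<in> saturation"
  unfolding saturation_def by blast

lemma saturation_common:
  assumes "x \<in> saturation" "y \<in> saturation"
  obtains k where "(Frob A ^^ k) x \<in> S" "(Frob A ^^ k) (differential A x) \<in> S"
    "(Frob A ^^ k) y \<in> S" "(Frob A ^^ k) (differential A y) \<in> S"
proof -
  obtain k l where "(Frob A ^^ k) x \<in> S" "(Frob A ^^ k) (differential A x) \<in> S"
    "(Frob A ^^ l) y \<in> S" "(Frob A ^^ l) (differential A y) \<in> S"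
    using assms unfolding saturation_def by blast
  thus ?thesis using that[of "max k l"] F_pow_mem_mono[of k _ "max k l"] F_pow_mem_mono[of l _ "max k l"] by simp
qed

lemma subset_saturation: "S \<subseteq> saturation"
  using saturationI[of _ 0] mem_carrier d_mem by auto

lemma subset_closure: "S \<subseteq> closure"
  unfolding closure_def using mem_carrier Fil_zero by (auto simp: minus_eq r_neg intro!: bexI)

text \<open>The delicate condition is the Frobenius lift. Let Fx = x^p + py. Applying F^k and
  cancelling p identifies F^k y with the lift term of F^k x, which is in S. Differentiating and
  cancelling p gives dy = F(dx) - x^(p-1) dx, whose image under F^k is in S as well.\<close>

lemma saturation_subalgebra:
  assumes p: "p > 0"
  shows "dieudonne_subalgebra p A saturation"
proof
  have sub: "x \<in> carrier A" if "x \<in> saturation" for x using that unfolding saturation_def by blast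
  have add: "x \<oplus> y \<in> saturation" if xy: "x \<in> saturation" "y \<in> saturation" for x y
  proof -
    obtain k where "(Frob A ^^ k) x \<in> S" "(Frob A ^^ k) (differential A x) \<in> S"
      "(Frob A ^^ k) y \<in> S" "(Frob A ^^ k) (differential A y) \<in> S" using saturation_common[OF xy] .
    thus ?thesis using sub[OF xy(1)] sub[OF xy(2)]
      by (intro saturationI[of _ k]) (simp_all add: d_simps F_pow_simps add_mem)
  qed
  have comp: "component A x n \<in> saturation" if x: "x \<in> saturation" for x n
  proof -
    obtain k where k: "(Frob A ^^ k) x \<in> S" "(Frob A ^^ k) (differential A x) \<in> S" using saturation_common[OF x x] .
    have c: "x \<in> carrier A" using sub x by blast
    have "component A (differential A x) (n + 1) = differential A (component A x n)"
      using component_d[OF c, of "n + 1"] by simp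
    hence "(Frob A ^^ k) (differential A (component A x n)) = component A ((Frob A ^^ k) (differential A x)) (n + 1)"
      using component_F_pow[OF d_simps(1)[OF c]] by simp
    thus ?thesis using k c component_F_pow[OF c] component_mem
      by (intro saturationI[of _ k]) (auto simp: component_carrier simp flip: component_F_pow)
  qed
  show "saturation \<subseteq> carrier A" using sub by blast
  show "\<one> \<in> saturation" using subset_saturation one_mem by blast
  show "x \<oplus> y \<in> saturation" if "x \<in> saturation" "y \<in> saturation" for x y using add that .
  show "component A x n \<in> saturation" if "x \<in> saturation" for x n using comp that .
  show "\<ominus> x \<in> saturation" if x: "x \<in> saturation" for x
  proof -
    obtain k where "(Frob A ^^ k) x \<in> S" "(Frob A ^^ k) (differential A x) \<in> S" using saturation_common[OF x x] .
    thus ?thesis using sub[OF x]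
      by (intro saturationI[of _ k]) (simp_all add: d_simps F_pow_simps neg_mem)
  qed
  show "differential A x \<in> saturation" if x: "x \<in> saturation" for x
  proof -
    obtain k where "(Frob A ^^ k) x \<in> S" "(Frob A ^^ k) (differential A x) \<in> S" using saturation_common[OF x x] .
    thus ?thesis using sub[OF x]
      by (intro saturationI[of _ k]) (simp_all add: d_simps F_pow_simps differential_square zero_mem)
  qed
  show "Frob A x \<in> saturation" if x: "x \<in> saturation" for x
  proof -
    obtain k where k: "(Frob A ^^ k) x \<in> S" "(Frob A ^^ k) (differential A x) \<in> S" using saturation_common[OF x x] .
    have c: "x \<in> carrier A" using sub x by blast
    have "(Frob A ^^ k) (differential A (Frob A x)) = [p] \<cdot> Frob A ((Frob A ^^ k) (differential A x))"
      using c by (simp add: differential_Frob d_simps F_simps F_pow_simps funpow_swap1)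
    moreover have "(Frob A ^^ k) (Frob A x) = Frob A ((Frob A ^^ k) x)" by (simp add: funpow_swap1)
    ultimately show ?thesis using k c
      by (intro saturationI[of _ k]) (simp_all add: F_simps F_mem nat_mult_mem)
  qed
  show "x \<otimes> y \<in> saturation" if x: "x \<in> saturation" and y: "y \<in> saturation" for x y
  proof (rule mult_closed_if_homogeneous)
    show "component A x m \<otimes> component A y n \<in> saturation" for m n
    proof -
      let ?x = "component A x m" and ?y = "component A y n"
      obtain k where k: "(Frob A ^^ k) ?x \<in> S" "(Frob A ^^ k) (differential A ?x) \<in> S"
        "(Frob A ^^ k) ?y \<in> S" "(Frob A ^^ k) (differential A ?y) \<in> S"
        using saturation_common[OF comp[OF x] comp[OF y]] .
      have c: "?x \<in> carrier A" "?y \<in> carrier A" "differential A ?x \<in> carrier A" "differential A ?y \<in> carrier A"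
        using sub x y component_carrier d_simps(1) by auto
      show ?thesis
      proof (rule saturationI[of _ k])
        show "(Frob A ^^ k) (?x \<otimes> ?y) \<in> S" using c k mult_mem by (simp add: F_pow_mult)
        show "(Frob A ^^ k) (differential A (?x \<otimes> ?y)) \<in> S"
          unfolding Leibniz_left[OF component_grade[OF sub[OF x]] c(2)]
          using c k mult_mem neg_mem by (auto simp: F_pow_mult F_pow_simps intro!: add_mem)
      qed (use c in simp)
    qed
  qed (use sub x y add subset_saturation zero_mem in auto)
  show "\<exists>y\<in>saturation \<inter> grade A 0. Frob A x = x [^] p \<oplus> [p] \<cdot> y" if x: "x \<in> saturation" "x \<in> grade A 0" for x
  proof -
    obtain q where Suc: "p = Suc q" using p by (metis Suc_pred)
    have c: "x \<in> carrier A" "differential A x \<in> carrier A" using sub x d_simps(1) by auto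
    obtain y where y: "y \<in> grade A 0" "Frob A x = x [^] p \<oplus> [p] \<cdot> y" using Frob_lift[OF x(2)] by blast
    have yc: "y \<in> carrier A" using y grade_carrier by blast
    obtain k where k: "(Frob A ^^ k) x \<in> S" "(Frob A ^^ k) (differential A x) \<in> S" using saturation_common[OF x(1) x(1)] .
    obtain z where z: "z \<in> S" "Frob A ((Frob A ^^ k) x) = ((Frob A ^^ k) x) [^] p \<oplus> [p] \<cdot> z"
      using lift_mem[OF k(1) F_pow_grade[OF x(2)]] by blast
    have zc: "z \<in> carrier A" using z mem_carrier by blast
    have "Frob A ((Frob A ^^ k) x) = (Frob A ^^ k) (Frob A x)" by (simp add: funpow_swap1)
    also have "\<dots> = ((Frob A ^^ k) x) [^] p \<oplus> [p] \<cdot> (Frob A ^^ k) y"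
      unfolding y(2) using c yc by (simp add: F_pow_simps F_pow_nat_pow)
    finally have "[p] \<cdot> z = [p] \<cdot> (Frob A ^^ k) y"
      unfolding z(2) using c yc zc F_pow_simps(1) by simp
    hence Fy: "(Frob A ^^ k) y \<in> S" using p_cancel[OF zc F_pow_simps(1)[OF yc]] z(1) by simp
    have "[p] \<cdot> Frob A (differential A x) = differential A (x [^] p) \<oplus> [p] \<cdot> differential A y"
      using differential_Frob[OF c(1)] unfolding y(2) using c yc by (simp add: d_simps)
    also have "\<dots> = [p] \<cdot> (x [^] q \<otimes> differential A x \<oplus> differential A y)"
      unfolding Suc d_nat_pow[OF x(2)] using c yc d_simps(1) by (simp add: nat_mult_simps del: add.nat_pow_Suc)
    finally have "Frob A (differential A x) = x [^] q \<otimes> differential A x \<oplus> differential A y"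
      by (rule p_cancel[rotated 2]) (use c yc d_simps(1) F_simps(1) in auto)
    hence "differential A y = Frob A (differential A x) \<ominus> x [^] q \<otimes> differential A x"
      using c yc d_simps(1) by (simp add: a_comm add_minus_cancel(3))
    hence "(Frob A ^^ k) (differential A y) = Frob A ((Frob A ^^ k) (differential A x)) \<ominus> ((Frob A ^^ k) x) [^] q \<otimes> (Frob A ^^ k) (differential A x)"
      using c by (simp add: F_pow_simps F_simps F_pow_mult F_pow_nat_pow funpow_swap1)
    also have "\<dots> \<in> S" by (intro minus_mem mult_mem nat_pow_mem F_mem k)
    finally show ?thesis using y yc Fy saturationI by blast
  qed
qed

text \<open>The delicate condition is again the Frobenius lift, where division by p has to respect
  approximation. Write x = b + h with b in S of degree 0 and h = V^(r+1) u. Both Fh and h^2 are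
  explicit multiples of p, so p cancels when Fx is compared with Fb, and the lift terms of x and b
  agree modulo Fil r.\<close>

lemma closure_subalgebra:
  assumes p: "p > 0"
  shows "dieudonne_subalgebra p A closure"
proof
  have sub: "x \<in> carrier A" if "x \<in> closure" for x using that unfolding closure_def by blast
  have approx: "\<exists>y\<in>S. x \<ominus> y \<in> Fil r" if "x \<in> closure" for x r using that unfolding closure_def by blast
  have I: "x \<in> closure" if "x \<in> carrier A" "\<And>r. \<exists>y\<in>S. x \<ominus> y \<in> Fil r" for x
    using that unfolding closure_def by blast
  show "closure \<subseteq> carrier A" using sub by blast
  show "\<one> \<in> closure" using subset_closure one_mem by blast
  show "x \<oplus> y \<in> closure" if x: "x \<in> closure" and y: "y \<in> closure" for x y
  proof (rule I)
    fix r
    obtain a b where "a \<in> S" "x \<ominus> a \<in> Fil r" "b \<in> S" "y \<ominus> b \<in> Fil r" using approx x y by meson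
    thus "\<exists>z\<in>S. (x \<oplus> y) \<ominus> z \<in> Fil r" using sub[OF x] sub[OF y] mem_carrier
      by (intro bexI[of _ "a \<oplus> b"]) (auto simp: minus_add_minus Fil_add add_mem)
  qed (use x y sub in auto)
  show "\<ominus> x \<in> closure" if x: "x \<in> closure" for x
  proof (rule I)
    fix r
    obtain a where a: "a \<in> S" "x \<ominus> a \<in> Fil r" using approx x by meson
    have "(\<ominus> x) \<ominus> (\<ominus> a) = \<ominus> (x \<ominus> a)" using sub[OF x] mem_carrier[OF a(1)] by (simp add: minus_eq minus_add)
    thus "\<exists>z\<in>S. (\<ominus> x) \<ominus> z \<in> Fil r" using a Fil_neg neg_mem by (intro bexI[of _ "\<ominus> a"]) auto
  qed (use x sub in auto)
  show "x \<otimes> y \<in> closure" if x: "x \<in> closure" and y: "y \<in> closure" for x y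
  proof (rule I)
    fix r
    obtain a b where ab: "a \<in> S" "x \<ominus> a \<in> Fil r" "b \<in> S" "y \<ominus> b \<in> Fil r" using approx x y by meson
    have c: "x \<in> carrier A" "y \<in> carrier A" "a \<in> carrier A" "b \<in> carrier A" using sub x y ab mem_carrier by auto
    have "x \<otimes> y \<ominus> a \<otimes> b = (x \<otimes> y \<ominus> a \<otimes> y) \<oplus> (a \<otimes> y \<ominus> a \<otimes> b)"
      using c by (simp add: minus_telescope)
    also have "\<dots> = (x \<ominus> a) \<otimes> y \<oplus> a \<otimes> (y \<ominus> b)"
      using c by (simp add: minus_eq l_distr r_distr l_minus r_minus)
    also have "\<dots> \<in> Fil r" using Fil_add Fil_mult_left[OF ab(4) c(3)] Fil_mult_right[OF ab(2) c(2)] by blast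
    finally show "\<exists>z\<in>S. x \<otimes> y \<ominus> z \<in> Fil r" using mult_mem ab by blast
  qed (use x y sub in auto)
  show "differential A x \<in> closure" if x: "x \<in> closure" for x
  proof (rule I)
    fix r
    obtain a where a: "a \<in> S" "x \<ominus> a \<in> Fil r" using approx x by meson
    have "differential A x \<ominus> differential A a = differential A (x \<ominus> a)" using sub[OF x] mem_carrier[OF a(1)] by (simp add: d_simps)
    thus "\<exists>z\<in>S. differential A x \<ominus> z \<in> Fil r" using a Fil_d d_mem by (intro bexI[of _ "differential A a"]) auto
  qed (use x sub d_simps in auto)
  show "Frob A x \<in> closure" if x: "x \<in> closure" for x
  proof (rule I)
    fix r
    \<comment> \<open>F lowers the filtration level by one.\<close>
    obtain a where a: "a \<in> S" "x \<ominus> a \<in> Fil (Suc r)" using approx x by meson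
    have "Frob A x \<ominus> Frob A a = Frob A (x \<ominus> a)" using sub[OF x] mem_carrier[OF a(1)] by (simp add: F_simps)
    thus "\<exists>z\<in>S. Frob A x \<ominus> z \<in> Fil r" using a Fil_F F_mem by (intro bexI[of _ "Frob A a"]) auto
  qed (use x sub F_simps in auto)
  show "component A x n \<in> closure" if x: "x \<in> closure" for x n
  proof (rule I)
    fix r
    obtain a where a: "a \<in> S" "x \<ominus> a \<in> Fil r" using approx x by meson
    have "component A x n \<ominus> component A a n = component A (x \<ominus> a) n" using sub[OF x] mem_carrier[OF a(1)] by (simp add: component_simps)
    thus "\<exists>z\<in>S. component A x n \<ominus> z \<in> Fil r" using a Fil_component component_mem by (intro bexI[of _ "component A a n"]) auto
  qed (use x sub component_carrier in auto)
  show "\<exists>y\<in>closure \<inter> grade A 0. Frob A x = x [^] p \<oplus> [p] \<cdot> y" if x: "x \<in> closure" "x \<in> grade A 0" for x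
  proof -
    obtain q where q: "p = Suc q" using p by (metis Suc_pred)
    obtain y where y: "y \<in> grade A 0" "Frob A x = x [^] p \<oplus> [p] \<cdot> y" using Frob_lift[OF x(2)] by blast
    have yc: "y \<in> carrier A" and xc: "x \<in> carrier A" using x y grade_carrier by auto
    have "\<exists>z\<in>S. y \<ominus> z \<in> Fil r" for r
    proof -
      \<comment> \<open>One level more than the target, because Fh = p V^r u has lost one V.\<close>
      obtain a where a: "a \<in> S" "x \<ominus> a \<in> Fil (Suc r)" using approx x(1) by meson
      let ?b = "component A a 0"
      have b: "?b \<in> S" "?b \<in> grade A 0" "?b \<in> carrier A"
        using component_mem a component_grade component_carrier mem_carrier by auto
      have "x \<ominus> ?b = component A (x \<ominus> a) 0"
        using component_simps(5)[OF xc mem_carrier[OF a(1)]] component_homogeneous[OF x(2)] by simp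
      hence "x \<ominus> ?b \<in> Fil (Suc r)" using Fil_component a by simp
      then obtain u where u: "u \<in> grade A 0" "x \<ominus> ?b = (V ^^ Suc r) u"
        using Fil_grade_zero minus_grade[OF x(2) b(2)] by blast
      have uc: "u \<in> carrier A" using u grade_carrier by blast
      define h where "h = (V ^^ Suc r) u"
      have h: "h \<in> grade A 0" "h \<in> carrier A" unfolding h_def using V_pow_grade[OF u(1), of "Suc r"] grade_carrier by blast+
      have xb: "x = ?b \<oplus> h" unfolding h_def u(2)[symmetric] using xc b add_minus_cancel(1) by simp
      obtain z where z: "z \<in> S" "z \<in> grade A 0" "Frob A ?b = ?b [^] p \<oplus> [p] \<cdot> z" using lift_mem[OF b(1,2)] by blast
      have zc: "z \<in> carrier A" using z mem_carrier by blast
      obtain c where c: "c \<in> grade A 0"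
        "x [^] Suc q = (?b [^] Suc q \<oplus> [Suc q] \<cdot> (?b [^] q \<otimes> h)) \<oplus> (h \<otimes> h) \<otimes> c"
        using grade_zero_pow_add_expansion[OF grade_zero_subring b(2) h(1)] unfolding xb by blast
      have cc: "c \<in> carrier A" using c grade_carrier by blast
      \<comment> \<open>This is h^2/p: by the projection formula h^2 = V^(r+1)(u p^(r+1) u), and one
        factor p is split off.\<close>
      let ?e = "[(p ^ r)] \<cdot> (V ^^ Suc r) (u \<otimes> u)"
      have ec: "?e \<in> carrier A" "V ((V ^^ r) (u \<otimes> u)) \<in> carrier A" using V_pow_simps(1)[of "u \<otimes> u" "Suc r"] uc by auto
      have "h \<otimes> h = (V ^^ Suc r) (u \<otimes> [(p ^ Suc r)] \<cdot> u)"
        unfolding h_def using V_pow_mult_left[OF uc, of "(V ^^ Suc r) u" "Suc r"] F_pow_V_pow[OF uc, of "Suc r"] h(2) h_def by simp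
      also have "\<dots> = [p] \<cdot> ?e"
        using uc V_pow_simps(6)[of "u \<otimes> u" "Suc r" "p ^ Suc r"] ec by (simp add: add_pow_rdistr nat_mult_simps)
      finally have hh: "h \<otimes> h = [p] \<cdot> ?e" .
      define e where "e = ?e"
      have eC: "e \<in> carrier A" using ec(1) unfolding e_def .
      have xp: "x [^] p = (?b [^] p \<oplus> [p] \<cdot> (?b [^] q \<otimes> h)) \<oplus> [p] \<cdot> (e \<otimes> c)"
        using c(2) unfolding hh q[symmetric] e_def[symmetric] using eC cc by (simp add: add_pow_ldistr)
      have Fh: "Frob A h = [p] \<cdot> (V ^^ r) u" unfolding h_def using uc V_pow_simps(1) by (simp add: F_V)
      have Vc: "(V ^^ r) u \<in> carrier A" using uc V_pow_simps(1) by auto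
      have "?b [^] p \<oplus> [p] \<cdot> (z \<oplus> (V ^^ r) u) = Frob A x"
        unfolding xb using b h z(3) zc Vc by (simp add: F_simps Fh nat_mult_simps a_assoc)
      also have "\<dots> = ?b [^] p \<oplus> [p] \<cdot> ((?b [^] q \<otimes> h \<oplus> e \<otimes> c) \<oplus> y)"
        unfolding y(2) xp using b h cc yc eC by (simp add: nat_mult_simps(3) a_assoc)
      finally have "[p] \<cdot> (z \<oplus> (V ^^ r) u) = [p] \<cdot> ((?b [^] q \<otimes> h \<oplus> e \<otimes> c) \<oplus> y)"
        using b h cc yc zc Vc eC by simp
      hence yz: "z \<oplus> (V ^^ r) u = (?b [^] q \<otimes> h \<oplus> e \<otimes> c) \<oplus> y"
        by (rule p_cancel[rotated 2]) (use b h cc yc zc Vc eC in auto)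
      let ?g = "?b [^] q \<otimes> h \<oplus> e \<otimes> c"
      have hF: "h \<in> Fil r" unfolding h_def using Fil_Suc[OF Fil_V[OF uc]] .
      have "e \<in> Fil r" unfolding e_def by (rule Fil_p_pow) (use uc V_pow_simps(1) in blast)
      hence g: "?g \<in> Fil r" using Fil_add Fil_mult_left[OF hF] Fil_mult_right cc b by auto
      have gc: "?g \<in> carrier A" using Fil_carrier g by blast
      have "y \<ominus> z = (V ^^ r) u \<ominus> ?g"
      proof -
        have "y = (z \<oplus> (V ^^ r) u) \<ominus> ?g" unfolding yz using gc yc by (simp add: a_comm[of ?g] add_minus_cancel(3))
        also have "\<dots> = ((V ^^ r) u \<ominus> ?g) \<oplus> z" using zc Vc gc by (simp add: minus_eq a_ac)
        finally show ?thesis using add_minus_cancel(3)[of "(V ^^ r) u \<ominus> ?g" z] zc Vc gc by simp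
      qed
      also have "\<dots> \<in> Fil r" using g Fil_V[OF uc] by (rule_tac Fil_minus)
      finally show ?thesis using z(1) by blast
    qed
    thus ?thesis using y yc I by blast
  qed
qed

end

section \<open>Bounded subalgebras\<close>

context dieudonne_algebra_over
begin

text \<open>Phrased with the components of all elements, so that it can be checked on additive
  generators. As S contains the components of its elements, it amounts to S \<inter> A^n \<subseteq>
  Fil^1 for n > D.\<close>

definition bounded_subalgebra :: "int \<Rightarrow> 'a set \<Rightarrow> bool" where
  "bounded_subalgebra D S \<longleftrightarrow> dieudonne_subalgebra p A S \<and> \<tau> ` carrier R \<subseteq> S \<and>
     (\<forall>x\<in>S. \<forall>n>D. component A x n \<in> Fil 1)"

lemma bounded_saturation:
  assumes "bounded_subalgebra D S"
  shows "bounded_subalgebra D (dieudonne_subalgebra.saturation A S)"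
proof -
  interpret S: dieudonne_subalgebra p A S using assms unfolding bounded_subalgebra_def by blast
  have "component A x n \<in> Fil 1" if x: "x \<in> S.saturation" and n: "n > D" for x n
  proof -
    obtain k where k: "(Frob A ^^ k) x \<in> S" "x \<in> carrier A" using x unfolding S.saturation_def by blast
    have "(Frob A ^^ k) (component A x n) \<in> Fil 1"
      using assms k(1) n component_F_pow[OF k(2), of k n] unfolding bounded_subalgebra_def by metis
    thus ?thesis by (rule Fil1_if_F_pow[OF component_carrier[OF k(2)]])
  qed
  thus ?thesis using assms S.subset_saturation S.saturation_subalgebra[OF p_pos]
    unfolding bounded_subalgebra_def by blast
qed

lemma bounded_closure:
  assumes "bounded_subalgebra D S"
  shows "bounded_subalgebra D (dieudonne_subalgebra.closure p A S)"
proof -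
  interpret S: dieudonne_subalgebra p A S using assms unfolding bounded_subalgebra_def by blast
  have "component A x n \<in> Fil 1" if x: "x \<in> S.closure" and n: "n > D" for x n
  proof -
    obtain y where y: "y \<in> S" "x \<ominus> y \<in> Fil 1" "x \<in> carrier A" using x unfolding S.closure_def by blast
    have yc: "y \<in> carrier A" using y S.mem_carrier by blast
    have 1: "component A x n \<ominus> component A y n \<in> Fil 1"
      using Fil_component[OF y(2), of n] component_simps(5)[OF y(3) yc, of n] by simp
    have 2: "component A y n \<in> Fil 1"
      using assms y n unfolding bounded_subalgebra_def by auto
    show ?thesis by (rule Fil_minus_cancel[OF component_carrier[OF y(3)] component_carrier[OF yc] 1 2])
  qed
  thus ?thesis using assms S.subset_closure S.closure_subalgebra[OF p_pos]
    unfolding bounded_subalgebra_def by blast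
qed

lemma bounded_chain:
  assumes C: "C \<noteq> {}" "subset.chain (Collect (bounded_subalgebra D)) C"
  shows "bounded_subalgebra D (\<Union>C)"
proof -
  have b: "bounded_subalgebra D S" if "S \<in> C" for S
    using C(2) that unfolding subset.chain_def by blast
  hence s: "dieudonne_subalgebra p A S" if "S \<in> C" for S
    using that unfolding bounded_subalgebra_def by blast
  have two: "\<exists>S\<in>C. x \<in> S \<and> y \<in> S" if xy: "x \<in> \<Union>C" "y \<in> \<Union>C" for x y
  proof -
    obtain S T where "S \<in> C" "T \<in> C" "x \<in> S" "y \<in> T" using xy by blast
    moreover have "S \<subseteq> T \<or> T \<subseteq> S" using C(2) calculation(1,2) unfolding subset_chain_def by blast
    ultimately show ?thesis by blast
  qed
  obtain S0 where S0: "S0 \<in> C" using C(1) by blast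
  have "dieudonne_subalgebra p A (\<Union>C)"
  proof
    show "\<Union>C \<subseteq> carrier A" using dieudonne_subalgebra.subset[OF s] by blast
    show "\<one> \<in> \<Union>C" using dieudonne_subalgebra.one_mem[OF s] S0 by blast
    show "x \<oplus> y \<in> \<Union>C" if xy: "x \<in> \<Union>C" "y \<in> \<Union>C" for x y
      using two[OF xy] dieudonne_subalgebra.add_mem[OF s] by blast
    show "x \<otimes> y \<in> \<Union>C" if xy: "x \<in> \<Union>C" "y \<in> \<Union>C" for x y
      using two[OF xy] dieudonne_subalgebra.mult_mem[OF s] by blast
    show "\<ominus> x \<in> \<Union>C" if x: "x \<in> \<Union>C" for x
      using x dieudonne_subalgebra.neg_mem[OF s] by blast
    show "differential A x \<in> \<Union>C" if x: "x \<in> \<Union>C" for x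
      using x dieudonne_subalgebra.d_mem[OF s] by blast
    show "Frob A x \<in> \<Union>C" if x: "x \<in> \<Union>C" for x
      using x dieudonne_subalgebra.F_mem[OF s] by blast
    show "component A x n \<in> \<Union>C" if x: "x \<in> \<Union>C" for x n
      using x dieudonne_subalgebra.component_mem[OF s] by blast
    show "\<exists>y\<in>\<Union>C \<inter> grade A 0. Frob A x = x [^] p \<oplus> [p] \<cdot> y"
      if x: "x \<in> \<Union>C" "x \<in> grade A 0" for x
      using x dieudonne_subalgebra.lift_mem[OF s] by blast
  qed
  thus ?thesis using b S0 unfolding bounded_subalgebra_def by blast
qed

text \<open>Saturating might destroy closedness and closing might destroy saturation. A maximal
  bounded subalgebra is fixed by both operations at once.\<close>

lemma closed_bounded_subalgebra_exists:
  assumes "bounded_subalgebra D S"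
  shows "\<exists>S. closed_dieudonne_subalgebra p A S \<and> bounded_subalgebra D S"
proof -
  have "\<exists>M\<in>Collect (bounded_subalgebra D). \<forall>X\<in>Collect (bounded_subalgebra D). M \<subseteq> X \<longrightarrow> X = M"
    by (rule subset_Zorn_nonempty) (use assms bounded_chain in auto)
  then obtain M where M: "bounded_subalgebra D M"
    and max: "\<And>X. bounded_subalgebra D X \<Longrightarrow> M \<subseteq> X \<Longrightarrow> X = M" by blast
  interpret M: dieudonne_subalgebra p A M using M unfolding bounded_subalgebra_def by blast
  have sat: "M.saturation = M" by (rule max[OF bounded_saturation[OF M] M.subset_saturation])
  have cl: "M.closure = M" by (rule max[OF bounded_closure[OF M] M.subset_closure])
  have "closed_dieudonne_subalgebra p A M"
  proof unfold_locales
    show "x \<in> M" if "x \<in> carrier A" "Frob A x \<in> M" "Frob A (differential A x) \<in> M" for x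
      using M.saturationI[of x 1] that sat by simp
    show "x \<in> M" if "x \<in> carrier A" "\<And>r. \<exists>y\<in>M. x \<ominus> y \<in> Fil r" for x
      using that cl unfolding M.closure_def by blast
  qed
  thus ?thesis using M by blast
qed

section \<open>Monomials in Teichmueller elements and their differentials\<close>

inductive monomial :: "nat \<Rightarrow> 'a \<Rightarrow> bool" where
  Teichmueller: "r \<in> carrier R \<Longrightarrow> monomial 0 (\<tau> r)"
| d_Teichmueller: "monomial n m \<Longrightarrow> r \<in> carrier R \<Longrightarrow> monomial (Suc n) (m \<otimes> differential A (\<tau> r))"

text \<open>The additive subgroup suffices to get a ring: Teichmueller elements commute with
  everything and multiply among themselves, so products of monomials are monomials.\<close>

inductive_set monomial_span :: "'a set" where
  zero: "\<zero> \<in> monomial_span"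
| monomial: "monomial n m \<Longrightarrow> m \<in> monomial_span"
| add: "x \<in> monomial_span \<Longrightarrow> y \<in> monomial_span \<Longrightarrow> x \<oplus> y \<in> monomial_span"
| neg: "x \<in> monomial_span \<Longrightarrow> \<ominus> x \<in> monomial_span"

lemma d_Teichmueller_grade: "r \<in> carrier R \<Longrightarrow> differential A (\<tau> r) \<in> grade A 1"
  using differential_grade[OF Teichmueller_grade] by simp

lemma d_Teichmueller_carrier: "r \<in> carrier R \<Longrightarrow> differential A (\<tau> r) \<in> carrier A"
  using d_Teichmueller_grade grade_carrier by blast

lemma monomial_grade: "monomial n m \<Longrightarrow> m \<in> grade A (int n)"
proof (induction rule: monomial.induct)
  case (d_Teichmueller n m r)
  thus ?case using mult_grade[OF d_Teichmueller.IH d_Teichmueller_grade] by (simp add: add.commute)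
qed (simp add: Teichmueller_grade)

lemma monomial_carrier: "monomial n m \<Longrightarrow> m \<in> carrier A"
  using monomial_grade grade_carrier by blast

lemma monomial_left:
  assumes s: "s \<in> carrier R"
  shows "monomial n m \<Longrightarrow> monomial n (\<tau> s \<otimes> m)"
proof (induction rule: monomial.induct)
  case (Teichmueller r)
  thus ?case using s monomial.Teichmueller[of "s \<otimes>\<^bsub>R\<^esub> r"] by (simp add: Teichmueller_mult)
next
  case (d_Teichmueller n m r)
  thus ?case using s monomial.d_Teichmueller[OF d_Teichmueller.IH]
    by (simp add: m_assoc Teichmueller_carrier d_Teichmueller_carrier monomial_carrier)
qed

lemma monomial_right: "s \<in> carrier R \<Longrightarrow> monomial n m \<Longrightarrow> monomial n (m \<otimes> \<tau> s)"
  using monomial_left[of s n m] grade_zero_comm[OF Teichmueller_grade monomial_carrier] by simp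

lemma monomial_mult: "monomial n y \<Longrightarrow> monomial m x \<Longrightarrow> monomial (m + n) (x \<otimes> y)"
proof (induction rule: monomial.induct)
  case (Teichmueller r)
  thus ?case by (simp add: monomial_right)
next
  case (d_Teichmueller n y r)
  thus ?case using monomial.d_Teichmueller[OF d_Teichmueller.IH, of r]
    by (simp add: m_assoc d_Teichmueller_carrier monomial_carrier)
qed

text \<open>After multiplication by p this is d(F[r]) = d([r]^p) = p [r]^(p-1) d[r].\<close>

lemma F_d_Teichmueller:
  assumes r: "r \<in> carrier R"
  shows "Frob A (differential A (\<tau> r)) = \<tau> (r [^]\<^bsub>R\<^esub> (p - 1)) \<otimes> differential A (\<tau> r)"
proof (rule p_cancel)
  have p: "Suc (p - 1) = p" using p_pos by simp
  have "[p] \<cdot> Frob A (differential A (\<tau> r)) = differential A (\<tau> r [^] Suc (p - 1))"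
    unfolding p using differential_Frob[OF Teichmueller_carrier[OF r]] F_Teichmueller[OF r] by simp
  also have "\<dots> = [p] \<cdot> (\<tau> (r [^]\<^bsub>R\<^esub> (p - 1)) \<otimes> differential A (\<tau> r))"
    using d_nat_pow[OF Teichmueller_grade[OF r], of "p - 1"] unfolding p Teichmueller_pow[OF r] .
  finally show "[p] \<cdot> Frob A (differential A (\<tau> r)) = [p] \<cdot> (\<tau> (r [^]\<^bsub>R\<^esub> (p - 1)) \<otimes> differential A (\<tau> r))" .
qed (use r in \<open>auto simp: F_simps d_Teichmueller_carrier Teichmueller_carrier\<close>)

lemma monomial_F: "monomial n m \<Longrightarrow> monomial n (Frob A m)"
proof (induction rule: monomial.induct)
  case (Teichmueller r)
  thus ?case using monomial.Teichmueller[of "r [^]\<^bsub>R\<^esub> p"] by (simp add: F_Teichmueller Teichmueller_pow)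
next
  case (d_Teichmueller n m r)
  note r = d_Teichmueller.hyps(2)
  have "Frob A (m \<otimes> differential A (\<tau> r)) = (Frob A m \<otimes> \<tau> (r [^]\<^bsub>R\<^esub> (p - 1))) \<otimes> differential A (\<tau> r)"
    using d_Teichmueller r
    by (simp add: F_mult F_d_Teichmueller m_assoc F_simps monomial_carrier d_Teichmueller_carrier Teichmueller_carrier)
  thus ?case using monomial.d_Teichmueller[OF monomial_right[OF _ d_Teichmueller.IH] r] r by simp
qed

text \<open>d[r] is the monomial [1]d[r], and dd = 0 leaves only (dm)d[r] of the Leibniz rule for m
  d[r].\<close>

lemma monomial_d: "monomial n m \<Longrightarrow> monomial (Suc n) (differential A m)"
proof (induction rule: monomial.induct)
  case (Teichmueller r)
  thus ?case using monomial.d_Teichmueller[OF monomial.Teichmueller[OF R.one_closed], of r]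
    by (simp add: Teichmueller_one d_Teichmueller_carrier)
next
  case (d_Teichmueller n m r)
  note r = d_Teichmueller.hyps(2)
  have "differential A (m \<otimes> differential A (\<tau> r)) = differential A m \<otimes> differential A (\<tau> r)"
    using Leibniz_left[OF monomial_grade[OF d_Teichmueller.hyps(1)] d_Teichmueller_carrier[OF r]] d_Teichmueller r
    by (simp add: differential_square monomial_carrier d_Teichmueller_carrier Teichmueller_carrier d_simps)
  thus ?case using monomial.d_Teichmueller[OF d_Teichmueller.IH r] by simp
qed

lemma monomial_span_carrier: "x \<in> monomial_span \<Longrightarrow> x \<in> carrier A"
  by (induction rule: monomial_span.induct) (auto simp: monomial_carrier)

lemma monomial_span_mult:
  assumes x: "x \<in> monomial_span" and y: "y \<in> monomial_span"
  shows "x \<otimes> y \<in> monomial_span"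
  using x
proof (induction rule: monomial_span.induct)
  case zero
  show ?case using y by (simp add: monomial_span_carrier monomial_span.zero)
next
  case (monomial n m)
  show ?case using y
  proof (induction rule: monomial_span.induct)
    case (monomial n' m')
    show ?case by (rule monomial_span.monomial[OF monomial_mult[OF monomial \<open>monomial n m\<close>]])
  qed (use monomial in \<open>auto simp: r_distr r_minus monomial_carrier monomial_span_carrier intro: monomial_span.intros\<close>)
qed (use y in \<open>auto simp: l_distr l_minus monomial_span_carrier intro: monomial_span.intros\<close>)

lemma monomial_span_component: "x \<in> monomial_span \<Longrightarrow> component A x n \<in> monomial_span"
proof (induction rule: monomial_span.induct)
  case (monomial k m)
  thus ?case using component_homogeneous[OF monomial_grade] by (auto intro: monomial_span.intros)
qed (auto simp: component_simps monomial_span_carrier intro: monomial_span.intros)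

lemma monomial_span_subring: "subring (monomial_span \<inter> grade A 0) (degree_zero A)"
proof -
  interpret Z: cring "degree_zero A" by (rule degree_zero_cring)
  have one: "\<one> \<in> monomial_span"
    using monomial_span.monomial[OF monomial.Teichmueller[OF R.one_closed]] by (simp add: Teichmueller_one)
  show ?thesis
    by (rule Z.subringI)
      (use one monomial_span.neg monomial_span.add monomial_span_mult one_grade neg_grade add_grade
        mult_grade[of _ 0 _ 0] in \<open>auto simp: degree_zero_simps degree_zero_a_inv\<close>)
qed

text \<open>The lift term is 0 for [r], and the property passes to sums because (x + x')^p differs
  from x^p + x'^p by p times an element of the span. Taking the component of degree 0 lets the
  induction run over all of the span.\<close>

lemma monomial_span_lift:
  assumes "x \<in> monomial_span"
  shows "\<exists>y\<in>monomial_span \<inter> grade A 0.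
    Frob A (component A x 0) = component A x 0 [^] p \<oplus> [p] \<cdot> y"
proof -
  let ?T = "monomial_span \<inter> grade A 0"
  let ?P = "\<lambda>x. \<exists>y\<in>?T. Frob A x = x [^] p \<oplus> [p] \<cdot> y"
  note T = monomial_span_subring
  note pow_add = grade_zero_prime_pow_add[OF prime T]
  have C: "z \<in> ?T \<Longrightarrow> z \<in> carrier A" for z using grade_carrier by blast
  have zero: "\<zero> \<in> ?T" using monomial_span.zero by simp
  have add: "z \<oplus> w \<in> ?T" if "z \<in> ?T" "w \<in> ?T" for z w
    using that monomial_span.add add_grade by blast
  have neg: "\<ominus> z \<in> ?T" if "z \<in> ?T" for z
    using that monomial_span.neg neg_grade by blast
  have P_zero: "?P \<zero>" using zero p_pos by (intro bexI[of _ "\<zero>"]) (auto simp: F_simps nat_pow_zero)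
  have P_add: "?P (x \<oplus> x')" if x: "x \<in> ?T" "x' \<in> ?T" and "?P x" "?P x'" for x x'
  proof -
    obtain y y' where y: "y \<in> ?T" "y' \<in> ?T" "Frob A x = x [^] p \<oplus> [p] \<cdot> y"
      "Frob A x' = x' [^] p \<oplus> [p] \<cdot> y'" using \<open>?P x\<close> \<open>?P x'\<close> by blast
    obtain P where P: "P \<in> ?T" "(x \<oplus> x') [^] p = (x [^] p \<oplus> x' [^] p) \<oplus> [p] \<cdot> P"
      using pow_add[OF x] by blast
    have c: "x \<in> carrier A" "x' \<in> carrier A" "y \<in> carrier A" "y' \<in> carrier A" "P \<in> carrier A"
      using C x y P by auto
    define a a' b b' c' where "a = x [^] p" "a' = x' [^] p" "b = [p] \<cdot> y" "b' = [p] \<cdot> y'" "c' = [p] \<cdot> P"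
    note defs = this
    have cc: "a \<in> carrier A" "a' \<in> carrier A" "b \<in> carrier A" "b' \<in> carrier A" "c' \<in> carrier A"
      unfolding defs using c by auto
    have "Frob A (x \<oplus> x') = (a \<oplus> b) \<oplus> (a' \<oplus> b')"
      using c y unfolding defs by (simp add: F_simps)
    also have "\<dots> = ((a \<oplus> a') \<oplus> c') \<oplus> ((b \<oplus> b') \<oplus> (\<ominus> c'))"
      using cc by (simp add: a_ac r_neg r_neg1 r_neg2)
    also have "(b \<oplus> b') \<oplus> (\<ominus> c') = [p] \<cdot> ((y \<oplus> y') \<oplus> (\<ominus> P))"
      unfolding defs using c by (simp add: nat_mult_simps)
    finally show ?thesis unfolding defs P(2)[symmetric] using add[OF add[OF y(1,2)] neg[OF P(1)]] by blast
  qed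
  have P_neg: "?P (\<ominus> x)" if x: "x \<in> ?T" and "?P x" for x
  proof -
    obtain y where y: "y \<in> ?T" "Frob A x = x [^] p \<oplus> [p] \<cdot> y" using \<open>?P x\<close> by blast
    \<comment> \<open>Expanding 0 = (x + (-x))^p relates (-x)^p to x^p uniformly in p, without a
      separate case p = 2.\<close>
    obtain P where P: "P \<in> ?T" "(x \<oplus> \<ominus> x) [^] p = (x [^] p \<oplus> (\<ominus> x) [^] p) \<oplus> [p] \<cdot> P"
      using pow_add[OF x neg[OF x]] by blast
    have c: "x \<in> carrier A" "y \<in> carrier A" "P \<in> carrier A" using C x y P by auto
    define a a' b c' where "a = x [^] p" "a' = (\<ominus> x) [^] p" "b = [p] \<cdot> y" "c' = [p] \<cdot> P"
    note defs = this
    have cc: "a \<in> carrier A" "a' \<in> carrier A" "b \<in> carrier A" "c' \<in> carrier A"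
      unfolding defs using c by auto
    have z: "(a \<oplus> a') \<oplus> c' = \<zero>"
      using P(2) c p_pos unfolding defs by (simp add: r_neg nat_pow_zero)
    have "Frob A (\<ominus> x) = \<ominus> (a \<oplus> b)" using c y unfolding defs by (simp add: F_simps)
    also have "\<dots> = ((a \<oplus> a') \<oplus> c') \<oplus> (\<ominus> (a \<oplus> b))" unfolding z using cc by simp
    also have "\<dots> = (a \<oplus> (\<ominus> a)) \<oplus> (a' \<oplus> (c' \<oplus> (\<ominus> b)))"
      using cc by (simp add: minus_add a_ac)
    also have "\<dots> = a' \<oplus> (c' \<oplus> (\<ominus> b))"
      using cc by (simp add: r_neg)
    also have "c' \<oplus> (\<ominus> b) = [p] \<cdot> (P \<oplus> (\<ominus> y))"
      unfolding defs using c by (simp add: nat_mult_simps)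
    finally show ?thesis unfolding defs using add[OF P(1) neg[OF y(1)]] by blast
  qed
  have comp: "component A x 0 \<in> ?T" if "x \<in> monomial_span" for x
    using that monomial_span_component monomial_span_carrier component_grade by blast
  show ?thesis using assms
  proof (induction rule: monomial_span.induct)
    case zero
    show ?case using P_zero by simp
  next
    case (monomial n m)
    show ?case
    proof (cases "n = 0")
      case True
      with monomial obtain r where r: "r \<in> carrier R" "m = \<tau> r" by (auto elim: monomial.cases)
      have "component A m 0 = m" using component_homogeneous[OF monomial_grade[OF monomial]] True by simp
      thus ?thesis using r zero F_Teichmueller[OF r(1)] Teichmueller_carrier[OF r(1)]
        by (intro bexI[of _ "\<zero>"]) auto
    next
      case False
      hence "component A m 0 = \<zero>" using component_homogeneous[OF monomial_grade[OF monomial]] by simp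
      thus ?thesis using P_zero by simp
    qed
  next
    case (add x y)
    thus ?case using P_add[OF comp comp] by (simp add: component_add monomial_span_carrier)
  next
    case (neg x)
    thus ?case using P_neg[OF comp] by (simp add: component_simps monomial_span_carrier)
  qed
qed

lemma monomial_span_subalgebra: "dieudonne_subalgebra p A monomial_span"
proof
  show "monomial_span \<subseteq> carrier A" using monomial_span_carrier by blast
  show "\<one> \<in> monomial_span"
    using monomial_span.monomial[OF monomial.Teichmueller[OF R.one_closed]] by (simp add: Teichmueller_one)
  show "x \<oplus> y \<in> monomial_span" if "x \<in> monomial_span" "y \<in> monomial_span" for x y
    using that by (rule monomial_span.add)
  show "\<ominus> x \<in> monomial_span" if "x \<in> monomial_span" for x
    using that by (rule monomial_span.neg)
  show "x \<otimes> y \<in> monomial_span" if "x \<in> monomial_span" "y \<in> monomial_span" for x y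
    using that by (rule monomial_span_mult)
  show "component A x n \<in> monomial_span" if "x \<in> monomial_span" for x n
    using that by (rule monomial_span_component)
  show "Frob A x \<in> monomial_span" if "x \<in> monomial_span" for x
    using that by (induction rule: monomial_span.induct)
      (auto simp: F_simps monomial_span_carrier intro: monomial_span.intros monomial_F)
  show "differential A x \<in> monomial_span" if "x \<in> monomial_span" for x
    using that by (induction rule: monomial_span.induct)
      (auto simp: d_simps monomial_span_carrier intro: monomial_span.intros monomial_d)
  show "\<exists>y\<in>monomial_span \<inter> grade A 0. Frob A x = x [^] p \<oplus> [p] \<cdot> y"
    if "x \<in> monomial_span" "x \<in> grade A 0" for x
    using monomial_span_lift[OF that(1)] component_homogeneous[OF that(2)] by simp
qed

lemma monomial_span_bounded:
  assumes "\<And>n m. int n > D \<Longrightarrow> monomial n m \<Longrightarrow> m \<in> Fil 1"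
  shows "bounded_subalgebra D monomial_span"
proof -
  have "component A x n \<in> Fil 1" if "x \<in> monomial_span" "n > D" for x n
    using that
  proof (induction rule: monomial_span.induct)
    case (monomial k m)
    thus ?case using component_homogeneous[OF monomial_grade[OF monomial(1)]] assms by auto
  qed (auto simp: component_simps monomial_span_carrier Fil_add Fil_neg)
  thus ?thesis
    using monomial_span_subalgebra monomial_span.monomial monomial.Teichmueller
    unfolding bounded_subalgebra_def by blast
qed

end

section \<open>Localization and Kaehler differentials\<close>

locale localization = abelian_group G for G :: "('a, 'm) ring_scheme" (structure) +
  fixes e :: "'a \<Rightarrow> 'a"
  assumes e_hom: "e \<in> hom (add_monoid G) (add_monoid G)"
begin

lemma e_pow_hom: "(e ^^ k) \<in> hom (add_monoid G) (add_monoid G)"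
  using e_hom by (induction k) (auto simp: hom_def Pi_def)

lemmas e_pow_simps = additive_hom[OF abelian_group_axioms abelian_group_axioms e_pow_hom]

lemma e_pow_e_pow: "(e ^^ k) ((e ^^ l) x) = (e ^^ (k + l)) x"
  by (simp add: funpow_add)

lemma e_pow_extend: "(e ^^ k) x = (e ^^ l) y \<Longrightarrow> (e ^^ (n + k)) x = (e ^^ (n + l)) y"
  by (simp add: funpow_add)

lemma loc_rel_iff:
  "((x, k), (y, l)) \<in> loc_rel G e \<longleftrightarrow> x \<in> carrier G \<and> y \<in> carrier G \<and> (\<exists>m. (e ^^ (m + l)) x = (e ^^ (m + k)) y)"
  by (simp add: loc_rel_def)

lemma loc_rel_sym: "(P, Q) \<in> loc_rel G e \<Longrightarrow> (Q, P) \<in> loc_rel G e"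
  by (cases P; cases Q) (auto simp: loc_rel_iff intro: sym)

lemma loc_rel_trans:
  assumes "(P, Q) \<in> loc_rel G e" "(Q, T) \<in> loc_rel G e"
  shows "(P, T) \<in> loc_rel G e"
proof -
  obtain x k y l z j where e: "P = (x, k)" "Q = (y, l)" "T = (z, j)" by (cases P; cases Q; cases T)
  obtain m n where m: "(e ^^ (m + l)) x = (e ^^ (m + k)) y" and n: "(e ^^ (n + j)) y = (e ^^ (n + l)) z"
    using assms unfolding e loc_rel_iff by blast
  have "(e ^^ ((n + j) + (m + l))) x = (e ^^ ((n + j) + (m + k))) y" by (rule e_pow_extend[OF m])
  moreover have "(e ^^ ((m + k) + (n + j))) y = (e ^^ ((m + k) + (n + l))) z" by (rule e_pow_extend[OF n])
  ultimately have "(e ^^ ((n + m + l) + j)) x = (e ^^ ((n + m + l) + k)) z" by (simp add: ac_simps)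
  thus ?thesis using assms unfolding e loc_rel_iff by blast
qed

lemma mem_loc_frac: "P \<in> loc_frac G e x k \<longleftrightarrow> ((x, k), P) \<in> loc_rel G e"
  by (simp add: loc_frac_def)

lemma loc_frac_self: "x \<in> carrier G \<Longrightarrow> (x, k) \<in> loc_frac G e x k"
  by (auto simp: mem_loc_frac loc_rel_iff)

lemma loc_frac_eq_iff:
  assumes "x \<in> carrier G" "y \<in> carrier G"
  shows "loc_frac G e x k = loc_frac G e y l \<longleftrightarrow> (\<exists>m. (e ^^ (m + l)) x = (e ^^ (m + k)) y)"
proof -
  have "loc_frac G e x k = loc_frac G e y l \<longleftrightarrow> ((x, k), (y, l)) \<in> loc_rel G e"
  proof
    assume "loc_frac G e x k = loc_frac G e y l"
    hence "(y, l) \<in> loc_frac G e x k" using loc_frac_self[OF assms(2), of l] by simp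
    thus "((x, k), (y, l)) \<in> loc_rel G e" by (simp add: mem_loc_frac)
  next
    assume *: "((x, k), (y, l)) \<in> loc_rel G e"
    show "loc_frac G e x k = loc_frac G e y l"
      unfolding loc_frac_def using loc_rel_trans[OF *] loc_rel_trans[OF loc_rel_sym[OF *]] by blast
  qed
  thus ?thesis using assms by (simp add: loc_rel_iff)
qed

lemma loc_frac_memD:
  assumes "(y, l) \<in> loc_frac G e x k"
  shows "x \<in> carrier G" "y \<in> carrier G" "loc_frac G e y l = loc_frac G e x k"
proof -
  show c: "x \<in> carrier G" "y \<in> carrier G" using assms by (auto simp: mem_loc_frac loc_rel_iff)
  have "loc_frac G e x k = loc_frac G e y l"
    unfolding loc_frac_eq_iff[OF c] using assms by (simp add: mem_loc_frac loc_rel_iff)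
  thus "loc_frac G e y l = loc_frac G e x k" ..
qed

text \<open>The operation is defined as a union over all representatives. All members of the union
  are the same class, so it collapses to the one given by the chosen pair;
  \<open>loc_map_frac\<close> and \<open>loc_mult_frac\<close> follow the same pattern.\<close>

lemma loc_add_frac:
  assumes x: "x \<in> carrier G" and y: "y \<in> carrier G"
  shows "loc_add G e (loc_frac G e x k) (loc_frac G e y l) = loc_frac G e ((e ^^ l) x \<oplus> (e ^^ k) y) (k + l)"
proof -
  have *: "loc_frac G e ((e ^^ l') x' \<oplus> (e ^^ k') y') (k' + l') = loc_frac G e ((e ^^ l) x \<oplus> (e ^^ k) y) (k + l)"
    if x': "(x', k') \<in> loc_frac G e x k" and y': "(y', l') \<in> loc_frac G e y l" for x' k' y' l'
  proof -
    have c: "x' \<in> carrier G" "y' \<in> carrier G" using loc_frac_memD x' y' by auto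
    obtain m where m: "(e ^^ (m + k')) x = (e ^^ (m + k)) x'" using x' by (auto simp: mem_loc_frac loc_rel_iff)
    obtain n where n: "(e ^^ (n + l')) y = (e ^^ (n + l)) y'" using y' by (auto simp: mem_loc_frac loc_rel_iff)
    \<comment> \<open>Both equations are padded to a common outer exponent, so that they can be
      added.\<close>
    have 1: "(e ^^ ((m + n + k' + l') + l)) x = (e ^^ ((m + n + k + l) + l')) x'"
      using e_pow_extend[OF m, of "n + l' + l"] by (simp add: ac_simps)
    have 2: "(e ^^ ((m + n + k' + l') + k)) y = (e ^^ ((m + n + k + l) + k')) y'"
      using e_pow_extend[OF n, of "m + k' + k"] by (simp add: ac_simps)
    have "(e ^^ (m + n + (k' + l'))) ((e ^^ l) x \<oplus> (e ^^ k) y) =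
        (e ^^ ((m + n + k' + l') + l)) x \<oplus> (e ^^ ((m + n + k' + l') + k)) y"
      using x y by (simp add: e_pow_simps e_pow_e_pow add.assoc)
    also have "\<dots> = (e ^^ (m + n + (k + l))) ((e ^^ l') x' \<oplus> (e ^^ k') y')"
      unfolding 1 2 using c by (simp add: e_pow_simps e_pow_e_pow add.assoc)
    finally have "(e ^^ (m + n + (k + l))) ((e ^^ l') x' \<oplus> (e ^^ k') y') = (e ^^ (m + n + (k' + l'))) ((e ^^ l) x \<oplus> (e ^^ k) y)" ..
    thus ?thesis using x y c by (subst loc_frac_eq_iff) (auto simp: e_pow_simps)
  qed
  have "(\<Union>(x', k')\<in>loc_frac G e x k. \<Union>(y', l')\<in>loc_frac G e y l. loc_frac G e ((e ^^ l') x' \<oplus> (e ^^ k') y') (k' + l')) =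
    (\<Union>P\<in>loc_frac G e x k. \<Union>Q\<in>loc_frac G e y l. loc_frac G e ((e ^^ l) x \<oplus> (e ^^ k) y) (k + l))"
    using * by (intro SUP_cong refl) (auto split: prod.splits)
  also have "\<dots> = loc_frac G e ((e ^^ l) x \<oplus> (e ^^ k) y) (k + l)"
    using loc_frac_self[OF x, of k] loc_frac_self[OF y, of l] by auto
  finally show ?thesis unfolding loc_add_def .
qed

lemma loc_map_frac:
  assumes H: "localization H e'" and f: "\<And>x. x \<in> carrier G \<Longrightarrow> f x \<in> carrier H"
    and fe: "\<And>x. x \<in> carrier G \<Longrightarrow> f (e x) = e' (f x)" and x: "x \<in> carrier G"
  shows "loc_map H e' f (loc_frac G e x k) = loc_frac H e' (f x) k"
proof -
  interpret H: localization H e' by (rule H)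
  have pow: "f ((e ^^ j) y) = (e' ^^ j) (f y)" if "y \<in> carrier G" for j y
    using that by (induction j) (auto simp: fe e_pow_simps)
  have *: "loc_frac H e' (f y) l = loc_frac H e' (f x) k" if y: "(y, l) \<in> loc_frac G e x k" for y l
  proof -
    have c: "y \<in> carrier G" using loc_frac_memD y by auto
    obtain m where "(e ^^ (m + l)) x = (e ^^ (m + k)) y" using y by (auto simp: mem_loc_frac loc_rel_iff)
    hence "(e' ^^ (m + k)) (f y) = (e' ^^ (m + l)) (f x)" using pow c x by metis
    thus ?thesis using H.loc_frac_eq_iff f c x by blast
  qed
  have "(\<Union>(y, l)\<in>loc_frac G e x k. loc_frac H e' (f y) l) = (\<Union>P\<in>loc_frac G e x k. loc_frac H e' (f x) k)"
    using * by (intro SUP_cong refl) (auto split: prod.splits)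
  also have "\<dots> = loc_frac H e' (f x) k" using loc_frac_self[OF x, of k] by auto
  finally show ?thesis unfolding loc_map_def .
qed

lemma loc_mult_frac:
  assumes H: "localization H e'" and f: "\<And>a x. a \<in> carrier G \<Longrightarrow> x \<in> carrier H \<Longrightarrow> f a x \<in> carrier H"
    and fe: "\<And>a x. a \<in> carrier G \<Longrightarrow> x \<in> carrier H \<Longrightarrow> f (e a) x = e' (f a x)"
    and fe': "\<And>a x. a \<in> carrier G \<Longrightarrow> x \<in> carrier H \<Longrightarrow> f a (e' x) = e' (f a x)"
    and a: "a \<in> carrier G" and x: "x \<in> carrier H"
  shows "loc_mult H e' f (loc_frac G e a k) (loc_frac H e' x l) = loc_frac H e' (f a x) (k + l)"
proof -
  interpret H: localization H e' by (rule H)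
  have pow: "f ((e ^^ j) b) y = (e' ^^ j) (f b y)" if "b \<in> carrier G" "y \<in> carrier H" for j b y
    using that by (induction j) (auto simp: fe e_pow_simps)
  have pow': "f b ((e' ^^ j) y) = (e' ^^ j) (f b y)" if "b \<in> carrier G" "y \<in> carrier H" for j b y
    using that by (induction j) (auto simp: fe' H.e_pow_simps)
  have *: "loc_frac H e' (f b y) (k' + l') = loc_frac H e' (f a x) (k + l)"
    if b: "(b, k') \<in> loc_frac G e a k" and y: "(y, l') \<in> loc_frac H e' x l" for b y k' l'
  proof -
    have c: "b \<in> carrier G" "y \<in> carrier H" using loc_frac_memD b H.loc_frac_memD y by auto
    obtain m where m: "(e ^^ (m + k')) a = (e ^^ (m + k)) b" using b by (auto simp: mem_loc_frac loc_rel_iff)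
    obtain n where n: "(e' ^^ (n + l')) x = (e' ^^ (n + l)) y" using y by (auto simp: H.mem_loc_frac H.loc_rel_iff)
    have "(e' ^^ (m + k')) ((e' ^^ (n + l')) (f a x)) = f ((e ^^ (m + k')) a) ((e' ^^ (n + l')) x)"
      using a x by (simp add: pow pow' e_pow_simps H.e_pow_simps H.e_pow_e_pow ac_simps)
    also have "\<dots> = (e' ^^ (m + k)) ((e' ^^ (n + l)) (f b y))"
      unfolding m n using c by (simp add: pow pow' e_pow_simps H.e_pow_simps H.e_pow_e_pow ac_simps)
    finally have "(e' ^^ ((m + n) + (k + l))) (f b y) = (e' ^^ ((m + n) + (k' + l'))) (f a x)"
      by (simp add: H.e_pow_e_pow ac_simps)
    thus ?thesis using H.loc_frac_eq_iff[OF f[OF c] f[OF a x]] by blast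
  qed
  have "(\<Union>(b, k')\<in>loc_frac G e a k. \<Union>(y, l')\<in>loc_frac H e' x l. loc_frac H e' (f b y) (k' + l')) =
    (\<Union>P\<in>loc_frac G e a k. \<Union>Q\<in>loc_frac H e' x l. loc_frac H e' (f a x) (k + l))"
    using * by (intro SUP_cong refl) (auto split: prod.splits)
  also have "\<dots> = loc_frac H e' (f a x) (k + l)"
    using loc_frac_self[OF a, of k] H.loc_frac_self[OF x, of l] by auto
  finally show ?thesis unfolding loc_mult_def .
qed

lemma loc_frac_shift: "x \<in> carrier G \<Longrightarrow> loc_frac G e ((e ^^ j) x) (k + j) = loc_frac G e x k"
  by (subst loc_frac_eq_iff) (auto simp: e_pow_simps e_pow_e_pow add.commute intro!: exI[of _ 0])

lemma loc_frac_cong: "x = y \<Longrightarrow> k = l \<Longrightarrow> loc_frac G e x k = loc_frac G e y l"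
  by simp

text \<open>L is any record with these three fields, so that localized modules are covered as well
  as localized rings.\<close>

lemma loc_abelian_group:
  assumes L: "carrier L = loc_set G e (carrier G)" "add L = loc_add G e" "zero L = loc_frac G e \<zero> 0"
  shows "abelian_group L"
    and "x \<in> carrier G \<Longrightarrow> \<ominus>\<^bsub>L\<^esub> loc_frac G e x k = loc_frac G e (\<ominus> x) k"
proof -
  have C: "\<And>P. P \<in> carrier L \<longleftrightarrow> (\<exists>x k. x \<in> carrier G \<and> P = loc_frac G e x k)"
    unfolding L loc_set_def by blast
  have inv: "loc_frac G e (\<ominus> x) k \<oplus>\<^bsub>L\<^esub> loc_frac G e x k = \<zero>\<^bsub>L\<^esub>" if x: "x \<in> carrier G" for x k
  proof -
    have "(e ^^ k) (\<ominus> x) \<oplus> (e ^^ k) x = \<zero>"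
      using x by (simp add: e_pow_simps(1,4) l_neg)
    hence "loc_add G e (loc_frac G e (\<ominus> x) k) (loc_frac G e x k) = loc_frac G e \<zero> (k + k)"
      using x by (simp add: loc_add_frac)
    also have "\<dots> = loc_frac G e \<zero> 0" by (subst loc_frac_eq_iff) (simp_all add: e_pow_simps(3))
    finally show ?thesis unfolding L .
  qed
  show L': "abelian_group L"
  proof (rule abelian_groupI)
    show "P \<oplus>\<^bsub>L\<^esub> Q \<in> carrier L" if PQ: "P \<in> carrier L" "Q \<in> carrier L" for P Q
    proof -
      obtain x k where "x \<in> carrier G" "P = loc_frac G e x k" using PQ(1) C by blast
      moreover obtain y l where "y \<in> carrier G" "Q = loc_frac G e y l" using PQ(2) C by blast
      ultimately have x: "x \<in> carrier G" "P = loc_frac G e x k" "y \<in> carrier G" "Q = loc_frac G e y l" by auto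
      have "P \<oplus>\<^bsub>L\<^esub> Q = loc_frac G e ((e ^^ l) x \<oplus> (e ^^ k) y) (k + l)"
        unfolding L x(2,4) using x by (simp add: loc_add_frac)
      moreover have "(e ^^ l) x \<oplus> (e ^^ k) y \<in> carrier G" using x by (simp add: e_pow_simps)
      ultimately show ?thesis using C by blast
    qed
    show "\<zero>\<^bsub>L\<^esub> \<in> carrier L" unfolding L(3) C using zero_closed by blast
    show "(P \<oplus>\<^bsub>L\<^esub> Q) \<oplus>\<^bsub>L\<^esub> T = P \<oplus>\<^bsub>L\<^esub> (Q \<oplus>\<^bsub>L\<^esub> T)"
      if PQT: "P \<in> carrier L" "Q \<in> carrier L" "T \<in> carrier L" for P Q T
    proof -
      obtain x k where x: "x \<in> carrier G" "P = loc_frac G e x k" using PQT(1) C by blast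
      obtain y l where y: "y \<in> carrier G" "Q = loc_frac G e y l" using PQT(2) C by blast
      obtain z j where z: "z \<in> carrier G" "T = loc_frac G e z j" using PQT(3) C by blast
      have c: "(e ^^ i) x \<in> carrier G" "(e ^^ i) y \<in> carrier G" "(e ^^ i) z \<in> carrier G" for i
        using x y z by (auto intro: e_pow_simps(1))
      have "loc_add G e (loc_add G e P Q) T = loc_frac G e ((e ^^ j) ((e ^^ l) x \<oplus> (e ^^ k) y) \<oplus> (e ^^ (k + l)) z) (k + l + j)"
        unfolding x(2) y(2) z(2) using x y z c by (simp add: loc_add_frac)
      also have "\<dots> = loc_frac G e ((e ^^ (l + j)) x \<oplus> (e ^^ k) ((e ^^ j) y \<oplus> (e ^^ l) z)) (k + (l + j))"
        by (rule loc_frac_cong)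
          (use c x y z in \<open>simp_all add: e_pow_simps(2) e_pow_e_pow a_assoc add.commute\<close>)
      also have "\<dots> = loc_add G e P (loc_add G e Q T)"
        unfolding x(2) y(2) z(2) using x y z c by (simp add: loc_add_frac)
      finally show ?thesis unfolding L .
    qed
    show "P \<oplus>\<^bsub>L\<^esub> Q = Q \<oplus>\<^bsub>L\<^esub> P" if PQ: "P \<in> carrier L" "Q \<in> carrier L" for P Q
    proof -
      obtain x k where x: "x \<in> carrier G" "P = loc_frac G e x k" using PQ(1) C by blast
      obtain y l where y: "y \<in> carrier G" "Q = loc_frac G e y l" using PQ(2) C by blast
      have "(e ^^ l) x \<oplus> (e ^^ k) y = (e ^^ k) y \<oplus> (e ^^ l) x"
        by (rule a_comm[OF e_pow_simps(1)[OF x(1)] e_pow_simps(1)[OF y(1)]])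
      thus ?thesis unfolding L x(2) y(2) using x y by (simp add: loc_add_frac add.commute)
    qed
    show "\<zero>\<^bsub>L\<^esub> \<oplus>\<^bsub>L\<^esub> P = P" if P: "P \<in> carrier L" for P
    proof -
      obtain x k where x: "x \<in> carrier G" "P = loc_frac G e x k" using P C by blast
      show ?thesis unfolding L x(2) using x loc_add_frac[OF zero_closed x(1), of 0 k] by (simp add: e_pow_simps)
    qed
    show "\<exists>Q\<in>carrier L. Q \<oplus>\<^bsub>L\<^esub> P = \<zero>\<^bsub>L\<^esub>" if P: "P \<in> carrier L" for P
    proof -
      obtain x k where x: "x \<in> carrier G" "P = loc_frac G e x k" using P C by blast
      have "loc_frac G e (\<ominus> x) k \<in> carrier L" using C a_inv_closed[OF x(1)] by blast
      thus ?thesis using inv[OF x(1), of k] unfolding x(2) by blast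
    qed
  qed
  interpret L: abelian_group L by (rule L')
  show "\<ominus>\<^bsub>L\<^esub> loc_frac G e x k = loc_frac G e (\<ominus> x) k" if x: "x \<in> carrier G"
  proof (rule L.minus_equality[OF inv[OF x]])
    show "loc_frac G e x k \<in> carrier L" using C x by blast
    show "loc_frac G e (\<ominus> x) k \<in> carrier L" using C a_inv_closed[OF x] by blast
  qed
qed

end

section \<open>Spans, free modules and Kaehler differentials\<close>

lemma mod_span_submodule:
  assumes M: "submodule (carrier M) R M" and X: "X \<subseteq> carrier M"
  shows "submodule (mod_span R M X) R M"
proof -
  have *: "mod_span R M X = \<Inter>{N. submodule N R M \<and> X \<subseteq> N}" by (simp add: mod_span_def)
  have sub: "subgroup N (add_monoid M)" if "submodule N R M" for N using that by (simp add: submodule_def)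
  have Msub: "mod_span R M X \<subseteq> carrier M" unfolding * using M X by blast
  have "subgroup (mod_span R M X) (add_monoid M)"
  proof (rule subgroup.intro)
    show "mod_span R M X \<subseteq> carrier (add_monoid M)" using Msub by simp
    show "x \<otimes>\<^bsub>add_monoid M\<^esub> y \<in> mod_span R M X" if "x \<in> mod_span R M X" "y \<in> mod_span R M X" for x y
      using that subgroup.m_closed[OF sub] unfolding * by blast
    show "\<one>\<^bsub>add_monoid M\<^esub> \<in> mod_span R M X"
      using subgroup.one_closed[OF sub] unfolding * by blast
    show "inv\<^bsub>add_monoid M\<^esub> x \<in> mod_span R M X" if "x \<in> mod_span R M X" for x
      using that subgroup.m_inv_closed[OF sub] unfolding * by blast
  qed
  moreover have "submodule_axioms (mod_span R M X) R M"
    unfolding * by (intro submodule_axioms.intro) (auto intro: submodule.smult_closed)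
  ultimately show ?thesis by (simp add: submodule_def)
qed

lemma mod_span_least: "submodule N R M \<Longrightarrow> X \<subseteq> N \<Longrightarrow> mod_span R M X \<subseteq> N"
  unfolding mod_span_def by blast

context cring
begin

abbreviation "FM \<equiv> free_mod R"

lemma free_mod_simps:
  "zero FM = (\<lambda>_. \<zero>)" "add FM = (\<lambda>b c x. b x \<oplus> c x)" "smult FM = (\<lambda>a c x. a \<otimes> c x)"
  by (simp_all add: free_mod_def)

lemma free_mod_carrier:
  "c \<in> carrier FM \<longleftrightarrow> (\<forall>x\<in>carrier R. c x \<in> carrier R) \<and> (\<forall>x. x \<notin> carrier R \<longrightarrow> c x = \<zero>) \<and> finite {x. c x \<noteq> \<zero>}"
  by (simp add: free_mod_def)

lemma free_mod_value: "c \<in> carrier FM \<Longrightarrow> c x \<in> carrier R"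
  by (cases "x \<in> carrier R") (auto simp: free_mod_carrier)

lemma free_mod_add: "b \<in> carrier FM \<Longrightarrow> c \<in> carrier FM \<Longrightarrow> b \<oplus>\<^bsub>FM\<^esub> c \<in> carrier FM"
proof -
  assume bc: "b \<in> carrier FM" "c \<in> carrier FM"
  have "{x. b x \<oplus> c x \<noteq> \<zero>} \<subseteq> {x. b x \<noteq> \<zero>} \<union> {x. c x \<noteq> \<zero>}" by auto
  moreover have "finite ({x. b x \<noteq> \<zero>} \<union> {x. c x \<noteq> \<zero>})" using bc by (simp add: free_mod_carrier)
  ultimately have "finite {x. b x \<oplus> c x \<noteq> \<zero>}" by (rule finite_subset)
  thus ?thesis using bc by (simp add: free_mod_carrier free_mod_simps)
qed

lemma free_mod_smult: "a \<in> carrier R \<Longrightarrow> c \<in> carrier FM \<Longrightarrow> a \<odot>\<^bsub>FM\<^esub> c \<in> carrier FM"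
proof -
  assume ac: "a \<in> carrier R" "c \<in> carrier FM"
  have "{x. a \<otimes> c x \<noteq> \<zero>} \<subseteq> {x. c x \<noteq> \<zero>}" using ac by auto
  moreover have "finite {x. c x \<noteq> \<zero>}" using ac by (simp add: free_mod_carrier)
  ultimately have "finite {x. a \<otimes> c x \<noteq> \<zero>}" by (rule finite_subset)
  thus ?thesis using ac by (simp add: free_mod_carrier free_mod_simps)
qed

lemma free_mod_neg: "c \<in> carrier FM \<Longrightarrow> (\<lambda>x. \<ominus> c x) \<in> carrier FM"
proof -
  assume c: "c \<in> carrier FM"
  have "{x. \<ominus> c x \<noteq> \<zero>} \<subseteq> {x. c x \<noteq> \<zero>}" by auto
  moreover have "finite {x. c x \<noteq> \<zero>}" using c by (simp add: free_mod_carrier)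
  ultimately have "finite {x. \<ominus> c x \<noteq> \<zero>}" by (rule finite_subset)
  thus ?thesis using c by (simp add: free_mod_carrier)
qed

lemma free_mod_gen: "x \<in> carrier R \<Longrightarrow> free_gen R x \<in> carrier FM"
  by (auto simp: free_mod_carrier free_gen_def)

lemma free_mod_abelian_group: "abelian_group FM"
proof (rule abelian_groupI)
  show "b \<oplus>\<^bsub>FM\<^esub> c \<in> carrier FM" if "b \<in> carrier FM" "c \<in> carrier FM" for b c
    using that by (rule free_mod_add)
  show "\<zero>\<^bsub>FM\<^esub> \<in> carrier FM" by (simp add: free_mod_carrier free_mod_simps)
  show "\<exists>b\<in>carrier FM. b \<oplus>\<^bsub>FM\<^esub> c = \<zero>\<^bsub>FM\<^esub>" if c: "c \<in> carrier FM" for c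
    using free_mod_neg[OF c] free_mod_value[OF c]
    by (intro bexI[of _ "\<lambda>x. \<ominus> c x"]) (auto simp: free_mod_simps l_neg)
qed (auto simp: free_mod_simps fun_eq_iff a_ac free_mod_value)

lemma free_mod_a_inv: "c \<in> carrier FM \<Longrightarrow> \<ominus>\<^bsub>FM\<^esub> c = (\<lambda>x. \<ominus> c x)"
proof -
  interpret FM: abelian_group FM by (rule free_mod_abelian_group)
  assume c: "c \<in> carrier FM"
  show ?thesis
    by (rule FM.minus_equality) (use c free_mod_neg free_mod_value in \<open>auto simp: free_mod_simps l_neg\<close>)
qed

lemma free_mod_submodule: "submodule (carrier FM) R FM"
proof -
  interpret FM: abelian_group FM by (rule free_mod_abelian_group)
  have "subgroup (carrier FM) (add_monoid FM)" using FM.a_group group.subgroup_self by fastforce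
  moreover have "submodule_axioms (carrier FM) R FM" by (intro submodule_axioms.intro free_mod_smult)
  ultimately show ?thesis by (simp add: submodule_def)
qed

lemma Kaehler_relations_subset: "Kaehler_relations R \<subseteq> carrier FM"
proof -
  interpret FM: abelian_group FM by (rule free_mod_abelian_group)
  show ?thesis unfolding Kaehler_relations_def using free_mod_gen free_mod_smult by auto
qed

abbreviation "KR \<equiv> mod_span R FM (Kaehler_relations R)"

lemma KR_submodule: "submodule KR R FM"
  by (rule mod_span_submodule[OF free_mod_submodule Kaehler_relations_subset])

lemma KR_subgroup: "additive_subgroup KR FM"
  using KR_submodule by (simp add: submodule_def additive_subgroup_def)

abbreviation kclass :: "('a \<Rightarrow> 'a) \<Rightarrow> ('a \<Rightarrow> 'a) set" where
  "kclass c \<equiv> KR +>\<^bsub>FM\<^esub> c"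

lemma Kaehler_simps:
  "carrier (Kaehler R) = a_rcosets\<^bsub>FM\<^esub> KR" "zero (Kaehler R) = KR" "add (Kaehler R) = set_add FM"
  "smult (Kaehler R) = (\<lambda>a C. \<Union>x\<in>C. KR +>\<^bsub>FM\<^esub> (a \<odot>\<^bsub>FM\<^esub> x))"
  by (simp_all add: Kaehler_def quot_module_def)

lemma kclass_eq_iff: "b \<in> carrier FM \<Longrightarrow> c \<in> carrier FM \<Longrightarrow> kclass b = kclass c \<longleftrightarrow> b \<ominus>\<^bsub>FM\<^esub> c \<in> KR"
  by (rule abelian_group.coset_eq_iff[OF free_mod_abelian_group KR_subgroup])

lemma Kaehler_carrier: "P \<in> carrier (Kaehler R) \<longleftrightarrow> (\<exists>c\<in>carrier FM. P = kclass c)"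
  unfolding Kaehler_simps A_RCOSETS_def' by auto

lemma kclass_carrier: "c \<in> carrier FM \<Longrightarrow> kclass c \<in> carrier (Kaehler R)"
  using Kaehler_carrier by blast

lemma kclass_add: "b \<in> carrier FM \<Longrightarrow> c \<in> carrier FM \<Longrightarrow> kclass b \<oplus>\<^bsub>Kaehler R\<^esub> kclass c = kclass (b \<oplus>\<^bsub>FM\<^esub> c)"
proof -
  interpret K: abelian_subgroup KR FM
    by (rule abelian_subgroupI3[OF KR_subgroup free_mod_abelian_group])
  show "b \<in> carrier FM \<Longrightarrow> c \<in> carrier FM \<Longrightarrow> ?thesis"
    unfolding Kaehler_simps by (rule K.a_rcos_sum)
qed

lemma kclass_zero: "kclass \<zero>\<^bsub>FM\<^esub> = \<zero>\<^bsub>Kaehler R\<^esub>"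
proof -
  interpret FM: abelian_group FM by (rule free_mod_abelian_group)
  show ?thesis unfolding Kaehler_simps using additive_subgroup.a_subset[OF KR_subgroup] by simp
qed

text \<open>Scalar multiplication on the quotient is a union over representatives; as the relations
  are stable under scalars, all its terms agree.\<close>

lemma kclass_smult:
  assumes a: "a \<in> carrier R" and c: "c \<in> carrier FM"
  shows "a \<odot>\<^bsub>Kaehler R\<^esub> kclass c = kclass (a \<odot>\<^bsub>FM\<^esub> c)"
proof -
  interpret FM: abelian_group FM by (rule free_mod_abelian_group)
  interpret K: abelian_subgroup KR FM
    by (rule abelian_subgroupI3[OF KR_subgroup free_mod_abelian_group])
  have *: "kclass (a \<odot>\<^bsub>FM\<^esub> b) = kclass (a \<odot>\<^bsub>FM\<^esub> c)" if b: "b \<in> kclass c" for b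
  proof -
    have bc: "b \<in> carrier FM" using b c K.a_elemrcos_carrier by blast
    have "kclass b = kclass c" using K.a_repr_independence'[OF b c] ..
    hence d: "b \<ominus>\<^bsub>FM\<^esub> c \<in> KR" using kclass_eq_iff[OF bc c] by simp
    have "a \<odot>\<^bsub>FM\<^esub> b \<ominus>\<^bsub>FM\<^esub> a \<odot>\<^bsub>FM\<^esub> c = a \<odot>\<^bsub>FM\<^esub> (b \<ominus>\<^bsub>FM\<^esub> c)"
      using a bc c free_mod_value[OF bc] free_mod_value[OF c] free_mod_smult[OF a c]
      by (simp add: a_minus_def free_mod_a_inv) (simp add: free_mod_simps fun_eq_iff r_distr r_minus)
    hence "a \<odot>\<^bsub>FM\<^esub> b \<ominus>\<^bsub>FM\<^esub> a \<odot>\<^bsub>FM\<^esub> c \<in> KR" using submodule.smult_closed[OF KR_submodule a d] by simp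
    thus ?thesis using kclass_eq_iff free_mod_smult a bc c by blast
  qed
  have "a \<odot>\<^bsub>Kaehler R\<^esub> kclass c = (\<Union>b\<in>kclass c. kclass (a \<odot>\<^bsub>FM\<^esub> c))"
    unfolding Kaehler_simps using * by auto
  thus ?thesis using K.a_rcos_self[OF c] by blast
qed

lemma Kaehler_abelian_group: "abelian_group (Kaehler R)"
proof -
  interpret FM: abelian_group FM by (rule free_mod_abelian_group)
  show ?thesis
  proof (rule abelian_groupI)
    show "\<exists>Q\<in>carrier (Kaehler R). Q \<oplus>\<^bsub>Kaehler R\<^esub> P = \<zero>\<^bsub>Kaehler R\<^esub>" if P: "P \<in> carrier (Kaehler R)" for P
    proof -
      obtain c where c: "c \<in> carrier FM" "P = kclass c" using P Kaehler_carrier by blast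
      have "kclass (\<ominus>\<^bsub>FM\<^esub> c) \<oplus>\<^bsub>Kaehler R\<^esub> P = \<zero>\<^bsub>Kaehler R\<^esub>"
        using c by (simp add: kclass_add FM.l_neg kclass_zero)
      thus ?thesis using kclass_carrier c by blast
    qed
    show "\<zero>\<^bsub>Kaehler R\<^esub> \<in> carrier (Kaehler R)" using kclass_carrier[OF FM.zero_closed] by (simp add: kclass_zero)
    show "\<zero>\<^bsub>Kaehler R\<^esub> \<oplus>\<^bsub>Kaehler R\<^esub> P = P" if "P \<in> carrier (Kaehler R)" for P
      using that unfolding Kaehler_carrier by (auto simp: kclass_add simp flip: kclass_zero)
  qed (auto simp: Kaehler_carrier kclass_add FM.a_ac)
qed

lemma localization_ring: "s \<in> carrier R \<Longrightarrow> localization R (\<lambda>x. s \<otimes> x)"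
  by (intro localization.intro localization_axioms.intro) (auto simp: hom_def r_distr abelian_group_axioms)

lemma Kaehler_smult_closed: "a \<in> carrier R \<Longrightarrow> P \<in> carrier (Kaehler R) \<Longrightarrow> a \<odot>\<^bsub>Kaehler R\<^esub> P \<in> carrier (Kaehler R)"
  using free_mod_smult by (auto simp: Kaehler_carrier kclass_smult)

lemma Kaehler_smult_add:
  assumes "a \<in> carrier R" "P \<in> carrier (Kaehler R)" "Q \<in> carrier (Kaehler R)"
  shows "a \<odot>\<^bsub>Kaehler R\<^esub> (P \<oplus>\<^bsub>Kaehler R\<^esub> Q) = a \<odot>\<^bsub>Kaehler R\<^esub> P \<oplus>\<^bsub>Kaehler R\<^esub> a \<odot>\<^bsub>Kaehler R\<^esub> Q"
proof -
  obtain b c where bc: "b \<in> carrier FM" "c \<in> carrier FM" "P = kclass b" "Q = kclass c"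
    using assms Kaehler_carrier by meson
  have "a \<odot>\<^bsub>FM\<^esub> (b \<oplus>\<^bsub>FM\<^esub> c) = a \<odot>\<^bsub>FM\<^esub> b \<oplus>\<^bsub>FM\<^esub> a \<odot>\<^bsub>FM\<^esub> c"
    using assms(1) free_mod_value bc by (simp add: free_mod_simps fun_eq_iff r_distr)
  thus ?thesis unfolding bc(3,4) using assms(1) bc free_mod_add free_mod_smult by (simp add: kclass_add kclass_smult)
qed

lemma Kaehler_smult_smult:
  assumes "a \<in> carrier R" "b \<in> carrier R" "P \<in> carrier (Kaehler R)"
  shows "a \<odot>\<^bsub>Kaehler R\<^esub> (b \<odot>\<^bsub>Kaehler R\<^esub> P) = (a \<otimes> b) \<odot>\<^bsub>Kaehler R\<^esub> P"
proof -
  obtain c where c: "c \<in> carrier FM" "P = kclass c" using assms Kaehler_carrier by meson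
  have "a \<odot>\<^bsub>FM\<^esub> (b \<odot>\<^bsub>FM\<^esub> c) = (a \<otimes> b) \<odot>\<^bsub>FM\<^esub> c"
    using assms free_mod_value c by (simp add: free_mod_simps fun_eq_iff m_assoc)
  thus ?thesis unfolding c(2) using assms c free_mod_smult by (simp add: kclass_smult)
qed

lemma localization_Kaehler: "s \<in> carrier R \<Longrightarrow> localization (Kaehler R) (\<lambda>x. s \<odot>\<^bsub>Kaehler R\<^esub> x)"
  by (intro localization.intro localization_axioms.intro Kaehler_abelian_group)
    (auto simp: hom_def Kaehler_smult_add Kaehler_smult_closed)

lemma kclass_smult_pow:
  assumes s: "s \<in> carrier R" and c: "c \<in> carrier FM"
  shows "((\<lambda>x. s \<odot>\<^bsub>Kaehler R\<^esub> x) ^^ k) (kclass c) = kclass ((s [^] k) \<odot>\<^bsub>FM\<^esub> c)"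
proof (induction k)
  case 0
  have "\<one> \<odot>\<^bsub>FM\<^esub> c = c" using free_mod_value[OF c] by (simp add: free_mod_simps)
  thus ?case by simp
next
  case (Suc k)
  have "s \<odot>\<^bsub>FM\<^esub> ((s [^] k) \<odot>\<^bsub>FM\<^esub> c) = (s [^] Suc k) \<odot>\<^bsub>FM\<^esub> c"
    using s free_mod_value[OF c] by (simp add: free_mod_simps fun_eq_iff m_ac)
  thus ?case using Suc s c free_mod_smult by (simp add: kclass_smult)
qed

end

section \<open>Alternating products over finitely generated modules\<close>

text \<open>An ideal maximal among those avoiding 1 is a maximal ideal, hence prime. It provides the
  point of Spec(R) at which the local hypothesis is applied.\<close>

lemma (in cring) primeideal_above:
  assumes I: "ideal I R" "\<one> \<notin> I"
  shows "\<exists>P. primeideal P R \<and> I \<subseteq> P"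
proof -
  let ?F = "{J. ideal J R \<and> I \<subseteq> J \<and> \<one> \<notin> J}"
  have "\<exists>M\<in>?F. \<forall>X\<in>?F. M \<subseteq> X \<longrightarrow> X = M"
  proof (rule subset_Zorn_nonempty)
    show "?F \<noteq> {}" using I by blast
    fix C assume C: "C \<noteq> {}" "subset.chain ?F C"
    have C': "C \<subseteq> ?F" using C(2) unfolding subset.chain_def by blast
    have id: "ideal J R" if "J \<in> C" for J using C' that by blast
    have sub: "subgroup J (add_monoid R)" if "J \<in> C" for J
      using id[OF that] by (simp add: ideal_def additive_subgroup_def)
    obtain J0 where J0: "J0 \<in> C" using C(1) by blast
    have idC: "ideal (\<Union>C) R"
    proof (rule idealI[OF ring_axioms])
      show "subgroup (\<Union>C) (add_monoid R)"
      proof (rule subgroup.intro)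
        show "\<Union>C \<subseteq> carrier (add_monoid R)" using subgroup.subset[OF sub] by blast
        show "\<one>\<^bsub>add_monoid R\<^esub> \<in> \<Union>C" using subgroup.one_closed[OF sub[OF J0]] J0 by blast
        show "inv\<^bsub>add_monoid R\<^esub> x \<in> \<Union>C" if "x \<in> \<Union>C" for x
          using that subgroup.m_inv_closed[OF sub] by blast
        show "x \<otimes>\<^bsub>add_monoid R\<^esub> y \<in> \<Union>C" if xy: "x \<in> \<Union>C" "y \<in> \<Union>C" for x y
        proof -
          obtain S T where ST: "S \<in> C" "T \<in> C" "x \<in> S" "y \<in> T" using xy by blast
          hence "S \<subseteq> T \<or> T \<subseteq> S" using C(2) unfolding subset_chain_def by blast
          thus ?thesis using ST subgroup.m_closed[OF sub] by blast
        qed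
      qed
      show "x \<otimes> a \<in> \<Union>C" if a: "a \<in> \<Union>C" and x: "x \<in> carrier R" for a x
      proof -
        obtain J where J: "J \<in> C" "a \<in> J" using a by blast
        thus ?thesis using ideal.I_l_closed[OF id[OF J(1)] J(2) x] by blast
      qed
      show "a \<otimes> x \<in> \<Union>C" if a: "a \<in> \<Union>C" and x: "x \<in> carrier R" for a x
      proof -
        obtain J where J: "J \<in> C" "a \<in> J" using a by blast
        thus ?thesis using ideal.I_r_closed[OF id[OF J(1)] J(2) x] by blast
      qed
    qed
    have F: "I \<subseteq> J \<and> \<one> \<notin> J" if "J \<in> C" for J
      using C' that by blast
    have "I \<subseteq> \<Union>C" "\<one> \<notin> \<Union>C" using F J0 by blast+
    thus "\<Union>C \<in> ?F" using idC by blast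
  qed
  then obtain M where MF: "M \<in> ?F" and maxF: "\<forall>X\<in>?F. M \<subseteq> X \<longrightarrow> X = M" by (rule bexE)
  have M: "ideal M R" "I \<subseteq> M" "\<one> \<notin> M" using MF by auto
  have max: "X = M" if X: "ideal X R" "\<one> \<notin> X" "M \<subseteq> X" for X
  proof -
    have "X \<in> ?F" using X M(2) by blast
    thus ?thesis using maxF X(3) by simp
  qed
  have "maximalideal M R"
  proof (rule maximalidealI[OF M(1)])
    show "carrier R \<noteq> M" using M(3) by blast
    show "J = M \<or> J = carrier R" if "ideal J R" "M \<subseteq> J" "J \<subseteq> carrier R" for J
      using max[OF that(1) _ that(2)] ideal.one_imp_carrier[OF that(1)] by blast
  qed
  thus ?thesis using maximalideal_prime M(2) by blast
qed

context strict_dieudonne_algebra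
begin

text \<open>Starting from Fil^1 makes this the preimage in A^1 of the A^0-submodule generated by E
  in degree 1 of A/Fil^1.\<close>

inductive_set lspan :: "'a set \<Rightarrow> 'a set" for E where
  base: "x \<in> Fil 1 \<Longrightarrow> x \<in> grade A 1 \<Longrightarrow> x \<in> lspan E"
| step: "y \<in> lspan E \<Longrightarrow> a \<in> grade A 0 \<Longrightarrow> \<eta> \<in> E \<Longrightarrow> y \<oplus> a \<otimes> \<eta> \<in> lspan E"

text \<open>Stands in for the n-th exterior power: sums of n-fold products of elements of
  \<open>lspan E\<close>, with a coefficient from A^0 in front.\<close>

inductive gspan :: "'a set \<Rightarrow> nat \<Rightarrow> 'a \<Rightarrow> bool" for E where
  zero: "a \<in> grade A 0 \<Longrightarrow> gspan E 0 a"
| Suc: "gspan E n g \<Longrightarrow> y \<in> lspan E \<Longrightarrow> gspan E (Suc n) (g \<otimes> y)"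
| add: "gspan E n g \<Longrightarrow> gspan E n h \<Longrightarrow> gspan E n (g \<oplus> h)"

lemma grade_smult: "a \<in> grade A 0 \<Longrightarrow> x \<in> grade A n \<Longrightarrow> a \<otimes> x \<in> grade A n"
  using mult_grade[of a 0 x n] by simp

context
  fixes E :: "'a set"
  assumes E: "E \<subseteq> grade A 1"
begin

lemma lspan_grade: "x \<in> lspan E \<Longrightarrow> x \<in> grade A 1"
  by (induction rule: lspan.induct) (use E grade_smult add_grade in auto)

lemma lspan_carrier: "x \<in> lspan E \<Longrightarrow> x \<in> carrier A"
  using lspan_grade grade_carrier by blast

lemma lspan_add: "y \<in> lspan E \<Longrightarrow> x \<in> lspan E \<Longrightarrow> x \<oplus> y \<in> lspan E"
proof (induction rule: lspan.induct)
  case (base z)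
  show ?case using base(3)
  proof (induction rule: lspan.induct)
    case (base w)
    thus ?case using \<open>z \<in> Fil 1\<close> \<open>z \<in> grade A 1\<close> by (intro lspan.base Fil_add add_grade)
  next
    case (step w a \<eta>)
    have "(w \<oplus> a \<otimes> \<eta>) \<oplus> z = (w \<oplus> z) \<oplus> a \<otimes> \<eta>"
    proof -
      have "\<eta> \<in> carrier A" using E step(3) grade_carrier by blast
      thus ?thesis using grade_carrier[OF \<open>z \<in> grade A 1\<close>] lspan_carrier[OF step(1)] grade_carrier[OF step(2)]
        by (simp add: a_ac)
    qed
    thus ?case using lspan.step[OF step(4) step(2,3)] by simp
  qed
next
  case (step y a \<eta>)
  have "x \<oplus> (y \<oplus> a \<otimes> \<eta>) = (x \<oplus> y) \<oplus> a \<otimes> \<eta>"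
  proof -
    have "\<eta> \<in> carrier A" using E step(3) grade_carrier by blast
    thus ?thesis using lspan_carrier[OF step(1)] lspan_carrier[OF step(5)] grade_carrier[OF step(2)]
      by (simp add: a_assoc)
  qed
  thus ?case using lspan.step[OF step(4)[OF step(5)] step(2,3)] by simp
qed

lemma lspan_smult:
  assumes b: "b \<in> grade A 0"
  shows "x \<in> lspan E \<Longrightarrow> b \<otimes> x \<in> lspan E"
proof (induction rule: lspan.induct)
  case (base x)
  thus ?case using b grade_carrier by (intro lspan.base Fil_mult_left grade_smult) auto
next
  case (step y a \<eta>)
  have "b \<otimes> (y \<oplus> a \<otimes> \<eta>) = b \<otimes> y \<oplus> (b \<otimes> a) \<otimes> \<eta>"
  proof -
    have "\<eta> \<in> carrier A" using E step(3) grade_carrier by blast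
    thus ?thesis using grade_carrier[OF b] lspan_carrier[OF step(1)] grade_carrier[OF step(2)]
      by (simp add: r_distr m_assoc)
  qed
  thus ?case using lspan.step[OF step(4) grade_smult[OF b step(2)] step(3)] by simp
qed

lemma lspan_gen:
  assumes "\<eta> \<in> E" shows "\<eta> \<in> lspan E"
proof -
  have "\<zero> \<oplus> \<one> \<otimes> \<eta> \<in> lspan E" by (intro lspan.step lspan.base one_grade assms) simp_all
  moreover have "\<eta> \<in> carrier A" using assms E grade_carrier by blast
  ultimately show ?thesis by simp
qed

text \<open>Identities modulo Fil^1 are enough, as they must be: sums of Teichmueller elements are
  only controlled up to such terms.\<close>

lemma lspan_if_minus_Fil:
  assumes "x \<in> grade A 1" "y \<in> lspan E" "x \<ominus> y \<in> Fil 1"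
  shows "x \<in> lspan E"
proof -
  have "x \<ominus> y \<in> lspan E"
    by (rule lspan.base[OF assms(3) minus_grade[OF assms(1) lspan_grade[OF assms(2)]]])
  hence "y \<oplus> (x \<ominus> y) \<in> lspan E" by (rule lspan_add[OF _ assms(2)])
  thus ?thesis using add_minus_cancel(1)[of x y] assms lspan_carrier grade_carrier by simp
qed

lemma gspan_grade: "gspan E n x \<Longrightarrow> x \<in> grade A (int n)"
proof (induction rule: gspan.induct)
  case (Suc n g y)
  thus ?case using mult_grade[OF Suc.IH lspan_grade] by (simp add: add.commute)
qed (auto intro: add_grade)

lemma gspan_carrier: "gspan E n x \<Longrightarrow> x \<in> carrier A"
  using gspan_grade grade_carrier by blast

lemma gspan_smult:
  assumes a: "a \<in> grade A 0"
  shows "gspan E n x \<Longrightarrow> gspan E n (x \<otimes> a)"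
proof (induction rule: gspan.induct)
  case (zero b)
  thus ?case using a grade_smult by (intro gspan.zero)
next
  case (Suc n g y)
  have "g \<otimes> y \<otimes> a = g \<otimes> (a \<otimes> y)"
    using grade_zero_comm[OF a lspan_carrier[OF Suc(2)]] grade_carrier[OF a] gspan_carrier[OF Suc(1)] lspan_carrier[OF Suc(2)]
    by (simp add: m_assoc)
  thus ?case using gspan.Suc[OF Suc(1) lspan_smult[OF a Suc(2)]] by simp
next
  case (add n g h)
  thus ?case using gspan.add[OF add.IH] grade_carrier[OF a] gspan_carrier by (simp add: l_distr)
qed

lemma gspan_neg: "gspan E n x \<Longrightarrow> gspan E n (\<ominus> x)"
  using gspan_smult[OF neg_grade[OF one_grade], of n x] gspan_carrier by (simp add: r_minus)

end

lemma lspan_insert: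
  assumes E: "insert \<eta> E \<subseteq> grade A 1"
  shows "x \<in> lspan (insert \<eta> E) \<Longrightarrow> \<exists>z\<in>lspan E. \<exists>a\<in>grade A 0. x = z \<oplus> a \<otimes> \<eta>"
proof (induction rule: lspan.induct)
  case (base x)
  thus ?case using E grade_carrier by (intro bexI[of _ x] bexI[of _ \<zero>] lspan.base) auto
next
  case (step y b \<xi>)
  have E': "E \<subseteq> grade A 1" and \<eta>: "\<eta> \<in> carrier A" using E grade_carrier by auto
  obtain z a where z: "z \<in> lspan E" "a \<in> grade A 0" "y = z \<oplus> a \<otimes> \<eta>" using step.IH by blast
  have c: "z \<in> carrier A" "a \<in> carrier A" "b \<in> carrier A" "\<xi> \<in> carrier A"
    using lspan_carrier[OF E' z(1)] z(2) step(2,3) E grade_carrier by auto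
  show ?case
  proof (cases "\<xi> = \<eta>")
    case True
    have "y \<oplus> b \<otimes> \<xi> = z \<oplus> (a \<oplus> b) \<otimes> \<eta>" unfolding z(3) True using c \<eta> by (simp add: l_distr a_assoc)
    thus ?thesis using z add_grade[OF z(2) step(2)] by blast
  next
    case False
    have "y \<oplus> b \<otimes> \<xi> = (z \<oplus> b \<otimes> \<xi>) \<oplus> a \<otimes> \<eta>" unfolding z(3) using c \<eta> by (simp add: a_ac)
    thus ?thesis using z lspan.step[OF z(1) step(2)] False step(3) by blast
  qed
qed

text \<open>One generator is split off as in an exterior algebra: a product of degree m + 1 is g +
  h\<open>\<eta>\<close> with g and h built from E alone. Moving \<open>\<eta>\<close> to the right
  costs a sign, and \<open>\<eta>\<close> a \<open>\<eta>\<close> = a \<open>\<eta>\<close>^2 =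
  0.\<close>

lemma gspan_insert:
  assumes E: "insert \<eta> E \<subseteq> grade A 1"
  shows "gspan (insert \<eta> E) n x \<Longrightarrow> (n = 0 \<longrightarrow> gspan E 0 x) \<and>
    (\<forall>m. n = Suc m \<longrightarrow> (\<exists>g h. gspan E (Suc m) g \<and> gspan E m h \<and> x = g \<oplus> h \<otimes> \<eta>))"
proof (induction rule: gspan.induct)
  case (zero a)
  thus ?case by (simp add: gspan.zero)
next
  case (Suc n x y)
  have E': "E \<subseteq> grade A 1" and \<eta>: "\<eta> \<in> grade A 1" "\<eta> \<in> carrier A" using E grade_carrier by auto
  note gc = gspan_carrier[OF E']
  obtain z a where z: "z \<in> lspan E" "a \<in> grade A 0" "y = z \<oplus> a \<otimes> \<eta>" using lspan_insert[OF E Suc(2)] by blast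
  have c: "z \<in> carrier A" "a \<in> carrier A" using lspan_carrier[OF E' z(1)] z(2) grade_carrier by auto
  have "\<exists>g h. gspan E (Suc n) g \<and> gspan E n h \<and> x \<otimes> y = g \<oplus> h \<otimes> \<eta>"
  proof (cases n)
    case 0
    hence x: "gspan E 0 x" using Suc.IH by blast
    have "x \<otimes> y = x \<otimes> z \<oplus> (x \<otimes> a) \<otimes> \<eta>" unfolding z(3) using c \<eta> gc[OF x] by (simp add: r_distr m_assoc)
    thus ?thesis using gspan.Suc[OF x z(1)] gspan_smult[OF E' z(2) x] 0 by blast
  next
    case (Suc m)
    then obtain g h where gh: "gspan E (Suc m) g" "gspan E m h" "x = g \<oplus> h \<otimes> \<eta>" using Suc.IH by blast
    note cc = c \<eta>(2) gc[OF gh(1)] gc[OF gh(2)]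
    have "z \<otimes> \<eta> = \<ominus> (\<eta> \<otimes> z)" using graded_comm[OF lspan_grade[OF E' z(1)] \<eta>(1)] by simp
    hence \<eta>z: "\<eta> \<otimes> z = \<ominus> (z \<otimes> \<eta>)" using cc by simp
    have "\<eta> \<otimes> (a \<otimes> \<eta>) = a \<otimes> (\<eta> \<otimes> \<eta>)"
      using grade_zero_comm[OF z(2) \<eta>(2)] cc by (metis m_assoc)
    hence \<eta>\<eta>: "\<eta> \<otimes> (a \<otimes> \<eta>) = \<zero>" using odd_square[of 1 \<eta>] \<eta>(1) cc by simp
    have "x \<otimes> y = (g \<otimes> z \<oplus> (g \<otimes> a) \<otimes> \<eta>) \<oplus> (h \<otimes> (\<eta> \<otimes> z) \<oplus> h \<otimes> (\<eta> \<otimes> (a \<otimes> \<eta>)))"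
      unfolding gh(3) z(3) using cc by (simp add: l_distr r_distr m_assoc a_ac)
    also have "\<dots> = g \<otimes> z \<oplus> (g \<otimes> a \<oplus> \<ominus> (h \<otimes> z)) \<otimes> \<eta>"
      unfolding \<eta>z \<eta>\<eta> using cc by (simp add: l_distr r_minus l_minus m_assoc a_assoc)
    finally have "x \<otimes> y = g \<otimes> z \<oplus> (g \<otimes> a \<oplus> \<ominus> (h \<otimes> z)) \<otimes> \<eta>" .
    moreover have "gspan E (Suc m) (g \<otimes> a \<oplus> \<ominus> (h \<otimes> z))"
      by (intro gspan.add gspan_smult[OF E' z(2) gh(1)] gspan_neg[OF E'] gspan.Suc gh(2) z(1))
    ultimately show ?thesis using gspan.Suc[OF gh(1) z(1)] Suc by blast
  qed
  thus ?case by blast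
next
  case (add n x y)
  have E': "E \<subseteq> grade A 1" and \<eta>: "\<eta> \<in> carrier A" using E grade_carrier by auto
  note gc = gspan_carrier[OF E']
  have "\<exists>g h. gspan E (Suc m) g \<and> gspan E m h \<and> x \<oplus> y = g \<oplus> h \<otimes> \<eta>" if n: "n = Suc m" for m
  proof -
    obtain g h where gh: "gspan E (Suc m) g" "gspan E m h" "x = g \<oplus> h \<otimes> \<eta>" using add.IH(1) n by blast
    obtain g' h' where gh': "gspan E (Suc m) g'" "gspan E m h'" "y = g' \<oplus> h' \<otimes> \<eta>" using add.IH(2) n by blast
    have "x \<oplus> y = (g \<oplus> g') \<oplus> (h \<oplus> h') \<otimes> \<eta>"
      unfolding gh(3) gh'(3) using \<eta> gc[OF gh(1)] gc[OF gh(2)] gc[OF gh'(1)] gc[OF gh'(2)]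
      by (simp add: l_distr a_ac)
    thus ?thesis using gspan.add gh gh' by blast
  qed
  thus ?case using add.IH gspan.add by blast
qed

text \<open>Exterior powers beyond the number of generators vanish modulo Fil^1. When
  \<open>\<eta>\<close> is split off, g keeps the degree with one generator fewer, and h loses one
  of each, so the strict inequality persists for both.\<close>

lemma gspan_in_Fil:
  assumes "finite E" "E \<subseteq> grade A 1" "gspan E n x" "card E < n"
  shows "x \<in> Fil 1"
  using assms
proof (induction E arbitrary: n x rule: finite_induct)
  case empty
  \<comment> \<open>Without generators only the starting case of \<open>lspan\<close> is left, so a
    product with at least one factor is in Fil^1.\<close>
  have "y \<in> Fil 1" if "y \<in> lspan {}" for y using that by (induction rule: lspan.induct) auto
  note lspan_empty = this
  have "y \<in> Fil 1" if "gspan {} k y" "k > 0" for k y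
    using that
  proof (induction rule: gspan.induct)
    case (Suc k g y)
    thus ?case using Fil_mult_left[OF lspan_empty gspan_carrier[of "{}"]] by blast
  qed (auto intro: Fil_add)
  thus ?case using empty by simp
next
  case (insert \<eta> E)
  then obtain m where m: "n = Suc m" by (cases n) auto
  obtain g h where gh: "gspan E (Suc m) g" "gspan E m h" "x = g \<oplus> h \<otimes> \<eta>"
    using gspan_insert[OF insert.prems(1,2)] m by blast
  have "g \<in> Fil 1" "h \<in> Fil 1" using insert.IH[OF _ gh(1)] insert.IH[OF _ gh(2)] insert.prems insert.hyps m by auto
  thus ?case unfolding gh(3) using insert.prems(1) grade_carrier by (intro Fil_add Fil_mult_right) auto
qed

end

context strict_dieudonne_algebra
begin

lemma finsum_minus_Fil:
  assumes "finite X" "\<And>x. x \<in> X \<Longrightarrow> f x \<in> carrier A" "\<And>x. x \<in> X \<Longrightarrow> g x \<in> carrier A"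
    and "\<And>x. x \<in> X \<Longrightarrow> f x \<ominus> g x \<in> Fil r"
  shows "(\<Oplus>x\<in>X. f x) \<ominus> (\<Oplus>x\<in>X. g x) \<in> Fil r"
  using assms
proof (induction X rule: finite_induct)
  case empty
  thus ?case by (simp add: minus_eq r_neg)
next
  case (insert x X)
  have c: "f \<in> X \<rightarrow> carrier A" "g \<in> X \<rightarrow> carrier A" using insert.prems by auto
  have "(\<Oplus>x\<in>insert x X. f x) \<ominus> (\<Oplus>x\<in>insert x X. g x) = (f x \<ominus> g x) \<oplus> ((\<Oplus>x\<in>X. f x) \<ominus> (\<Oplus>x\<in>X. g x))"
    using insert.hyps insert.prems(1,2) c by (simp add: minus_add_minus)
  thus ?case using insert Fil_add by simp
qed

lemma finsum_grade:
  assumes "finite X" "\<And>x. x \<in> X \<Longrightarrow> f x \<in> grade A n"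
  shows "(\<Oplus>x\<in>X. f x) \<in> grade A n"
  using assms
proof (induction X rule: finite_induct)
  case (insert x X)
  have c: "f \<in> X \<rightarrow> carrier A" using insert.prems grade_carrier by blast
  show ?case using insert c grade_carrier[of "f x" n] by (simp add: add_grade)
qed simp

end

section \<open>From Kaehler differentials to degree 1 modulo Fil^1\<close>

context dieudonne_algebra_over
begin

text \<open>Lifts the map a dx |-> [a]d[x] with values modulo Fil^1. It lives on the free module
  because additivity and the relations hold only modulo Fil^1.\<close>

definition kmap :: "('r \<Rightarrow> 'r) \<Rightarrow> 'a" where
  "kmap c = (\<Oplus>x\<in>{x. c x \<noteq> \<zero>\<^bsub>R\<^esub>}. \<tau> (c x) \<otimes> differential A (\<tau> x))"

abbreviation "FMR \<equiv> free_mod R"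
abbreviation "K \<equiv> Kaehler R"

lemma kmap_superset:
  assumes c: "c \<in> carrier FMR" and X: "finite X" "{x. c x \<noteq> \<zero>\<^bsub>R\<^esub>} \<subseteq> X" "X \<subseteq> carrier R"
  shows "kmap c = (\<Oplus>x\<in>X. \<tau> (c x) \<otimes> differential A (\<tau> x))"
  unfolding kmap_def
  by (rule add.finprod_mono_neutral_cong_left)
    (use X in \<open>auto simp: Teichmueller_zero d_Teichmueller_carrier intro!: m_closed Teichmueller_carrier R.free_mod_value[OF c] d_Teichmueller_carrier\<close>)

lemma kmap_support_subset: "c \<in> carrier FMR \<Longrightarrow> {x. c x \<noteq> \<zero>\<^bsub>R\<^esub>} \<subseteq> carrier R"
  by (auto simp: R.free_mod_carrier)

lemma kmap_support_finite: "c \<in> carrier FMR \<Longrightarrow> finite {x. c x \<noteq> \<zero>\<^bsub>R\<^esub>}"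
  by (auto simp: R.free_mod_carrier)

lemma kmap_term_grade:
  assumes "c \<in> carrier FMR" "x \<in> carrier R"
  shows "\<tau> (c x) \<otimes> differential A (\<tau> x) \<in> grade A 1"
  using mult_grade[OF Teichmueller_grade[OF R.free_mod_value[OF assms(1)]] d_Teichmueller_grade[OF assms(2)]] by simp

lemma kmap_grade: "c \<in> carrier FMR \<Longrightarrow> kmap c \<in> grade A 1"
  unfolding kmap_def using kmap_support_subset[of c] kmap_support_finite[of c] kmap_term_grade[of c]
  by (intro finsum_grade) auto

lemma kmap_carrier: "c \<in> carrier FMR \<Longrightarrow> kmap c \<in> carrier A"
  using kmap_grade grade_carrier by blast

lemma Teichmueller_add_minus:
  assumes "r \<in> carrier R" "s \<in> carrier R"
  shows "\<tau> (r \<oplus>\<^bsub>R\<^esub> s) \<ominus> (\<tau> r \<oplus> \<tau> s) \<in> Fil 1"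
proof -
  obtain y where y: "y \<in> grade A 0" "\<tau> (r \<oplus>\<^bsub>R\<^esub> s) = (\<tau> r \<oplus> \<tau> s) \<oplus> V y"
    using Teichmueller_add_Fil[OF assms] by blast
  have yc: "y \<in> carrier A" using y grade_carrier by blast
  have "\<tau> (r \<oplus>\<^bsub>R\<^esub> s) \<ominus> (\<tau> r \<oplus> \<tau> s) = V y"
    unfolding y(2) using Teichmueller_carrier assms V_simps(1)[OF yc]
    by (subst a_comm) (simp_all add: add_minus_cancel(3))
  thus ?thesis using Fil_V1[OF yc] by simp
qed

lemma kmap_add:
  assumes b: "b \<in> carrier FMR" and c: "c \<in> carrier FMR"
  shows "kmap (b \<oplus>\<^bsub>FMR\<^esub> c) \<ominus> (kmap b \<oplus> kmap c) \<in> Fil 1"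
proof -
  let ?X = "{x. b x \<noteq> \<zero>\<^bsub>R\<^esub>} \<union> {x. c x \<noteq> \<zero>\<^bsub>R\<^esub>}"
  let ?t = "\<lambda>c x. \<tau> (c x) \<otimes> differential A (\<tau> x)"
  have X: "finite ?X" "?X \<subseteq> carrier R" using kmap_support_finite kmap_support_subset b c by auto
  have bc: "b \<oplus>\<^bsub>FMR\<^esub> c \<in> carrier FMR" using R.free_mod_add b c by blast
  have tc: "?t f x \<in> carrier A" if "f \<in> carrier FMR" "x \<in> ?X" for f x
    using kmap_term_grade[OF that(1)] that(2) X(2) grade_carrier by blast
  have "kmap b \<oplus> kmap c = (\<Oplus>x\<in>?X. ?t b x) \<oplus> (\<Oplus>x\<in>?X. ?t c x)"
    using kmap_superset[OF b X(1) _ X(2)] kmap_superset[OF c X(1) _ X(2)] by simp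
  also have "\<dots> = (\<Oplus>x\<in>?X. ?t b x \<oplus> ?t c x)"
    by (rule finsum_addf[symmetric]) (use tc[OF b] tc[OF c] in auto)
  finally have 1: "kmap b \<oplus> kmap c = (\<Oplus>x\<in>?X. ?t b x \<oplus> ?t c x)" .
  have "{x. (b \<oplus>\<^bsub>FMR\<^esub> c) x \<noteq> \<zero>\<^bsub>R\<^esub>} \<subseteq> ?X" by (auto simp: R.free_mod_simps)
  hence 2: "kmap (b \<oplus>\<^bsub>FMR\<^esub> c) = (\<Oplus>x\<in>?X. ?t (b \<oplus>\<^bsub>FMR\<^esub> c) x)"
    by (rule kmap_superset[OF bc X(1) _ X(2)])
  show ?thesis unfolding 1 2
  proof (rule finsum_minus_Fil[OF X(1)])
    fix x assume x: "x \<in> ?X"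
    show "?t (b \<oplus>\<^bsub>FMR\<^esub> c) x \<in> carrier A" "?t b x \<oplus> ?t c x \<in> carrier A"
      using tc[OF bc x] tc[OF b x] tc[OF c x] by auto
    have v: "b x \<in> carrier R" "c x \<in> carrier R" using R.free_mod_value b c by auto
    have xR: "x \<in> carrier R" using x X(2) by blast
    have "(b \<oplus>\<^bsub>FMR\<^esub> c) x = b x \<oplus>\<^bsub>R\<^esub> c x" by (simp add: R.free_mod_simps)
    moreover have "\<tau> (b x \<oplus>\<^bsub>R\<^esub> c x) \<otimes> differential A (\<tau> x) \<ominus> (?t b x \<oplus> ?t c x) =
      (\<tau> (b x \<oplus>\<^bsub>R\<^esub> c x) \<ominus> (\<tau> (b x) \<oplus> \<tau> (c x))) \<otimes> differential A (\<tau> x)"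
      using v xR by (simp add: minus_eq l_distr l_minus Teichmueller_carrier d_Teichmueller_carrier)
    moreover have "\<dots> \<in> Fil 1"
      by (rule Fil_mult_right[OF Teichmueller_add_minus[OF v] d_Teichmueller_carrier[OF xR]])
    ultimately show "?t (b \<oplus>\<^bsub>FMR\<^esub> c) x \<ominus> (?t b x \<oplus> ?t c x) \<in> Fil 1" by simp
  qed
qed

text \<open>An exact equality, in contrast to additivity, since Teichmueller representatives are
  multiplicative.\<close>

lemma kmap_smult:
  assumes a: "a \<in> carrier R" and c: "c \<in> carrier FMR"
  shows "kmap (a \<odot>\<^bsub>FMR\<^esub> c) = \<tau> a \<otimes> kmap c"
proof -
  let ?X = "{x. c x \<noteq> \<zero>\<^bsub>R\<^esub>}"
  let ?t = "\<lambda>c x. \<tau> (c x) \<otimes> differential A (\<tau> x)"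
  have X: "finite ?X" "?X \<subseteq> carrier R" using kmap_support_finite kmap_support_subset c by auto
  have "{x. (a \<odot>\<^bsub>FMR\<^esub> c) x \<noteq> \<zero>\<^bsub>R\<^esub>} \<subseteq> ?X" using a by (auto simp: R.free_mod_simps)
  hence "kmap (a \<odot>\<^bsub>FMR\<^esub> c) = (\<Oplus>x\<in>?X. ?t (a \<odot>\<^bsub>FMR\<^esub> c) x)"
    by (rule kmap_superset[OF R.free_mod_smult[OF a c] X(1) _ X(2)])
  also have "\<dots> = (\<Oplus>x\<in>?X. \<tau> a \<otimes> ?t c x)"
  proof (rule finsum_cong')
    have "\<tau> a \<otimes> ?t c x \<in> carrier A" if "x \<in> ?X" for x
      using Teichmueller_carrier[OF a] grade_carrier[OF kmap_term_grade[OF c]] that X(2) by blast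
    thus "(\<lambda>x. \<tau> a \<otimes> ?t c x) \<in> ?X \<rightarrow> carrier A" by blast
    fix x assume "x \<in> ?X"
    hence "x \<in> carrier R" using X(2) by blast
    thus "?t (a \<odot>\<^bsub>FMR\<^esub> c) x = \<tau> a \<otimes> ?t c x"
      using a R.free_mod_value[OF c, of x]
      by (simp add: R.free_mod_simps Teichmueller_mult m_assoc Teichmueller_carrier d_Teichmueller_carrier)
  qed simp
  also have "\<dots> = \<tau> a \<otimes> kmap c" unfolding kmap_def
  proof (rule finsum_rdistr[symmetric])
    show "?t c \<in> ?X \<rightarrow> carrier A" using grade_carrier[OF kmap_term_grade[OF c]] X(2) by blast
  qed (use X(1) Teichmueller_carrier[OF a] in auto)
  finally show ?thesis .
qed

lemma kmap_gen:
  assumes x: "x \<in> carrier R"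
  shows "kmap (free_gen R x) = differential A (\<tau> x)"
proof -
  have "kmap (free_gen R x) = (\<Oplus>y\<in>{x}. \<tau> (free_gen R x y) \<otimes> differential A (\<tau> y))"
    by (rule kmap_superset[OF R.free_mod_gen[OF x]]) (use x in \<open>auto simp: free_gen_def\<close>)
  also have "\<dots> = differential A (\<tau> x)"
    using x d_Teichmueller_carrier[OF x] by (simp add: free_gen_def Teichmueller_one)
  finally show ?thesis .
qed

lemma kmap_zero: "kmap \<zero>\<^bsub>FMR\<^esub> = \<zero>"
  by (simp add: kmap_def R.free_mod_simps)

lemma kmap_minus:
  assumes b: "b \<in> carrier FMR" and c: "c \<in> carrier FMR"
  shows "kmap (b \<ominus>\<^bsub>FMR\<^esub> c) \<ominus> (kmap b \<ominus> kmap c) \<in> Fil 1"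
proof -
  interpret FM: abelian_group FMR by (rule R.free_mod_abelian_group)
  let ?u = "b \<ominus>\<^bsub>FMR\<^esub> c"
  have u: "?u \<in> carrier FMR" using b c by simp
  have c': "kmap b \<in> carrier A" "kmap c \<in> carrier A" "kmap ?u \<in> carrier A" using kmap_carrier b c u by auto
  have "kmap b \<ominus> (kmap ?u \<oplus> kmap c) \<in> Fil 1"
    using kmap_add[OF u c] FM.add_minus_cancel(2)[OF b c] by simp
  hence "(kmap ?u \<oplus> kmap c) \<ominus> kmap b \<in> Fil 1" by (rule Fil_minus_swap[rotated 2]) (use c' in auto)
  moreover have "(kmap ?u \<oplus> kmap c) \<ominus> kmap b = kmap ?u \<ominus> (kmap b \<ominus> kmap c)"
    using c' by (simp add: minus_eq minus_add a_ac)
  ultimately show ?thesis by simp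
qed

text \<open>The elements sent into Fil^1 form a submodule, so the defining relations suffice. The
  Leibniz relation comes from [xy] = [x][y]; the additive one from [x + y] - [x] - [y] in Fil^1 and
  the stability of Fil^1 under d.\<close>

lemma kmap_KR:
  assumes "c \<in> R.KR"
  shows "kmap c \<in> Fil 1"
proof -
  interpret FM: abelian_group FMR by (rule R.free_mod_abelian_group)
  let ?N = "{c \<in> carrier FMR. kmap c \<in> Fil 1}"
  have minus: "b \<ominus>\<^bsub>FMR\<^esub> c \<in> ?N" if b: "b \<in> carrier FMR" and c: "c \<in> carrier FMR"
    and "kmap b \<ominus> kmap c \<in> Fil 1" for b c
    using Fil_minus_cancel[OF _ _ kmap_minus[OF b c]] that kmap_carrier FM.minus_closed by auto
  have "subgroup ?N (add_monoid FMR)"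
  proof (rule subgroup.intro)
    show "\<one>\<^bsub>add_monoid FMR\<^esub> \<in> ?N" using kmap_zero by simp
    show "b \<otimes>\<^bsub>add_monoid FMR\<^esub> c \<in> ?N" if "b \<in> ?N" "c \<in> ?N" for b c
      using Fil_minus_cancel[OF _ _ kmap_add[of b c]] that kmap_carrier R.free_mod_add Fil_add by auto
    show "inv\<^bsub>add_monoid FMR\<^esub> c \<in> ?N" if c: "c \<in> ?N" for c
    proof -
      have "\<zero> \<ominus> kmap c \<in> Fil 1" using c Fil_neg[of "kmap c"] kmap_carrier[of c] by (simp add: minus_eq)
      hence "\<zero>\<^bsub>FMR\<^esub> \<ominus>\<^bsub>FMR\<^esub> c \<in> ?N" using minus[OF FM.zero_closed, of c] c kmap_zero by simp
      thus ?thesis using c by (simp add: a_minus_def flip: a_inv_def)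
    qed
  qed auto
  moreover have "submodule_axioms ?N R FMR"
    by (intro submodule_axioms.intro) (auto simp: kmap_smult R.free_mod_smult Teichmueller_carrier Fil_mult_left)
  ultimately have N: "submodule ?N R FMR" by (simp add: submodule_def)
  have "Kaehler_relations R \<subseteq> ?N"
  proof
    fix c assume "c \<in> Kaehler_relations R"
    then consider x y where "x \<in> carrier R" "y \<in> carrier R"
        "c = free_gen R (x \<oplus>\<^bsub>R\<^esub> y) \<ominus>\<^bsub>FMR\<^esub> (free_gen R x \<oplus>\<^bsub>FMR\<^esub> free_gen R y)"
      | x y where "x \<in> carrier R" "y \<in> carrier R"
        "c = free_gen R (x \<otimes>\<^bsub>R\<^esub> y) \<ominus>\<^bsub>FMR\<^esub> (x \<odot>\<^bsub>FMR\<^esub> free_gen R y \<oplus>\<^bsub>FMR\<^esub> y \<odot>\<^bsub>FMR\<^esub> free_gen R x)"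
      unfolding Kaehler_relations_def by blast
    thus "c \<in> ?N"
    proof cases
      case (1 x y)
      note g = R.free_mod_gen[OF 1(1)] R.free_mod_gen[OF 1(2)]
      let ?v = "free_gen R x \<oplus>\<^bsub>FMR\<^esub> free_gen R y"
      have v: "?v \<in> carrier FMR" using g by simp
      have xy: "x \<oplus>\<^bsub>R\<^esub> y \<in> carrier R" using 1 by simp
      have dc: "differential A (\<tau> x) \<in> carrier A" "differential A (\<tau> y) \<in> carrier A" "differential A (\<tau> (x \<oplus>\<^bsub>R\<^esub> y)) \<in> carrier A"
        using d_Teichmueller_carrier 1 by auto
      have a: "kmap ?v \<ominus> (differential A (\<tau> x) \<oplus> differential A (\<tau> y)) \<in> Fil 1"
        using kmap_add[OF g] by (simp add: kmap_gen 1)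
      have b: "differential A (\<tau> (x \<oplus>\<^bsub>R\<^esub> y)) \<ominus> (differential A (\<tau> x) \<oplus> differential A (\<tau> y)) \<in> Fil 1"
        using Fil_d[OF Teichmueller_add_minus[OF 1(1,2)]] 1 by (simp add: d_simps Teichmueller_carrier)
      have "differential A (\<tau> (x \<oplus>\<^bsub>R\<^esub> y)) \<ominus> kmap ?v \<in> Fil 1"
        by (rule Fil_minus_trans[OF _ _ _ b Fil_minus_swap[OF _ _ a]]) (use dc kmap_carrier[OF v] in auto)
      thus ?thesis unfolding 1(3) by (intro minus R.free_mod_gen xy v) (simp add: kmap_gen xy)
    next
      case (2 x y)
      note g = R.free_mod_gen[OF 2(1)] R.free_mod_gen[OF 2(2)]
      let ?v = "x \<odot>\<^bsub>FMR\<^esub> free_gen R y \<oplus>\<^bsub>FMR\<^esub> y \<odot>\<^bsub>FMR\<^esub> free_gen R x"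
      have m: "x \<odot>\<^bsub>FMR\<^esub> free_gen R y \<in> carrier FMR" "y \<odot>\<^bsub>FMR\<^esub> free_gen R x \<in> carrier FMR"
        using R.free_mod_smult g 2 by auto
      have v: "?v \<in> carrier FMR" using m by simp
      have xy: "x \<otimes>\<^bsub>R\<^esub> y \<in> carrier R" using 2 by simp
      have dc: "differential A (\<tau> x) \<in> carrier A" "differential A (\<tau> y) \<in> carrier A" "\<tau> x \<in> carrier A" "\<tau> y \<in> carrier A"
        using d_Teichmueller_carrier Teichmueller_carrier 2 by auto
      have "differential A (\<tau> (x \<otimes>\<^bsub>R\<^esub> y)) = differential A (\<tau> x) \<otimes> \<tau> y \<oplus> \<tau> x \<otimes> differential A (\<tau> y)"
        using Leibniz_left[OF Teichmueller_grade[OF 2(1)] dc(4)] 2 by (simp add: Teichmueller_mult)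
      also have "\<dots> = \<tau> x \<otimes> differential A (\<tau> y) \<oplus> \<tau> y \<otimes> differential A (\<tau> x)"
        using grade_zero_comm[OF Teichmueller_grade[OF 2(2)] dc(1)] dc by (simp add: a_comm)
      finally have b: "differential A (\<tau> (x \<otimes>\<^bsub>R\<^esub> y)) = kmap (x \<odot>\<^bsub>FMR\<^esub> free_gen R y) \<oplus> kmap (y \<odot>\<^bsub>FMR\<^esub> free_gen R x)"
        using 2 g by (simp add: kmap_smult kmap_gen)
      have "differential A (\<tau> (x \<otimes>\<^bsub>R\<^esub> y)) \<ominus> kmap ?v \<in> Fil 1"
        unfolding b by (rule Fil_minus_swap[OF _ _ kmap_add[OF m]]) (use m v kmap_carrier in auto)
      thus ?thesis unfolding 2(3) by (intro minus R.free_mod_gen xy v) (simp add: kmap_gen xy)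
    qed
  qed
  from mod_span_least[OF N this] show ?thesis using assms by blast
qed

lemma kmap_kclass:
  assumes b: "b \<in> carrier FMR" and c: "c \<in> carrier FMR" and e: "R.kclass b = R.kclass c"
  shows "kmap b \<ominus> kmap c \<in> Fil 1"
proof -
  interpret FM: abelian_group FMR by (rule R.free_mod_abelian_group)
  have "kmap (b \<ominus>\<^bsub>FMR\<^esub> c) \<in> Fil 1" using kmap_KR R.kclass_eq_iff[OF b c] e by blast
  moreover have "(kmap b \<ominus> kmap c) \<ominus> kmap (b \<ominus>\<^bsub>FMR\<^esub> c) \<in> Fil 1"
    by (rule Fil_minus_swap[OF _ _ kmap_minus[OF b c]]) (use b c kmap_carrier in auto)
  ultimately show ?thesis
    by (rule_tac Fil_minus_cancel[of _ "kmap (b \<ominus>\<^bsub>FMR\<^esub> c)"]) (use b c kmap_carrier in auto)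
qed

text \<open>E consists of the images of numerators of the given generators. Identities in the
  localization hold only after multiplication by a power of s, hence the factor [s^N]. The fractions
  possessing a numerator that some power of [s] moves into \<open>lspan E\<close> form a submodule
  containing the generators, hence all of the localization, in particular dr/1.\<close>

lemma local_generators:
  assumes s: "s \<in> carrier R" and gen: "generated_by_at_most (loc_ring R s) (loc_module K s) d"
  shows "\<exists>E. finite E \<and> card E \<le> d \<and> E \<subseteq> grade A 1 \<and>
    (\<forall>r\<in>carrier R. \<exists>N::nat. \<tau> (s [^]\<^bsub>R\<^esub> N) \<otimes> differential A (\<tau> r) \<in> lspan E)"
proof -
  interpret FM: abelian_group FMR by (rule R.free_mod_abelian_group)
  define e where "e = (\<lambda>x. s \<odot>\<^bsub>K\<^esub> x)"
  interpret L: localization K e unfolding e_def by (rule R.localization_Kaehler[OF s])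
  let ?L = "loc_module K s" and ?F = "\<lambda>c k. loc_frac K e (R.kclass c) k"
  have Ls: "carrier ?L = loc_set K e (carrier K)" "add ?L = loc_add K e" "zero ?L = loc_frac K e \<zero>\<^bsub>K\<^esub> 0"
    "smult ?L = loc_mult K e (smult K)"
    by (simp_all add: loc_module_def e_def Let_def)
  have Lc: "P \<in> carrier ?L \<longleftrightarrow> (\<exists>c\<in>carrier FMR. \<exists>k. P = ?F c k)" for P
  proof
    assume "P \<in> carrier ?L"
    then obtain x k where x: "x \<in> carrier K" "P = loc_frac K e x k" unfolding Ls(1) loc_set_def by blast
    obtain c where "c \<in> carrier FMR" "x = R.kclass c" using x(1) unfolding R.Kaehler_carrier by (rule bexE)
    thus "\<exists>c\<in>carrier FMR. \<exists>k. P = ?F c k" using x(2) by blast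
  next
    assume "\<exists>c\<in>carrier FMR. \<exists>k. P = ?F c k"
    then obtain c k where c: "c \<in> carrier FMR" "P = ?F c k" by blast
    show "P \<in> carrier ?L" unfolding Ls(1) loc_set_def using R.kclass_carrier[OF c(1)] c(2) by blast
  qed
  have e_pow: "(e ^^ k) (R.kclass c) = R.kclass ((s [^]\<^bsub>R\<^esub> k) \<odot>\<^bsub>FMR\<^esub> c)" if "c \<in> carrier FMR" for k c
    unfolding e_def by (rule R.kclass_smult_pow[OF s that])
  have spow: "(s [^]\<^bsub>R\<^esub> (k::nat)) \<odot>\<^bsub>FMR\<^esub> c \<in> carrier FMR" if "c \<in> carrier FMR" for k c
    using that s R.free_mod_smult by simp
  obtain X where X: "X \<subseteq> carrier ?L" "finite X" "card X \<le> d" "mod_span (loc_ring R s) ?L X = carrier ?L"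
    using gen unfolding generated_by_at_most_def by blast
  have "\<forall>P\<in>X. \<exists>c. c \<in> carrier FMR \<and> (\<exists>k. P = ?F c k)" using X(1) Lc by blast
  then obtain rep where rep: "\<And>P. P \<in> X \<Longrightarrow> rep P \<in> carrier FMR" "\<And>P. P \<in> X \<Longrightarrow> \<exists>k. P = ?F (rep P) k"
    using bchoice[of X] by metis
  define E where "E = (kmap \<circ> rep) ` X"
  have E: "finite E" "card E \<le> d" "E \<subseteq> grade A 1"
    using X(2,3) card_image_le[OF X(2), of "kmap \<circ> rep"] kmap_grade[OF rep(1)] by (auto simp: E_def)
  let ?good = "\<lambda>c. \<exists>m::nat. \<tau> (s [^]\<^bsub>R\<^esub> m) \<otimes> kmap c \<in> lspan E"
  let ?N = "{P. \<exists>c k. c \<in> carrier FMR \<and> ?good c \<and> P = ?F c k}"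
  have tc: "\<tau> (s [^]\<^bsub>R\<^esub> (k::nat)) \<in> carrier A" "\<tau> (s [^]\<^bsub>R\<^esub> (k::nat)) \<in> grade A 0" for k
    using Teichmueller_carrier Teichmueller_grade s by auto
  have tadd: "\<tau> (s [^]\<^bsub>R\<^esub> ((k::nat) + l)) = \<tau> (s [^]\<^bsub>R\<^esub> k) \<otimes> \<tau> (s [^]\<^bsub>R\<^esub> l)" for k l
    using s by (simp add: Teichmueller_mult[symmetric] R.nat_pow_mult)
  have good_mono: "\<tau> (s [^]\<^bsub>R\<^esub> ((k::nat) + m)) \<otimes> x \<in> lspan E"
    if "\<tau> (s [^]\<^bsub>R\<^esub> m) \<otimes> x \<in> lspan E" "x \<in> carrier A" for k m x
    using lspan_smult[OF E(3) tc(2) that(1), of k] tc(1) that(2) by (simp add: tadd m_assoc)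
  have good_smult: "?good (a \<odot>\<^bsub>FMR\<^esub> c)" if a: "a \<in> carrier R" and c: "c \<in> carrier FMR" "?good c" for a c
  proof -
    obtain m where "\<tau> (s [^]\<^bsub>R\<^esub> (m::nat)) \<otimes> kmap c \<in> lspan E" using c(2) by blast
    from lspan_smult[OF E(3) Teichmueller_grade[OF a] this]
    have "\<tau> a \<otimes> (\<tau> (s [^]\<^bsub>R\<^esub> m) \<otimes> kmap c) \<in> lspan E" .
    also have "\<tau> a \<otimes> (\<tau> (s [^]\<^bsub>R\<^esub> m) \<otimes> kmap c) = \<tau> (s [^]\<^bsub>R\<^esub> m) \<otimes> kmap (a \<odot>\<^bsub>FMR\<^esub> c)"
      using grade_zero_comm[OF Teichmueller_grade[OF a] tc(1)[of m]] Teichmueller_carrier[OF a] tc(1) kmap_carrier[OF c(1)]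
      by (simp add: kmap_smult[OF a c(1)] m_assoc[symmetric])
    finally show ?thesis by blast
  qed
  have good_add: "?good (b \<oplus>\<^bsub>FMR\<^esub> c)" if b: "b \<in> carrier FMR" "?good b" and c: "c \<in> carrier FMR" "?good c" for b c
  proof -
    obtain m n where mn: "\<tau> (s [^]\<^bsub>R\<^esub> (m::nat)) \<otimes> kmap b \<in> lspan E" "\<tau> (s [^]\<^bsub>R\<^esub> (n::nat)) \<otimes> kmap c \<in> lspan E"
      using b(2) c(2) by blast
    note kc = kmap_carrier[OF b(1)] kmap_carrier[OF c(1)] kmap_carrier[OF R.free_mod_add[OF b(1) c(1)]]
    let ?t = "\<tau> (s [^]\<^bsub>R\<^esub> (n + m))"
    have 1: "?t \<otimes> kmap b \<in> lspan E" by (rule good_mono[OF mn(1) kc(1)])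
    have 2: "?t \<otimes> kmap c \<in> lspan E" using good_mono[OF mn(2) kc(2), of m] by (simp add: add.commute)
    have "?t \<otimes> kmap (b \<oplus>\<^bsub>FMR\<^esub> c) \<in> lspan E"
    proof (rule lspan_if_minus_Fil[OF E(3)])
      show "?t \<otimes> kmap (b \<oplus>\<^bsub>FMR\<^esub> c) \<in> grade A 1"
        using grade_smult[OF tc(2) kmap_grade[OF R.free_mod_add[OF b(1) c(1)]]] .
      show "?t \<otimes> kmap b \<oplus> ?t \<otimes> kmap c \<in> lspan E" by (rule lspan_add[OF E(3) 2 1])
      have "?t \<otimes> (kmap (b \<oplus>\<^bsub>FMR\<^esub> c) \<ominus> (kmap b \<oplus> kmap c)) \<in> Fil 1"
        by (rule Fil_mult_left[OF kmap_add[OF b(1) c(1)] tc(1)])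
      thus "?t \<otimes> kmap (b \<oplus>\<^bsub>FMR\<^esub> c) \<ominus> (?t \<otimes> kmap b \<oplus> ?t \<otimes> kmap c) \<in> Fil 1"
        using tc(1)[of "n + m"] kc by (simp add: minus_eq r_distr r_minus)
    qed
    thus ?thesis by blast
  qed
  have good_zero: "?good \<zero>\<^bsub>FMR\<^esub>"
    unfolding kmap_zero using lspan.base[of "\<zero>" E] by (intro exI[of _ 0]) (simp add: Teichmueller_one)
  \<comment> \<open>Negation is multiplication by the scalar -1, so \<open>good_smult\<close> covers
    it.\<close>
  have neg_eq: "\<ominus>\<^bsub>FMR\<^esub> c = (\<ominus>\<^bsub>R\<^esub> \<one>\<^bsub>R\<^esub>) \<odot>\<^bsub>FMR\<^esub> c" if "c \<in> carrier FMR" for c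
    using that R.free_mod_value[OF that] by (simp add: R.free_mod_a_inv R.free_mod_simps fun_eq_iff R.l_minus)
  have good_neg: "?good (\<ominus>\<^bsub>FMR\<^esub> c)" if "c \<in> carrier FMR" "?good c" for c
    unfolding neg_eq[OF that(1)] by (rule good_smult) (use that in auto)
  have Lneg: "\<ominus>\<^bsub>?L\<^esub> ?F c k = ?F (\<ominus>\<^bsub>FMR\<^esub> c) k" if c: "c \<in> carrier FMR" for c k
  proof -
    have "R.kclass (\<ominus>\<^bsub>FMR\<^esub> c) \<oplus>\<^bsub>K\<^esub> R.kclass c = \<zero>\<^bsub>K\<^esub>"
      using c by (simp add: R.kclass_add FM.l_neg R.kclass_zero)
    hence "\<ominus>\<^bsub>K\<^esub> R.kclass c = R.kclass (\<ominus>\<^bsub>FMR\<^esub> c)"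
      by (rule L.minus_equality) (use c R.kclass_carrier in auto)
    thus ?thesis using L.loc_abelian_group(2)[OF Ls(1-3) R.kclass_carrier[OF c], of k] by simp
  qed
  have N: "submodule ?N (loc_ring R s) ?L"
  proof (intro submodule.intro submodule_axioms.intro subgroup.intro)
    show "?N \<subseteq> carrier (add_monoid ?L)" using Lc by auto
    show "\<one>\<^bsub>add_monoid ?L\<^esub> \<in> ?N"
      using good_zero FM.zero_closed R.kclass_zero unfolding monoid.simps Ls(3) by force
    show "inv\<^bsub>add_monoid ?L\<^esub> P \<in> ?N" if P: "P \<in> ?N" for P
    proof -
      obtain c k where c: "c \<in> carrier FMR" "?good c" "P = ?F c k" using P by blast
      have "inv\<^bsub>add_monoid ?L\<^esub> P = ?F (\<ominus>\<^bsub>FMR\<^esub> c) k"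
        unfolding c(3) using Lneg[OF c(1), of k] by (simp add: a_inv_def)
      thus ?thesis using good_neg[OF c(1,2)] FM.a_inv_closed[OF c(1)] by blast
    qed
    show "P \<otimes>\<^bsub>add_monoid ?L\<^esub> Q \<in> ?N" if P: "P \<in> ?N" and Q: "Q \<in> ?N" for P Q
    proof -
      obtain b k where b: "b \<in> carrier FMR" "?good b" "P = ?F b k" using P by blast
      obtain c l where c: "c \<in> carrier FMR" "?good c" "Q = ?F c l" using Q by blast
      let ?b = "(s [^]\<^bsub>R\<^esub> l) \<odot>\<^bsub>FMR\<^esub> b" and ?c = "(s [^]\<^bsub>R\<^esub> k) \<odot>\<^bsub>FMR\<^esub> c"
      have "P \<otimes>\<^bsub>add_monoid ?L\<^esub> Q = ?F (?b \<oplus>\<^bsub>FMR\<^esub> ?c) (k + l)"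
        unfolding b(3) c(3) using b(1) c(1) spow R.kclass_carrier
        by (simp add: Ls L.loc_add_frac e_pow R.kclass_add)
      moreover have "?good (?b \<oplus>\<^bsub>FMR\<^esub> ?c)"
        by (intro good_add good_smult spow b c R.nat_pow_closed s)
      ultimately show ?thesis using R.free_mod_add[OF spow[OF b(1)] spow[OF c(1)]] by blast
    qed
    show "T \<odot>\<^bsub>?L\<^esub> P \<in> ?N" if T: "T \<in> carrier (loc_ring R s)" and P: "P \<in> ?N" for T P
    proof -
      interpret LR: localization R "\<lambda>x. s \<otimes>\<^bsub>R\<^esub> x" by (rule R.localization_ring[OF s])
      obtain a l where a: "a \<in> carrier R" "T = loc_frac R (\<lambda>x. s \<otimes>\<^bsub>R\<^esub> x) a l"
        using T unfolding loc_ring_def loc_set_def Let_def by auto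
      obtain c k where c: "c \<in> carrier FMR" "?good c" "P = ?F c k" using P by blast
      have "T \<odot>\<^bsub>?L\<^esub> P = loc_frac K e (a \<odot>\<^bsub>K\<^esub> R.kclass c) (l + k)"
        unfolding Ls(4) a(2) c(3)
      proof (rule LR.loc_mult_frac[OF L.localization_axioms])
        show "b \<odot>\<^bsub>K\<^esub> x \<in> carrier K" if "b \<in> carrier R" "x \<in> carrier K" for b x
          using that by (rule R.Kaehler_smult_closed)
        show "(s \<otimes>\<^bsub>R\<^esub> b) \<odot>\<^bsub>K\<^esub> x = e (b \<odot>\<^bsub>K\<^esub> x)" if "b \<in> carrier R" "x \<in> carrier K" for b x
          unfolding e_def using R.Kaehler_smult_smult[OF s that] by simp
        show "b \<odot>\<^bsub>K\<^esub> e x = e (b \<odot>\<^bsub>K\<^esub> x)" if "b \<in> carrier R" "x \<in> carrier K" for b x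
          unfolding e_def using R.Kaehler_smult_smult[OF s that] R.Kaehler_smult_smult[OF that(1) s that(2)] that s
          by (simp add: R.m_comm)
      qed (use a c R.kclass_carrier in auto)
      also have "\<dots> = ?F (a \<odot>\<^bsub>FMR\<^esub> c) (l + k)" by (simp add: R.kclass_smult[OF a(1) c(1)])
      finally show ?thesis using good_smult[OF a(1) c(1,2)] R.free_mod_smult[OF a(1) c(1)] by blast
    qed
  qed
  have XN: "X \<subseteq> ?N"
  proof
    fix P assume P: "P \<in> X"
    have "kmap (rep P) \<in> lspan E" by (rule lspan_gen[OF E(3)]) (use P in \<open>auto simp: E_def\<close>)
    hence "?good (rep P)" using kmap_carrier[OF rep(1)[OF P]] by (intro exI[of _ 0]) (simp add: Teichmueller_one)
    thus "P \<in> ?N" using rep[OF P] by blast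
  qed
  have sub: "carrier ?L \<subseteq> ?N" using mod_span_least[OF N XN] unfolding X(4) .
  have "\<exists>N::nat. \<tau> (s [^]\<^bsub>R\<^esub> N) \<otimes> differential A (\<tau> r) \<in> lspan E" if r: "r \<in> carrier R" for r
  proof -
    note g = R.free_mod_gen[OF r]
    have "?F (free_gen R r) 0 \<in> ?N" using sub Lc g by blast
    then obtain c k where c: "c \<in> carrier FMR" "?good c" "?F (free_gen R r) 0 = ?F c k" by blast
    obtain m where m: "\<tau> (s [^]\<^bsub>R\<^esub> (m::nat)) \<otimes> kmap c \<in> lspan E" using c(2) by blast
    \<comment> \<open>The equality dr/1 = c/s^k means s^(j+k) dr = s^j c in the Kaehler module for
      some j, and \<open>kmap\<close> carries this to A^1 modulo Fil^1.\<close>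
    obtain j where "(e ^^ (j + k)) (R.kclass (free_gen R r)) = (e ^^ (j + 0)) (R.kclass c)"
      using L.loc_frac_eq_iff[OF R.kclass_carrier[OF g] R.kclass_carrier[OF c(1)]] c(3) by blast
    hence "R.kclass ((s [^]\<^bsub>R\<^esub> (j + k)) \<odot>\<^bsub>FMR\<^esub> free_gen R r) = R.kclass ((s [^]\<^bsub>R\<^esub> j) \<odot>\<^bsub>FMR\<^esub> c)"
      using e_pow g c(1) by simp
    from kmap_kclass[OF spow[OF g] spow[OF c(1)] this]
    have 1: "\<tau> (s [^]\<^bsub>R\<^esub> (j + k)) \<otimes> differential A (\<tau> r) \<ominus> \<tau> (s [^]\<^bsub>R\<^esub> j) \<otimes> kmap c \<in> Fil 1"
      using s g c(1) r by (simp add: kmap_smult kmap_gen)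
    note cc = d_Teichmueller_carrier[OF r] kmap_carrier[OF c(1)]
    have "\<tau> (s [^]\<^bsub>R\<^esub> (m + (j + k))) \<otimes> differential A (\<tau> r) \<in> lspan E"
    proof (rule lspan_if_minus_Fil[OF E(3)])
      show "\<tau> (s [^]\<^bsub>R\<^esub> (m + (j + k))) \<otimes> differential A (\<tau> r) \<in> grade A 1"
        by (rule grade_smult[OF tc(2) d_Teichmueller_grade[OF r]])
      show "\<tau> (s [^]\<^bsub>R\<^esub> (j + m)) \<otimes> kmap c \<in> lspan E" by (rule good_mono[OF m cc(2)])
      have "\<tau> (s [^]\<^bsub>R\<^esub> m) \<otimes> (\<tau> (s [^]\<^bsub>R\<^esub> (j + k)) \<otimes> differential A (\<tau> r) \<ominus> \<tau> (s [^]\<^bsub>R\<^esub> j) \<otimes> kmap c) \<in> Fil 1"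
        by (rule Fil_mult_left[OF 1 tc(1)])
      thus "\<tau> (s [^]\<^bsub>R\<^esub> (m + (j + k))) \<otimes> differential A (\<tau> r) \<ominus> \<tau> (s [^]\<^bsub>R\<^esub> (j + m)) \<otimes> kmap c \<in> Fil 1"
        using tc(1) cc by (simp only: tadd[of m] add.commute[of j m]) (simp add: minus_eq r_distr r_minus m_assoc)
    qed
    thus ?thesis by blast
  qed
  thus ?thesis using E by blast
qed

text \<open>The r with [r]x in Fil^1 form an ideal. If it were proper, a prime P above it would come
  with an s outside P over which d generators suffice. Then [s^N]x is a sum of n-fold products over
  these generators, hence in Fil^1 since n > d, so s^N would lie in P.\<close>

lemma monomial_in_Fil:
  assumes loc: "locally_generated_by_at_most R K d" and m: "monomial n x" and n: "n > d"
  shows "x \<in> Fil 1"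
proof -
  have xc: "x \<in> carrier A" using m by (rule monomial_carrier)
  let ?I = "{r \<in> carrier R. \<tau> r \<otimes> x \<in> Fil 1}"
  have I_smult: "s \<otimes>\<^bsub>R\<^esub> r \<in> ?I" if r: "r \<in> ?I" and s: "s \<in> carrier R" for r s
  proof -
    have "\<tau> s \<otimes> (\<tau> r \<otimes> x) \<in> Fil 1" using r by (rule_tac Fil_mult_left[OF _ Teichmueller_carrier[OF s]]) simp
    thus ?thesis using r s xc by (simp add: Teichmueller_mult Teichmueller_carrier m_assoc)
  qed
  have I: "ideal ?I R"
  proof (rule idealI[OF R.ring_axioms])
    show "s \<otimes>\<^bsub>R\<^esub> r \<in> ?I" "r \<otimes>\<^bsub>R\<^esub> s \<in> ?I" if "r \<in> ?I" "s \<in> carrier R" for r s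
      using I_smult[OF that] that R.m_comm[of r s] by auto
    show "subgroup ?I (add_monoid R)"
    proof (rule subgroup.intro)
      show "r \<otimes>\<^bsub>add_monoid R\<^esub> s \<in> ?I" if "r \<in> ?I" "s \<in> ?I" for r s
      proof -
        have rs: "r \<in> carrier R" "s \<in> carrier R" using that by auto
        have "(\<tau> (r \<oplus>\<^bsub>R\<^esub> s) \<ominus> (\<tau> r \<oplus> \<tau> s)) \<otimes> x \<in> Fil 1"
          by (rule Fil_mult_right[OF Teichmueller_add_minus[OF rs] xc])
        hence 1: "\<tau> (r \<oplus>\<^bsub>R\<^esub> s) \<otimes> x \<ominus> (\<tau> r \<otimes> x \<oplus> \<tau> s \<otimes> x) \<in> Fil 1"
          using rs xc by (simp add: minus_eq l_distr l_minus Teichmueller_carrier)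
        have "\<tau> (r \<oplus>\<^bsub>R\<^esub> s) \<otimes> x \<in> Fil 1"
          by (rule Fil_minus_cancel[OF _ _ 1]) (use rs xc that Teichmueller_carrier Fil_add in auto)
        thus ?thesis using rs by simp
      qed
      show "inv\<^bsub>add_monoid R\<^esub> r \<in> ?I" if r: "r \<in> ?I" for r
        using I_smult[OF r, of "\<ominus>\<^bsub>R\<^esub> \<one>\<^bsub>R\<^esub>"] r by (simp add: R.l_minus flip: a_inv_def)
    qed (use xc in \<open>auto simp: Teichmueller_zero\<close>)
  qed
  have "\<one>\<^bsub>R\<^esub> \<in> ?I"
  proof (rule ccontr)
    assume "\<one>\<^bsub>R\<^esub> \<notin> ?I"
    then obtain P where P: "primeideal P R" "?I \<subseteq> P" using R.primeideal_above[OF I] by blast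
    then obtain s where s: "s \<in> carrier R" "s \<notin> P" "generated_by_at_most (loc_ring R s) (loc_module K s) d"
      using loc unfolding locally_generated_by_at_most_def by blast
    obtain E where E: "finite E" "card E \<le> d" "E \<subseteq> grade A 1"
      and gen: "\<And>r. r \<in> carrier R \<Longrightarrow> \<exists>N::nat. \<tau> (s [^]\<^bsub>R\<^esub> N) \<otimes> differential A (\<tau> r) \<in> lspan E"
      using local_generators[OF s(1,3)] by blast
    have tc: "\<tau> (s [^]\<^bsub>R\<^esub> (k::nat)) \<in> carrier A" "\<tau> (s [^]\<^bsub>R\<^esub> (k::nat)) \<in> grade A 0" for k
      using Teichmueller_carrier Teichmueller_grade s by auto
    \<comment> \<open>Each factor d[r] needs its own power of s; the powers are collected in front
      because elements of degree 0 commute with everything.\<close>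
    have "\<exists>N::nat. gspan E n (\<tau> (s [^]\<^bsub>R\<^esub> N) \<otimes> x)" using m
    proof (induction rule: monomial.induct)
      case (Teichmueller r)
      show ?case
        using grade_smult[OF tc(2) Teichmueller_grade[OF Teichmueller]] by (blast intro: gspan.zero)
    next
      case (d_Teichmueller n x r)
      obtain N where N: "gspan E n (\<tau> (s [^]\<^bsub>R\<^esub> (N::nat)) \<otimes> x)" using d_Teichmueller.IH by blast
      obtain M where M: "\<tau> (s [^]\<^bsub>R\<^esub> (M::nat)) \<otimes> differential A (\<tau> r) \<in> lspan E"
        using gen[OF d_Teichmueller.hyps(2)] by blast
      note c = monomial_carrier[OF d_Teichmueller.hyps(1)] d_Teichmueller_carrier[OF d_Teichmueller.hyps(2)]
      have "(\<tau> (s [^]\<^bsub>R\<^esub> N) \<otimes> x) \<otimes> (\<tau> (s [^]\<^bsub>R\<^esub> M) \<otimes> differential A (\<tau> r)) =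
        \<tau> (s [^]\<^bsub>R\<^esub> N) \<otimes> ((x \<otimes> \<tau> (s [^]\<^bsub>R\<^esub> M)) \<otimes> differential A (\<tau> r))"
        using tc(1) c by (simp add: m_assoc)
      also have "x \<otimes> \<tau> (s [^]\<^bsub>R\<^esub> M) = \<tau> (s [^]\<^bsub>R\<^esub> M) \<otimes> x" by (rule grade_zero_comm[OF tc(2) c(1), symmetric])
      also have "\<tau> (s [^]\<^bsub>R\<^esub> N) \<otimes> ((\<tau> (s [^]\<^bsub>R\<^esub> M) \<otimes> x) \<otimes> differential A (\<tau> r)) =
        \<tau> (s [^]\<^bsub>R\<^esub> (N + M)) \<otimes> (x \<otimes> differential A (\<tau> r))"
        using tc(1) c s by (simp add: m_assoc Teichmueller_mult R.nat_pow_mult[symmetric])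
      finally show ?case using gspan.Suc[OF N M] by metis
    qed
    then obtain N where "gspan E n (\<tau> (s [^]\<^bsub>R\<^esub> (N::nat)) \<otimes> x)" by blast
    hence "\<tau> (s [^]\<^bsub>R\<^esub> N) \<otimes> x \<in> Fil 1" by (rule gspan_in_Fil[OF E(1,3)]) (use E(2) n in simp)
    hence N: "s [^]\<^bsub>R\<^esub> N \<in> P" using P(2) s(1) by blast
    interpret P: primeideal P R by (rule P(1))
    have "s [^]\<^bsub>R\<^esub> (k::nat) \<notin> P" for k
    proof (induction k)
      case 0
      show ?case using P.one_imp_carrier P.I_notcarr by auto
    next
      case (Suc k)
      thus ?case using P.I_prime[of "s [^]\<^bsub>R\<^esub> k" s] s by auto
    qed
    thus False using N by blast
  qed
  thus ?thesis using xc by (simp add: Teichmueller_one)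
qed

lemma closed_bounded_subalgebra:
  assumes "locally_generated_by_at_most R K d"
  shows "\<exists>S. closed_dieudonne_subalgebra p A S \<and> \<tau> ` carrier R \<subseteq> S \<and>
    (\<forall>n>int d. S \<inter> grade A n \<subseteq> Fil 1)"
proof -
  have "bounded_subalgebra (int d) monomial_span"
    by (rule monomial_span_bounded) (use monomial_in_Fil[OF assms] in auto)
  then obtain S where S: "closed_dieudonne_subalgebra p A S" "bounded_subalgebra (int d) S"
    using closed_bounded_subalgebra_exists by blast
  have "x \<in> Fil 1" if "n > int d" "x \<in> S" "x \<in> grade A n" for n x
  proof -
    have "component A x n \<in> Fil 1" using S(2) that unfolding bounded_subalgebra_def by blast
    thus ?thesis using component_homogeneous[OF that(3)] by simp
  qed
  thus ?thesis using S unfolding bounded_subalgebra_def by blast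
qed

end

section \<open>The Frobenius endomorphism\<close>

context strict_dieudonne_algebra
begin

text \<open>V is determined by FV = p, and f commutes with F and with p.\<close>

lemma alg_hom_V:
  assumes B: "strict_dieudonne_algebra p B" and f: "f \<in> dieudonne_alg_hom A B" and u: "u \<in> carrier A"
  shows "f (V u) = Ver p B (f u)"
proof -
  interpret B: strict_dieudonne_algebra p B by (rule B)
  have hom: "f \<in> ring_hom A B" using f by (simp add: dieudonne_alg_hom_def)
  hence "f \<in> hom (add_monoid A) (add_monoid B)" by (auto simp: hom_def ring_hom_def)
  note f_simps = additive_hom[OF abelian_group_axioms B.abelian_group_axioms this]
  have "Frob B (f (V u)) = f (Frob A (V u))"
    using f V_carrier[OF u] by (simp add: dieudonne_alg_hom_def)
  also have "\<dots> = [p] \<cdot>\<^bsub>B\<^esub> f u" using u by (simp add: F_V f_simps)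
  finally show ?thesis using B.V_unique[of "f u" "f (V u)"] f_simps(1) u V_carrier by simp
qed

text \<open>For negative n the exponent \<open>nat n\<close> is 0, which is harmless as those
  degrees vanish.\<close>

definition Frob_endo :: "'a \<Rightarrow> 'a" where
  "Frob_endo = graded_extension A (\<lambda>n x. [(p ^ nat n)] \<cdot> Frob A x)"

lemma Frob_endo_hom: "Frob_endo \<in> hom (add_monoid A) (add_monoid A)"
  unfolding Frob_endo_def
  by (rule graded_extension_hom)
    (auto simp: nat_mult_grade Frob_grade F_simps nat_mult_simps grade_carrier)

lemmas Frob_endo_simps = additive_hom[OF abelian_group_axioms abelian_group_axioms Frob_endo_hom]

lemma Frob_endo_homogeneous: "x \<in> grade A n \<Longrightarrow> Frob_endo x = [(p ^ nat n)] \<cdot> Frob A x"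
  unfolding Frob_endo_def
  by (rule graded_extension_homogeneous)
    (auto simp: nat_mult_grade Frob_grade F_simps nat_mult_simps grade_carrier)

lemma Frob_endo_grade: "x \<in> grade A n \<Longrightarrow> Frob_endo x \<in> grade A n"
  by (simp add: Frob_endo_homogeneous nat_mult_grade Frob_grade)

lemma negative_grade_zero: "x \<in> grade A n \<Longrightarrow> n < 0 \<Longrightarrow> x = \<zero>"
  using negative_grade by blast

lemma Frob_endo_mult:
  assumes x: "x \<in> carrier A" and y: "y \<in> carrier A"
  shows "Frob_endo (x \<otimes> y) = Frob_endo x \<otimes> Frob_endo y"
  using x
proof (induction x rule: homogeneous_induct)
  case (homogeneous m x)
  have x: "x \<in> carrier A" using homogeneous grade_carrier by blast
  show ?case using y
  proof (induction y rule: homogeneous_induct)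
    case (homogeneous n y)
    have y: "y \<in> carrier A" using homogeneous grade_carrier by blast
    note xg = \<open>x \<in> grade A m\<close>
    show ?case
    \<comment> \<open>\<open>nat\<close> is additive on nonnegative integers only; in the other case
      one factor is zero.\<close>
    proof (cases "m < 0 \<or> n < 0")
      case True
      hence "x = \<zero> \<or> y = \<zero>" using negative_grade_zero xg homogeneous by blast
      thus ?thesis using x y by (auto simp: Frob_endo_simps)
    next
      case False
      have "Frob_endo (x \<otimes> y) = [(p ^ nat (m + n))] \<cdot> (Frob A x \<otimes> Frob A y)"
        using Frob_endo_homogeneous[OF mult_grade[OF xg homogeneous]] x y by (simp add: F_mult)
      also have "\<dots> = [(p ^ nat m)] \<cdot> Frob A x \<otimes> [(p ^ nat n)] \<cdot> Frob A y"
        using x y False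
        by (simp add: add_pow_ldistr add_pow_rdistr nat_mult_simps(2) F_simps(1) nat_add_distrib power_add mult.commute)
      finally show ?thesis using Frob_endo_homogeneous[OF xg] Frob_endo_homogeneous[OF homogeneous] by simp
    qed
  next
    case (add y z)
    thus ?case using x by (simp add: r_distr Frob_endo_simps(1,2))
  qed
next
  case (add x z)
  thus ?case using y by (simp add: l_distr Frob_endo_simps(1,2))
qed

lemma Frob_endo_d: "x \<in> carrier A \<Longrightarrow> Frob_endo (differential A x) = differential A (Frob_endo x)"
proof (induction x rule: homogeneous_induct)
  case (homogeneous n x)
  have x: "x \<in> carrier A" using homogeneous grade_carrier by blast
  show ?case
  proof (cases "n < 0")
    case True
    thus ?thesis using negative_grade_zero[OF homogeneous] by (simp add: Frob_endo_simps d_simps)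
  next
    case False
    hence "nat (n + 1) = Suc (nat n)" by simp
    hence "Frob_endo (differential A x) = [(p ^ nat n * p)] \<cdot> Frob A (differential A x)"
      using Frob_endo_homogeneous[OF differential_grade[OF homogeneous]] by (simp add: mult.commute)
    also have "\<dots> = [(p ^ nat n)] \<cdot> differential A (Frob A x)"
      using x by (simp add: differential_Frob F_simps(1) d_simps(1) nat_mult_simps(2))
    also have "\<dots> = differential A (Frob_endo x)"
      using Frob_endo_homogeneous[OF homogeneous] x by (simp add: d_simps F_simps(1))
    finally show ?thesis .
  qed
next
  case (add x y)
  thus ?case by (simp add: d_simps(1,2) Frob_endo_simps(1,2))
qed

lemma Frob_endo_F: "x \<in> carrier A \<Longrightarrow> Frob_endo (Frob A x) = Frob A (Frob_endo x)"
proof (induction x rule: homogeneous_induct)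
  case (homogeneous n x)
  have x: "x \<in> carrier A" using homogeneous grade_carrier by blast
  show ?case using Frob_endo_homogeneous[OF homogeneous] Frob_endo_homogeneous[OF Frob_grade[OF homogeneous]] x
    by (simp add: F_simps(1,6))
next
  case (add x y)
  thus ?case by (simp add: F_simps(1,2) Frob_endo_simps(1,2))
qed

lemma Frob_endo_one: "Frob_endo \<one> = \<one>"
  using Frob_endo_homogeneous[OF one_grade] by (simp add: F_one)

lemma Frob_endo_alg_hom: "restrict Frob_endo (carrier A) \<in> dieudonne_alg_hom A A"
  unfolding dieudonne_alg_hom_def
  by (auto intro!: ring_hom_memI simp: Frob_endo_simps(1,2) Frob_endo_mult Frob_endo_one Frob_endo_grade
      Frob_endo_d Frob_endo_F grade_carrier d_simps(1) F_simps(1))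

lemma Frob_endo_cochain_hom: "Frob_endo \<in> cochain_hom A A"
  using Frob_endo_hom Frob_endo_grade Frob_endo_d by (simp add: cochain_hom_def)

lemma Frob_endo_inj_grade:
  assumes "x \<in> grade A n" "y \<in> grade A n" "Frob_endo x = Frob_endo y"
  shows "x = y"
proof -
  have c: "x \<in> carrier A" "y \<in> carrier A" using assms grade_carrier by auto
  have "[(p ^ nat n)] \<cdot> Frob A x = [(p ^ nat n)] \<cdot> Frob A y"
    using assms by (simp add: Frob_endo_homogeneous)
  hence "Frob A x = Frob A y" by (rule p_pow_cancel[OF F_simps(1)[OF c(1)] F_simps(1)[OF c(2)]])
  thus ?thesis by (rule F_inj[OF c])
qed

section \<open>Isogenies and division by p\<close>

lemma localization_p: "localization A (\<lambda>x. [p] \<cdot> x)"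
  by (intro localization.intro localization_axioms.intro abelian_group_axioms)
    (auto simp: hom_def nat_mult_simps(3,6))

lemma mult_p_funpow: "x \<in> carrier A \<Longrightarrow> ((\<lambda>x. [p] \<cdot> x) ^^ k) x = [(p ^ k)] \<cdot> x"
  by (induction k) (auto simp: nat_mult_simps(2))

lemma cochain_hom_cong:
  assumes "f \<in> cochain_hom A A" and fg: "\<And>x. x \<in> carrier A \<Longrightarrow> g x = f x"
  shows "g \<in> cochain_hom A A"
  using assms d_simps(1) grade_carrier by (auto simp: cochain_hom_def hom_def)

text \<open>If f y = p^j x, then x/p^k is the image of y/p^(k+j). Injectivity passes to fractions
  because f commutes with multiplication by p.\<close>

lemma p_isogeny_if_divides:
  assumes f: "f \<in> cochain_hom A A"
    and inj: "\<And>n x y. x \<in> grade A n \<Longrightarrow> y \<in> grade A n \<Longrightarrow> f x = f y \<Longrightarrow> x = y"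
    and surj: "\<And>n x. x \<in> grade A n \<Longrightarrow> \<exists>y\<in>grade A n. \<exists>j. f y = [(p ^ j)] \<cdot> x"
  shows "p_isogeny p A A f"
proof -
  define e where "e = (\<lambda>x. [p] \<cdot> x)"
  interpret L: localization A e unfolding e_def by (rule localization_p)
  have e_pow: "(e ^^ k) x = [(p ^ k)] \<cdot> x" if "x \<in> carrier A" for k x
    unfolding e_def by (rule mult_p_funpow[OF that])
  have fhom: "f \<in> hom (add_monoid A) (add_monoid A)" using f by (simp add: cochain_hom_def)
  note f_simps = additive_hom[OF abelian_group_axioms abelian_group_axioms fhom]
  have f_grade: "f x \<in> grade A n" if "x \<in> grade A n" for x n using f that by (simp add: cochain_hom_def)
  have f_d: "f (differential A x) = differential A (f x)" if "x \<in> carrier A" for x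
    using f that by (simp add: cochain_hom_def)
  let ?F = "loc_map A e f" and ?C = "loc_complex p A"
  have C: "carrier ?C = loc_set A e (carrier A)" "add ?C = loc_add A e"
    "grade ?C = (\<lambda>n. loc_set A e (grade A n))" "differential ?C = loc_map A e (differential A)"
    by (simp_all add: loc_complex_def e_def Let_def)
  have F: "?F (loc_frac A e x k) = loc_frac A e (f x) k" if "x \<in> carrier A" for x k
    by (rule L.loc_map_frac[OF L.localization_axioms]) (use that in \<open>auto simp: f_simps e_def\<close>)
  have D: "differential ?C (loc_frac A e x k) = loc_frac A e (differential A x) k" if "x \<in> carrier A" for x k
    unfolding C by (rule L.loc_map_frac[OF L.localization_axioms]) (use that in \<open>auto simp: d_simps e_def\<close>)
  have mem: "P \<in> loc_set A e X \<longleftrightarrow> (\<exists>x\<in>X. \<exists>k. P = loc_frac A e x k)" for P X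
    by (auto simp: loc_set_def)
  have "?F \<in> cochain_hom ?C ?C"
    unfolding cochain_hom_def
  proof (intro CollectI conjI allI ballI)
    show "?F \<in> hom (add_monoid ?C) (add_monoid ?C)"
    proof (rule homI)
      fix P assume "P \<in> carrier (add_monoid ?C)"
      then obtain x k where x: "x \<in> carrier A" "P = loc_frac A e x k" by (auto simp: C mem)
      show "?F P \<in> carrier (add_monoid ?C)" unfolding x(2) F[OF x(1)] using f_simps(1)[OF x(1)] by (auto simp: C mem)
      fix Q assume "Q \<in> carrier (add_monoid ?C)"
      then obtain y l where y: "y \<in> carrier A" "Q = loc_frac A e y l" by (auto simp: C mem)
      have c: "(e ^^ l) x \<oplus> (e ^^ k) y \<in> carrier A" using x y L.e_pow_simps(1) by simp
      have "?F (P \<oplus>\<^bsub>?C\<^esub> Q) = loc_frac A e (f ((e ^^ l) x \<oplus> (e ^^ k) y)) (k + l)"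
        unfolding x(2) y(2) C L.loc_add_frac[OF x(1) y(1)] by (rule F[OF c])
      also have "f ((e ^^ l) x \<oplus> (e ^^ k) y) = (e ^^ l) (f x) \<oplus> (e ^^ k) (f y)"
        using x y by (simp add: e_pow f_simps nat_mult_simps(6))
      also have "loc_frac A e ((e ^^ l) (f x) \<oplus> (e ^^ k) (f y)) (k + l) = ?F P \<oplus>\<^bsub>?C\<^esub> ?F Q"
        unfolding x(2) y(2) C F[OF x(1)] F[OF y(1)] by (rule L.loc_add_frac[symmetric]) (use x y f_simps in auto)
      finally show "?F (P \<otimes>\<^bsub>add_monoid ?C\<^esub> Q) = ?F P \<otimes>\<^bsub>add_monoid ?C\<^esub> ?F Q" by simp
    qed
    fix n P assume "P \<in> grade ?C n"
    then obtain x k where x: "x \<in> grade A n" "P = loc_frac A e x k" by (auto simp: C mem)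
    show "?F P \<in> grade ?C n" unfolding x(2) F[OF grade_carrier[OF x(1)]] using f_grade[OF x(1)] by (auto simp: C mem)
  next
    fix P assume "P \<in> carrier ?C"
    then obtain x k where x: "x \<in> carrier A" "P = loc_frac A e x k" by (auto simp: C mem)
    show "?F (differential ?C P) = differential ?C (?F P)"
      unfolding x(2) D[OF x(1)] F[OF x(1)] F[OF d_simps(1)[OF x(1)]] D[OF f_simps(1)[OF x(1)]] f_d[OF x(1)] ..
  qed
  moreover have "bij_betw ?F (grade ?C n) (grade ?C n)" for n
  proof (rule bij_betw_imageI)
    show "inj_on ?F (grade ?C n)"
    proof (rule inj_onI)
      fix P Q assume P: "P \<in> grade ?C n" and Q: "Q \<in> grade ?C n" and eq: "?F P = ?F Q"
      obtain x k where x: "x \<in> grade A n" "P = loc_frac A e x k" using P by (auto simp: C mem)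
      obtain y l where y: "y \<in> grade A n" "Q = loc_frac A e y l" using Q by (auto simp: C mem)
      have c: "x \<in> carrier A" "y \<in> carrier A" using x y grade_carrier by auto
      have "loc_frac A e (f x) k = loc_frac A e (f y) l" using eq unfolding x(2) y(2) F[OF c(1)] F[OF c(2)] .
      then obtain m where m: "(e ^^ (m + l)) (f x) = (e ^^ (m + k)) (f y)"
        using L.loc_frac_eq_iff[OF f_simps(1)[OF c(1)] f_simps(1)[OF c(2)]] by blast
      hence "f ([(p ^ (m + l))] \<cdot> x) = f ([(p ^ (m + k))] \<cdot> y)"
        using c by (simp add: e_pow f_simps)
      hence "[(p ^ (m + l))] \<cdot> x = [(p ^ (m + k))] \<cdot> y"
        by (rule inj[OF nat_mult_grade[OF x(1)] nat_mult_grade[OF y(1)]])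
      hence "(e ^^ (m + l)) x = (e ^^ (m + k)) y" using c by (simp add: e_pow)
      thus "P = Q" unfolding x(2) y(2) using L.loc_frac_eq_iff[OF c] by blast
    qed
    show "?F ` grade ?C n = grade ?C n"
    proof (rule equalityI)
      show "?F ` grade ?C n \<subseteq> grade ?C n"
        using calculation by (auto simp: cochain_hom_def)
      show "grade ?C n \<subseteq> ?F ` grade ?C n"
      proof
        fix P assume "P \<in> grade ?C n"
        then obtain x k where x: "x \<in> grade A n" "P = loc_frac A e x k" by (auto simp: C mem)
        obtain y j where y: "y \<in> grade A n" "f y = [(p ^ j)] \<cdot> x" using surj[OF x(1)] by blast
        have c: "x \<in> carrier A" "y \<in> carrier A" using x y grade_carrier by auto
        have "?F (loc_frac A e y (k + j)) = loc_frac A e ((e ^^ j) x) (k + j)"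
          unfolding F[OF c(2)] y(2) e_pow[OF c(1)] ..
        also have "\<dots> = P" unfolding x(2) by (rule L.loc_frac_shift[OF c(1)])
        finally have "P = ?F (loc_frac A e y (k + j))" ..
        moreover have "loc_frac A e y (k + j) \<in> grade ?C n" using y(1) by (auto simp: C mem)
        ultimately show "P \<in> ?F ` grade ?C n" by blast
      qed
    qed
  qed
  ultimately show ?thesis using f unfolding p_isogeny_def cochain_iso_def e_def by simp
qed

lemma Frob_endo_V:
  assumes x: "x \<in> grade A n"
  shows "Frob_endo (V x) = [(p ^ Suc (nat n))] \<cdot> x"
  using Frob_endo_homogeneous[OF V_grade[OF x]] grade_carrier[OF x]
  by (simp add: F_V nat_mult_simps(2) mult.commute)

text \<open>Injectivity in each degree makes the preimage of p^d x unique. Hence a mere choice of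
  preimages is additive and commutes with d: both sides of each identity have the same
  image.\<close>

lemma Frob_endo_factor:
  assumes vanish: "\<And>n. n > int d \<Longrightarrow> grade A n = {\<zero>}"
  shows "\<exists>\<psi>\<in>cochain_hom A A. \<forall>x\<in>carrier A. Frob_endo (\<psi> x) = [(p ^ d)] \<cdot> x"
proof -
  have ex: "\<exists>z. z \<in> grade A n \<and> Frob_endo z = [(p ^ d)] \<cdot> x" if x: "x \<in> grade A n" for n x
  proof -
    have c: "x \<in> carrier A" using x grade_carrier by blast
    consider "n < 0 \<or> n > int d" | "0 \<le> n" "n < int d" | "n = int d" by linarith
    thus ?thesis
    proof cases
      case 1
      hence "x = \<zero>" using negative_grade_zero[OF x] vanish x by blast
      thus ?thesis by (intro exI[of _ \<zero>]) (simp add: Frob_endo_simps(3) nat_mult_simps(7))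
    next
      case 2
      \<comment> \<open>Vx is sent to p^(n+1) x in degree n, and n < d leaves the exponent d - n - 1
        to be supplied.\<close>
      let ?j = "d - Suc (nat n)"
      have j: "d = ?j + Suc (nat n)" using 2 by linarith
      have "Frob_endo ([(p ^ ?j)] \<cdot> V x) = [(p ^ ?j)] \<cdot> ([(p ^ Suc (nat n))] \<cdot> x)"
        unfolding Frob_endo_simps(6)[OF V_carrier[OF c]] Frob_endo_V[OF x] ..
      also have "\<dots> = [(p ^ d)] \<cdot> x" unfolding nat_mult_simps(2)[OF c] power_add[symmetric] j[symmetric] ..
      finally show ?thesis using nat_mult_grade[OF V_grade[OF x]] by blast
    next
      case 3
      \<comment> \<open>Degree d + 1 is zero, so x is closed and hence of the form Fz; the
        coefficient p^d of the map supplies the rest.\<close>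
      have "differential A x = \<zero>" using differential_grade[OF x] vanish[of "n + 1"] 3 by simp
      hence "differential A x = [p] \<cdot> \<zero>" by (simp add: nat_mult_simps(7))
      then obtain z where z: "z \<in> grade A n" "Frob A z = x" using F_surj_grade[OF x zero_closed] by blast
      have "Frob_endo z = [(p ^ d)] \<cdot> x" using Frob_endo_homogeneous[OF z(1)] z(2) 3 by simp
      thus ?thesis using z(1) by blast
    qed
  qed
  define g where "g n x = (SOME z. z \<in> grade A n \<and> Frob_endo z = [(p ^ d)] \<cdot> x)" for n x
  have g: "g n x \<in> grade A n" "Frob_endo (g n x) = [(p ^ d)] \<cdot> x" if "x \<in> grade A n" for n x
    using someI_ex[OF ex[OF that]] unfolding g_def by blast+
  have g_eq: "g n x = z" if "x \<in> grade A n" "z \<in> grade A n" "Frob_endo z = [(p ^ d)] \<cdot> x" for n x z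
    by (rule Frob_endo_inj_grade[OF g(1)[OF that(1)] that(2)]) (simp add: g(2)[OF that(1)] that(3))
  have g_add: "g n (x \<oplus> y) = g n x \<oplus> g n y" if xy: "x \<in> grade A n" "y \<in> grade A n" for n x y
    by (rule g_eq[OF add_grade[OF xy] add_grade[OF g(1)[OF xy(1)] g(1)[OF xy(2)]]])
      (simp add: g(2) xy Frob_endo_simps(2) grade_carrier[OF g(1)] nat_mult_simps(3)[OF grade_carrier[OF xy(1)] grade_carrier[OF xy(2)]])
  define \<psi> where "\<psi> = graded_extension A g"
  have \<psi>_hom: "\<psi> \<in> hom (add_monoid A) (add_monoid A)"
    unfolding \<psi>_def by (rule graded_extension_hom[OF g(1) g_add])
  note \<psi>_simps = additive_hom[OF abelian_group_axioms abelian_group_axioms \<psi>_hom]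
  have \<psi>: "\<psi> x = g n x" if "x \<in> grade A n" for n x
    unfolding \<psi>_def by (rule graded_extension_homogeneous[OF g(1) g_add that])
  have \<psi>_d: "\<psi> (differential A x) = differential A (\<psi> x)" if "x \<in> carrier A" for x
    using that
  proof (induction x rule: homogeneous_induct)
    case (homogeneous n x)
    note dx = differential_grade[OF homogeneous]
    have "g (n + 1) (differential A x) = differential A (g n x)"
      by (rule g_eq[OF dx differential_grade[OF g(1)[OF homogeneous]]])
        (simp add: Frob_endo_d grade_carrier[OF g(1)[OF homogeneous]] g(2)[OF homogeneous] d_simps(6) grade_carrier[OF homogeneous])
    thus ?case unfolding \<psi>[OF homogeneous] \<psi>[OF dx] .
  next
    case (add x y)
    thus ?case by (simp add: \<psi>_simps(1,2) d_simps(1,2))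
  qed
  have "\<psi> \<in> cochain_hom A A"
    using \<psi>_hom \<psi> g(1) \<psi>_d by (simp add: cochain_hom_def)
  moreover have "Frob_endo (\<psi> x) = [(p ^ d)] \<cdot> x" if "x \<in> carrier A" for x
    using that
  proof (induction x rule: homogeneous_induct)
    case (homogeneous n x)
    thus ?case by (simp add: \<psi> g(2))
  next
    case (add x y)
    thus ?case by (simp add: \<psi>_simps(1,2) Frob_endo_simps(2) nat_mult_simps(3))
  qed
  ultimately show ?thesis by blast
qed

end

text \<open>\<open>mod_V_map\<close> is a union over the coset belonging to r. As f commutes with V,
  all elements of this coset have the same image modulo V, so [r] may represent it.\<close>

lemma (in dieudonne_algebra_over) precompose_eq:
  assumes B: "strict_dieudonne_algebra p B" and f: "f \<in> dieudonne_alg_hom A B"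
  shows "precompose p R B \<iota> f = (\<lambda>r\<in>carrier R. (Ver p B ` grade B 0) +>\<^bsub>degree_zero B\<^esub> f (\<tau> r))"
proof -
  interpret B: strict_dieudonne_algebra p B by (rule B)
  have hom: "f \<in> ring_hom A B" using f by (simp add: dieudonne_alg_hom_def)
  hence "f \<in> hom (add_monoid A) (add_monoid B)" by (auto simp: hom_def ring_hom_def)
  note f_simps = additive_hom[OF abelian_group_axioms B.abelian_group_axioms this]
  have fg: "f x \<in> grade B 0" if "x \<in> grade A 0" for x using f that by (simp add: dieudonne_alg_hom_def)
  have "mod_V_map p B f (\<iota> r) = (Ver p B ` grade B 0) +>\<^bsub>degree_zero B\<^esub> f (\<tau> r)" if r: "r \<in> carrier R" for r
  proof -
    have "(Ver p B ` grade B 0) +>\<^bsub>degree_zero B\<^esub> f x = (Ver p B ` grade B 0) +>\<^bsub>degree_zero B\<^esub> f (\<tau> r)"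
      if x: "x \<in> \<iota> r" for x
    proof -
      have xg: "x \<in> grade A 0" using \<iota>_grade[OF r x] .
      obtain u where u: "u \<in> grade A 0" "x \<ominus> \<tau> r = V u" using \<iota>_minus[OF r x Teichmueller_mem[OF r]] by blast
      have "f x \<ominus>\<^bsub>B\<^esub> f (\<tau> r) = f (V u)"
        using f_simps(5)[OF grade_carrier[OF xg] Teichmueller_carrier[OF r]] u(2) by simp
      also have "\<dots> = Ver p B (f u)" by (rule alg_hom_V[OF B f grade_carrier[OF u(1)]])
      finally have "f x \<ominus>\<^bsub>B\<^esub> f (\<tau> r) \<in> Ver p B ` grade B 0" using fg[OF u(1)] by simp
      thus ?thesis using B.mod_V_coset_eq[OF fg[OF xg] fg[OF Teichmueller_grade[OF r]]] by simp
    qed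
    hence "mod_V_map p B f (\<iota> r) = (\<Union>x\<in>\<iota> r. (Ver p B ` grade B 0) +>\<^bsub>degree_zero B\<^esub> f (\<tau> r))"
      unfolding mod_V_map_def by simp
    thus ?thesis using Teichmueller_mem[OF r] by auto
  qed
  thus ?thesis unfolding precompose_def by (intro restrict_ext) simp
qed

section \<open>Consequences of universality\<close>

locale deRham_Witt_complex = dieudonne_algebra_over p A R \<iota>
  for p :: nat and A :: "'a dieudonne" (structure) and R :: "('r, 'k) ring_scheme" (structure)
    and \<iota> :: "'r \<Rightarrow> 'a set" +
  assumes \<iota>_extensional: "\<iota> \<in> extensional (carrier R)"
    and universal: "strict_dieudonne_algebra p (B :: 'a dieudonne) \<Longrightarrow>
      bij_betw (precompose p R B \<iota>) (dieudonne_alg_hom A B) (ring_hom_ext R (mod_V p B))"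
begin

lemma precompose_inj: "inj_on (precompose p R A \<iota>) (dieudonne_alg_hom A A)"
  by (rule bij_betw_imp_inj_on[OF universal]) unfold_locales

text \<open>In degree 0 the map is F, and F[r] = [r]^p = [r^p]; so it induces r |-> r^p modulo V,
  and the uniqueness part of universality identifies it.\<close>

lemma deRham_Witt_map_Frob:
  "deRham_Witt_map p R A \<iota> A \<iota> (\<lambda>r. r [^]\<^bsub>R\<^esub> p) = restrict Frob_endo (carrier A)"
  unfolding deRham_Witt_map_def
proof (rule the_inv_into_f_eq[OF precompose_inj _ Frob_endo_alg_hom])
  have A: "strict_dieudonne_algebra p A" ..
  show "precompose p R A \<iota> (restrict Frob_endo (carrier A)) = (\<lambda>r\<in>carrier R. \<iota> (r [^]\<^bsub>R\<^esub> p))"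
    unfolding precompose_eq[OF A Frob_endo_alg_hom]
  proof (rule restrict_ext)
    fix r assume r: "r \<in> carrier R"
    have "Frob_endo (\<tau> r) = \<tau> (r [^]\<^bsub>R\<^esub> p)"
      using Frob_endo_homogeneous[OF Teichmueller_grade[OF r]] Teichmueller_carrier[OF r]
      by (simp add: F_Teichmueller[OF r] Teichmueller_pow[OF r])
    thus "VA +>\<^bsub>degree_zero A\<^esub> restrict Frob_endo (carrier A) (\<tau> r) = \<iota> (r [^]\<^bsub>R\<^esub> p)"
      using \<iota>_Teichmueller[of "r [^]\<^bsub>R\<^esub> p"] r Teichmueller_carrier[OF r] by simp
  qed
qed

text \<open>The homomorphism r |-> [r] to S^0/VS^0 corresponds to a morphism g from A to the
  restricted algebra. Seen as an endomorphism of A, it induces the same map on R as the identity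
  does, so g is the identity, while its values lie in S.\<close>

lemma carrier_subset_if_closed:
  assumes S: "closed_dieudonne_subalgebra p A S" and \<tau>: "\<tau> ` carrier R \<subseteq> S"
  shows "carrier A \<subseteq> S"
proof -
  interpret S: closed_dieudonne_subalgebra p A S by (rule S)
  interpret B: strict_dieudonne_algebra p S.B by (rule S.restrict_algebra)
  have A: "strict_dieudonne_algebra p A" ..
  let ?VB = "Ver p S.B ` grade S.B 0"
  have \<tau>B: "\<tau> r \<in> grade S.B 0" "\<tau> r \<in> S" if "r \<in> carrier R" for r
    using \<tau> that Teichmueller_grade by (auto simp: S.restrict_simps)
  have VB: "?VB \<subseteq> VA" by (auto simp: S.restrict_simps S.restrict_V)
  define j where "j = (\<lambda>r\<in>carrier R. ?VB +>\<^bsub>degree_zero S.B\<^esub> \<tau> r)"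
  have "j \<in> ring_hom R (mod_V p S.B)"
  proof (rule ring_hom_memI)
    show "j r \<in> carrier (mod_V p S.B)" if "r \<in> carrier R" for r
      using \<tau>B that unfolding B.mod_V_carrier j_def by auto
    show "j (r \<otimes>\<^bsub>R\<^esub> s) = j r \<otimes>\<^bsub>mod_V p S.B\<^esub> j s" if rs: "r \<in> carrier R" "s \<in> carrier R" for r s
      using ring_hom_mult[OF B.mod_V_ring_hom, of "\<tau> r" "\<tau> s"] \<tau>B rs
      by (simp add: j_def B.degree_zero_simps S.restrict_simps(2) Teichmueller_mult)
    show "j \<one>\<^bsub>R\<^esub> = \<one>\<^bsub>mod_V p S.B\<^esub>"
      using ring_hom_one[OF B.mod_V_ring_hom]
      by (simp add: j_def B.degree_zero_simps S.restrict_simps(3) Teichmueller_one)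
    show "j (r \<oplus>\<^bsub>R\<^esub> s) = j r \<oplus>\<^bsub>mod_V p S.B\<^esub> j s" if rs: "r \<in> carrier R" "s \<in> carrier R" for r s
    proof -
      \<comment> \<open>The limit-closed subring S \<inter> A^0 keeps y in S, so that the correction
        Vy vanishes modulo VS^0 and not just modulo VA^0.\<close>
      have "\<exists>y\<in>S \<inter> grade A 0. \<tau> (r \<oplus>\<^bsub>R\<^esub> s) = (\<tau> r \<oplus> \<tau> s) \<oplus> V y"
        by (rule Teichmueller_add[OF rs S.subring_grade_zero])
          (use \<tau>B rs Teichmueller_grade S.V_sum_limit[of _ 0] in auto)
      then obtain y where y: "y \<in> S" "y \<in> grade A 0" "\<tau> (r \<oplus>\<^bsub>R\<^esub> s) = (\<tau> r \<oplus> \<tau> s) \<oplus> V y" by blast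
      have rs': "r \<oplus>\<^bsub>R\<^esub> s \<in> carrier R" using rs by simp
      let ?x = "\<tau> r \<oplus> \<tau> s"
      have x: "?x \<in> grade S.B 0" "?x \<in> S"
        using B.add_grade[OF \<tau>B(1)[OF rs(1)] \<tau>B(1)[OF rs(2)]] by (auto simp: S.restrict_simps)
      have "\<tau> (r \<oplus>\<^bsub>R\<^esub> s) \<ominus>\<^bsub>S.B\<^esub> ?x = V y"
        unfolding S.restrict_minus[OF \<tau>B(2)[OF rs'] x(2)] unfolding y(3)
        using Teichmueller_carrier[OF rs(1)] Teichmueller_carrier[OF rs(2)] V_carrier[OF grade_carrier[OF y(2)]]
        by (subst a_comm) (simp_all add: add_minus_cancel(3))
      also have "\<dots> = Ver p S.B y" by (rule S.restrict_V[OF y(1), symmetric])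
      also have "\<dots> \<in> ?VB" using y by (simp add: S.restrict_simps)
      finally have "?VB +>\<^bsub>degree_zero S.B\<^esub> \<tau> (r \<oplus>\<^bsub>R\<^esub> s) = ?VB +>\<^bsub>degree_zero S.B\<^esub> ?x"
        using B.mod_V_coset_eq[OF \<tau>B(1)[OF rs'] x(1)] by simp
      thus ?thesis using ring_hom_add[OF B.mod_V_ring_hom, of "\<tau> r" "\<tau> s"] \<tau>B rs rs'
        by (simp add: j_def B.degree_zero_simps S.restrict_simps(5))
    qed
  qed
  hence "j \<in> ring_hom_ext R (mod_V p S.B)" by (simp add: ring_hom_ext_def j_def)
  then obtain g where g: "g \<in> dieudonne_alg_hom A S.B" "precompose p R S.B \<iota> g = j"
    using bij_betw_imp_surj_on[OF universal[OF S.restrict_algebra]] by (metis imageE)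
  have gS: "g x \<in> S" if "x \<in> carrier A" for x
    using g(1) that ring_hom_closed[of g A S.B x] by (simp add: dieudonne_alg_hom_def S.restrict_simps(1))
  have gA: "g \<in> dieudonne_alg_hom A A"
    using g(1) S.mem_carrier unfolding dieudonne_alg_hom_def ring_hom_def by (auto simp: S.restrict_simps)
  let ?id = "restrict (\<lambda>x. x) (carrier A)"
  have idA: "?id \<in> dieudonne_alg_hom A A"
    unfolding dieudonne_alg_hom_def ring_hom_def using d_simps(1) F_simps(1) grade_carrier by auto
  have "precompose p R A \<iota> g = precompose p R A \<iota> ?id"
    unfolding precompose_eq[OF A gA] precompose_eq[OF A idA]
  proof (rule restrict_ext)
    fix r assume r: "r \<in> carrier R"
    have gB: "g (\<tau> r) \<in> grade S.B 0" using g(1) Teichmueller_grade[OF r] by (simp add: dieudonne_alg_hom_def)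
    have "?VB +>\<^bsub>degree_zero S.B\<^esub> g (\<tau> r) = ?VB +>\<^bsub>degree_zero S.B\<^esub> \<tau> r"
      using fun_cong[OF g(2), of r] r unfolding precompose_eq[OF S.restrict_algebra g(1)] j_def by simp
    hence "g (\<tau> r) \<ominus>\<^bsub>S.B\<^esub> \<tau> r \<in> ?VB" using B.mod_V_coset_eq[OF gB \<tau>B(1)[OF r]] by simp
    \<comment> \<open>Congruence modulo VS^0 implies congruence modulo VA^0, as V of the restricted
      algebra is the restriction of V.\<close>
    hence "g (\<tau> r) \<ominus> \<tau> r \<in> VA"
      using VB S.restrict_minus[of "g (\<tau> r)" "\<tau> r"] gS[OF Teichmueller_carrier[OF r]] \<tau>B(2)[OF r] by auto
    hence "VA +>\<^bsub>degree_zero A\<^esub> g (\<tau> r) = VA +>\<^bsub>degree_zero A\<^esub> \<tau> r"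
      using mod_V_coset_eq[OF _ Teichmueller_grade[OF r], of "g (\<tau> r)"] gB by (simp add: S.restrict_simps(6))
    thus "VA +>\<^bsub>degree_zero A\<^esub> g (\<tau> r) = VA +>\<^bsub>degree_zero A\<^esub> ?id (\<tau> r)"
      using Teichmueller_carrier[OF r] by simp
  qed
  hence "g = ?id" by (rule inj_onD[OF precompose_inj _ gA idA])
  thus ?thesis using gS by fastforce
qed

lemma grade_vanishes_above:
  assumes "locally_generated_by_at_most R (Kaehler R) d" and n: "n > int d"
  shows "grade A n = {\<zero>}"
proof (rule grade_vanishes)
  obtain S where S: "closed_dieudonne_subalgebra p A S" "\<tau> ` carrier R \<subseteq> S"
    "\<forall>n>int d. S \<inter> grade A n \<subseteq> Fil 1"
    using closed_bounded_subalgebra[OF assms(1)] by blast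
  show "grade A n \<subseteq> Fil 1"
    using carrier_subset_if_closed[OF S(1,2)] S(3) n grade_carrier by blast
qed

end

theorem corollary9p3p5:
  fixes p :: nat
    and R :: "('r, 'm) ring_scheme"
    and W :: "'w dieudonne"
    and \<iota> :: "'r \<Rightarrow> 'w set"
  assumes "Factorial_Ring.prime p"
    and "Fp_algebra p R"
    and "saturated_deRham_Witt p R W \<iota>"
  shows "let \<phi> = deRham_Witt_map p R W \<iota> W \<iota> (\<lambda>r. r [^]\<^bsub>R\<^esub> p) in
    p_isogeny p W W \<phi> \<and>
    (\<forall>d. locally_generated_by_at_most R (Kaehler R) d \<longrightarrow>
      (\<exists>\<psi>\<in>cochain_hom W W. \<forall>x\<in>carrier W. \<phi> (\<psi> x) = [(p ^ d)] \<cdot>\<^bsub>W\<^esub> x))"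
proof -
  have W: "strict_dieudonne_algebra p W" and \<iota>: "\<iota> \<in> ring_hom R (mod_V p W)" "\<iota> \<in> extensional (carrier R)"
    and univ: "\<And>B :: 'w dieudonne. strict_dieudonne_algebra p B \<Longrightarrow>
      bij_betw (precompose p R B \<iota>) (dieudonne_alg_hom W B) (ring_hom_ext R (mod_V p B))"
    using assms(3) unfolding saturated_deRham_Witt_def ring_hom_ext_def by blast+
  have R: "cring R" using assms(2) by (simp add: Fp_algebra_def)
  interpret W: deRham_Witt_complex p W R \<iota>
    by (intro deRham_Witt_complex.intro dieudonne_algebra_over.intro dieudonne_algebra_over_axioms.intro
        deRham_Witt_complex_axioms.intro W R assms(1) \<iota> univ)
  \<comment> \<open>Morphisms are extensional functions, hence the restriction.\<close>
  let ?\<phi> = "restrict W.Frob_endo (carrier W)"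
  have \<phi>: "?\<phi> x = W.Frob_endo x" if "x \<in> carrier W" for x using that by simp
  have "p_isogeny p W W ?\<phi>"
  proof (rule W.p_isogeny_if_divides)
    show "?\<phi> \<in> cochain_hom W W" by (rule W.cochain_hom_cong[OF W.Frob_endo_cochain_hom \<phi>])
    show "x = y" if "x \<in> grade W n" "y \<in> grade W n" "?\<phi> x = ?\<phi> y" for n x y
      using W.Frob_endo_inj_grade[OF that(1,2)] that W.grade_carrier by simp
    \<comment> \<open>The witness is y = Vx, which is sent to p^(n+1) x.\<close>
    show "\<exists>y\<in>grade W n. \<exists>j. ?\<phi> y = [(p ^ j)] \<cdot>\<^bsub>W\<^esub> x" if x: "x \<in> grade W n" for n x
      using W.Frob_endo_V[OF x] W.V_grade[OF x] W.grade_carrier[OF W.V_grade[OF x]]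
      by (intro bexI[of _ "W.V x"] exI[of _ "Suc (nat n)"]) simp_all
  qed
  moreover have "\<exists>\<psi>\<in>cochain_hom W W. \<forall>x\<in>carrier W. ?\<phi> (\<psi> x) = [(p ^ d)] \<cdot>\<^bsub>W\<^esub> x"
    if d: "locally_generated_by_at_most R (Kaehler R) d" for d
  proof -
    obtain \<psi> where \<psi>: "\<psi> \<in> cochain_hom W W" "\<forall>x\<in>carrier W. W.Frob_endo (\<psi> x) = [(p ^ d)] \<cdot>\<^bsub>W\<^esub> x"
      using W.Frob_endo_factor[OF W.grade_vanishes_above[OF d]] by blast
    have "\<psi> x \<in> carrier W" if "x \<in> carrier W" for x
      using \<psi>(1) that by (auto simp: cochain_hom_def hom_def)
    thus ?thesis using \<psi> by (intro bexI[of _ \<psi>]) auto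
  qed
  ultimately show ?thesis unfolding W.deRham_Witt_map_Frob Let_def by blast
qed

end
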